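(* The function $\xi_{\mathbb Q}(w,s)=\frac{s(s-w)}{2w}Z_{\mathbb Q}(w,s)$ extends to an entire function of the two complex variables $(w,s)\in\mathbb C^2$. Its value at $w=0$ is $$\xi_{\mathbb Q}(0,s)=-\frac{s^2}{8}\bigl(1-2^{1+\frac s2}\bigr)\bigl(1-2^{1-\frac s2}\bigr)\hat\zeta\!\left(\tfrac s2\right)\hat\zeta\!\left(-\tfrac s2\right)\qquad(s\in\mathbb C),$$ where $\hat\zeta(s)=\pi^{-s/2}\Gamma(s/2)\zeta(s)$ is the completed Riemann zeta function. In particular, for all real $t$, $$\xi_{\mathbb Q}(0,it)=\frac{t^2}{8}\,\bigl|1-2^{1+\frac{it}{2}}\bigr|^2\,\bigl|\hat\zeta(\tfrac{it}{2})\bigr|^2$$ is strictly positive, and $\xi_{\mathbb Q}(0,0)=1/2$.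
   Context: Let $\theta(t)=\sum_{n\in\mathbb Z}e^{-\pi n^2 t}$ for $t>0$ (so $\theta(t)>0$). The two-variable zeta function of $\mathbb Q$ is defined on the open cone $\{(w,s)\in\mathbb C^2:\Re(w)<\Re(s)<0\}$ by the absolutely convergent integral $$Z_{\mathbb Q}(w,s)=\int_0^\infty \theta(t^2)^s\,\theta(1/t^2)^{w-s}\,\frac{dt}{t},$$ and is extended to $\mathbb C^2$ by meromorphic continuation. $\zeta$ is the Riemann zeta function. At points where the displayed formulas involve removable singularities (e.g. $t=0$), they are understood by continuity. *)

theory Defs
  imports "HOL-Complex_Analysis.Complex_Analysis"
begin

definition riemann_theta :: "real \<Rightarrow> real" where
  "riemann_theta t = (\<Sum>\<^sub>\<infinity>n::int. exp (- pi * (of_int n)\<^sup>2 * t))"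

text \<open>The value at the pole \<open>1\<close> is fixed to be \<open>0\<close> only to make the meromorphic
  continuation unique as a total function.\<close>

definition riemann_zeta :: "complex \<Rightarrow> complex" where
  "riemann_zeta = (THE f. f holomorphic_on - {1} \<and> f 1 = 0 \<and>
     (\<forall>s. Re s > 1 \<longrightarrow> (\<lambda>n. 1 / of_nat (Suc n) powr s) sums f s))"

text \<open>\<^const>\<open>remove_sings\<close> is needed at \<open>s = -2, -4, \<dots>\<close>, where the poles of the
  Gamma factor cancel against zeros of zeta; it gives \<open>0\<close> at the poles \<open>0\<close> and \<open>1\<close>.\<close>

definition completed_zeta :: "complex \<Rightarrow> complex" where
  "completed_zeta =
     remove_sings (\<lambda>s. of_real pi powr (- s / 2) * Gamma (s / 2) * riemann_zeta s)"

text \<open>Functions of two complex variables are functions on pairs; holomorphy means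
  that the Frechet derivative exists and is complex linear.\<close>

definition holomorphic2_on :: "(complex \<times> complex \<Rightarrow> complex) \<Rightarrow> (complex \<times> complex) set \<Rightarrow> bool" where
  "holomorphic2_on f D \<longleftrightarrow>
     (\<forall>p\<in>D. \<exists>a b. (f has_derivative (\<lambda>h. a * fst h + b * snd h)) (at p within D))"

text \<open>A meromorphic function on \<open>\<complex>\<^sup>2\<close> is locally a quotient of holomorphic functions
  with denominator not identically zero. Here \<open>F\<close> is only meaningful on the open set
  \<open>D\<close>, where it is holomorphic; locally the complement of \<open>D\<close> is contained in the zero
  set of a denominator, hence nowhere dense.\<close>

definition meromorphic2 :: "(complex \<times> complex) set \<Rightarrow> (complex \<times> complex \<Rightarrow> complex) \<Rightarrow> bool" where
  "meromorphic2 D F \<longleftrightarrow> open D \<and> holomorphic2_on F D \<and>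
     (\<forall>p. \<exists>r>0. \<exists>g h. holomorphic2_on g (ball p r) \<and> holomorphic2_on h (ball p r) \<and>
        (\<exists>q\<in>ball p r. h q \<noteq> 0) \<and>
        (\<forall>q\<in>ball p r. h q \<noteq> 0 \<longrightarrow> q \<in> D \<and> F q = g q / h q))"

definition ZQ_cone :: "(complex \<times> complex) set" where
  "ZQ_cone = {(w, s). Re w < Re s \<and> Re s < 0}"

definition ZQ_integral :: "complex \<Rightarrow> complex \<Rightarrow> complex" where
  "ZQ_integral w s = (LINT t:{0<..}|lborel.
     complex_of_real (riemann_theta (t\<^sup>2)) powr s *
     complex_of_real (riemann_theta (1 / t\<^sup>2)) powr (w - s) / complex_of_real t)"

text \<open>\<open>Z\<close>, with domain \<open>D\<close>, is the meromorphic continuation of the integral to \<open>\<complex>\<^sup>2\<close>;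
  by the identity theorem it is unique up to the choice of \<open>D\<close>.\<close>

definition is_ZQ :: "(complex \<times> complex) set \<Rightarrow> (complex \<times> complex \<Rightarrow> complex) \<Rightarrow> bool" where
  "is_ZQ D Z \<longleftrightarrow> meromorphic2 D Z \<and> ZQ_cone \<subseteq> D \<and>
     (\<forall>(w, s)\<in>ZQ_cone. Z (w, s) = ZQ_integral w s)"

end

theory Submission
  imports Defs
begin

text \<open>
  Substituting \<open>t = exp u\<close>, folding the line at \<open>u = 0\<close> and using \<open>\<theta>(1/x) = \<surd>x \<theta>(x)\<close> gives
  \<open>Z(w,s) = w G(w,s) + w / (s (s - w))\<close>, where with \<open>L u = ln \<theta>(exp (2 u))\<close>
  \<open>G(w,s) = \<integral>\<^sub>0 ((exp (w L) - 1) / w) (exp (s u) + exp ((w - s) u)) du\<close>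
  is entire because \<open>L\<close> decays doubly exponentially. Hence \<open>\<xi>(w,s) = 1/2 + s (s - w) G(w,s) / 2\<close>.
  The same function yields the completed zeta function, \<open>\<zeta>^(s) = G(1,s) + 1 / (s (s - 1))\<close>,
  and the symmetry of \<open>G\<close> in \<open>s\<close> and \<open>w - s\<close> is its functional equation.

  At \<open>w = 0\<close> the integral is the Mellin transform of \<open>ln \<theta>\<close>. By Jacobi's product,
  \<open>\<theta> = \<phi>(q\<^sup>2)^5 / (\<phi>(q)^2 \<phi>(q^4)^2)\<close> with \<open>\<phi>(q) = \<Prod> (1 - q^n)\<close>, and \<open>- ln \<phi>\<close> has Mellin
  transform a Gamma factor times \<open>\<zeta>(s/2) \<zeta>(s/2 + 1)\<close>; Legendre's duplication formula
  turns this into the stated expression for large \<open>Re s\<close>, hence everywhere. Positivity on the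
  imaginary axis is the non-vanishing of \<open>\<zeta>\<close> on \<open>Re s = 1\<close>.

  The transformation formula of \<open>\<theta>\<close> is obtained by Polya's method: averaging
  \<open>(2 cos (\<pi> \<nu> / l))^(2m)\<close> over \<open>\<nu>\<close> modulo \<open>l\<close> picks out every \<open>l\<close>-th binomial coefficient, and
  both sides converge to theta series as \<open>l\<close> tends to infinity with \<open>l\<^sup>2 / m\<close> tending to \<open>\<pi> x\<close>.
\<close>

section \<open>The transformation formula of the theta function\<close>

text \<open>The continuation is given only as an unspecified pair (D, Z), locally a quotient, and xi
  divides Z by w, so nothing about w = 0 can be read off Z. Hence xi is built from G by a formula
  without division by w, and its relation to Z is proved in the cleared form 2 w xi = s (s - w) Z,
  which an identity theorem in two variables carries from the cone to all of D. The factors 1 - 2^(1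
  + s/2) and 1 - 2^(1 - s/2) come from the exponents in Jacobi's product: the scalings 1, 2, 4 of
  the argument of phi contribute 2 - 5 x + 2 x^2 with x = 2^(-s/2), a quadratic with the roots 2 and
  1/2. The factor zeta(s/2 + 1) appears as the completed zeta function at -s/2 after the functional
  equation. Polya's identity is exact and finite on both sides, so the transformation formula needs
  only dominated convergence with Gaussian majorants and the size of the central binomial
  coefficient.\<close>

lemma infsum_dominated_convergence:
  fixes f :: "nat \<Rightarrow> 'i \<Rightarrow> 'b :: {banach, second_countable_topology}" and M :: "'i \<Rightarrow> real"
  assumes lim: "\<And>i. (\<lambda>n. f n i) \<longlonglongrightarrow> g i"
    and bound: "\<And>n i. norm (f n i) \<le> M i" and M: "M summable_on UNIV"
  shows "(\<lambda>n. \<Sum>\<^sub>\<infinity>i. f n i) \<longlonglongrightarrow> (\<Sum>\<^sub>\<infinity>i. g i)"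
proof -
  \<comment> \<open>A bound for norms is nonnegative, so summability of \<open>M\<close> is absolute
    summability, that is, integrability for the counting measure.\<close>
  have "norm (M i) = M i" for i using order_trans[OF norm_ge_zero bound] by simp
  then have Mint: "integrable (count_space UNIV) M"
    using M
    by (metis abs_summable_equivalent abs_summable_on_def summable_on_iff_abs_summable_on_real)
  have f_int: "integrable (count_space UNIV) (f n)" for n
    by (rule Bochner_Integration.integrable_bound[OF Mint])
       (auto intro!: AE_I2 order.trans[OF bound] abs_ge_self)
  have g_bound: "norm (g i) \<le> M i" for i
    by (rule tendsto_upperbound[OF tendsto_norm[OF lim]]) (use bound in auto)
  have g_int: "integrable (count_space UNIV) g"
    by (rule Bochner_Integration.integrable_bound[OF Mint])
       (auto intro!: AE_I2 order.trans[OF g_bound] abs_ge_self)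
  have eq: "infsum h UNIV = lebesgue_integral (count_space UNIV) h"
    if "integrable (count_space UNIV) h" for h :: "'i \<Rightarrow> 'b"
    using that infsetsum_infsum[of h UNIV] abs_summable_equivalent[of h UNIV]
    by (simp add: infsetsum_def abs_summable_on_def)
  have "(\<lambda>n. lebesgue_integral (count_space UNIV) (f n)) \<longlonglongrightarrow> lebesgue_integral (count_space UNIV) g"
    by (rule integral_dominated_convergence[OF _ _ Mint]) (auto intro!: AE_I2 lim bound)
  then show ?thesis by (simp add: eq f_int g_int)
qed

lemma has_sum_int_even:
  fixes f :: "int \<Rightarrow> real"
  assumes even: "\<And>n. f (- n) = f n"
    and S: "((\<lambda>n::nat. f (int (Suc n))) has_sum S) UNIV"
  shows "(f has_sum (f 0 + 2 * S)) UNIV"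
proof -
  have p: "(f has_sum S) (range (\<lambda>n. int (Suc n)))"
    by (subst has_sum_reindex) (use S in \<open>auto simp: inj_def o_def\<close>)
  have n: "(f has_sum S) (range (\<lambda>n. - int (Suc n)))"
  proof (subst has_sum_reindex)
    have "f (- int (Suc n)) = f (int (Suc n))" for n by (rule even)
    then show "((f \<circ> (\<lambda>n. - int (Suc n))) has_sum S) UNIV"
      using S by (simp only: o_def)
  qed (auto simp: inj_def)
  have pn: "(f has_sum (S + S)) (range (\<lambda>n. int (Suc n)) \<union> range (\<lambda>n. - int (Suc n)))"
    by (rule has_sum_Un_disjoint[OF p n]) auto
  have z: "(f has_sum f 0) {0}" by (rule has_sum_finiteI) auto
  have all: "(f has_sum (f 0 + (S + S))) ({0} \<union> (range (\<lambda>n. int (Suc n)) \<union> range (\<lambda>n. - int (Suc n))))"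
    by (rule has_sum_Un_disjoint[OF z pn]) auto
  have "n \<in> {0} \<union> (range (\<lambda>n. int (Suc n)) \<union> range (\<lambda>n. - int (Suc n)))" for n :: int
  proof (cases n rule: linorder_cases[of _ 0])
    case less
    then have "n = - int (Suc (nat (- n - 1)))" by simp
    then show ?thesis by blast
  next
    case greater
    then have "n = int (Suc (nat (n - 1)))" by simp
    then show ?thesis by blast
  qed auto
  then have "{0} \<union> (range (\<lambda>n. int (Suc n)) \<union> range (\<lambda>n. - int (Suc n))) = UNIV" by blast
  with all show ?thesis by (simp only: mult_2)
qed

lemma summable_exp_neg_Suc_square:
  fixes a :: real
  assumes "a > 0"
  shows "(\<lambda>n::nat. exp (- a * real (Suc n) ^ 2)) summable_on UNIV"
proof (rule summable_on_comparison_test)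
  have "summable (\<lambda>n::nat. exp (- a) ^ n)"
    using assms by (intro summable_geometric) auto
  then show "(\<lambda>n::nat. exp (- a) ^ n) summable_on UNIV"
    by (rule summable_nonneg_imp_summable_on) auto
  have "real n \<le> real (Suc n) ^ 2" for n
    by (simp add: power2_eq_square algebra_simps)
  then show "exp (- a * real (Suc n) ^ 2) \<le> exp (- a) ^ n" for n
    using assms by (simp flip: exp_of_nat_mult)
qed auto

lemma summable_exp_neg_square:
  fixes a :: real
  assumes "a > 0"
  shows "(\<lambda>n::int. exp (- a * (of_int n)\<^sup>2)) summable_on UNIV"
  using has_sum_int_even[of "\<lambda>n. exp (- a * (of_int n)\<^sup>2)"]
    summable_exp_neg_Suc_square[OF assms]
  by (simp add: summable_on_def) blast

text \<open>Orthogonality of characters modulo \<open>l\<close>. The centred residues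
  \<open>j - r\<close> only contribute a common phase to a geometric sum of powers of the root of
  unity \<open>w\<close>.\<close>

lemma sum_cis_roots_of_unity:
  fixes d :: int
  assumes l: "l = 2 * r + 1"
  shows "(\<Sum>j<l. cis (2 * pi * (real j - real r) * d / l)) = (if int l dvd d then of_nat l else 0)"
proof -
  define w where "w = cis (2 * pi * d / l)"
  have l0: "real l > 0" using l by simp
  have term_eq: "cis (2 * pi * (real j - real r) * d / l) = cis (- 2 * pi * r * d / l) * w ^ j" for j
  proof -
    have "w ^ j = cis (real j * (2 * pi * d / l))" by (simp only: w_def Complex.DeMoivre)
    then show ?thesis using l0 by (simp add: cis_mult field_simps)
  qed
  have wl: "w ^ l = 1"
  proof -
    have "w ^ l = cis (real l * (2 * pi * d / l))" by (simp only: w_def Complex.DeMoivre)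
    also have "real l * (2 * pi * d / l) = 2 * pi * of_int d" using l0 by simp
    finally show ?thesis by (metis cis_multiple_2pi Ints_of_int)
  qed
  have w1: "w = 1 \<longleftrightarrow> int l dvd d"
  proof
    assume "w = 1"
    then have "exp (\<i> * complex_of_real (2 * pi * d / l)) = 1" by (simp add: w_def cis_conv_exp)
    then obtain n :: int where "2 * pi * d / l = of_int (2 * n) * pi"
      by (auto simp: exp_eq_1)
    then have "of_int d = (of_int n * real l)" using l0 by (simp add: field_simps)
    then have "d = n * int l" by (metis of_int_eq_iff of_int_mult of_int_of_nat_eq)
    then show "int l dvd d" by simp
  next
    assume "int l dvd d"
    then obtain n where "d = int l * n" by blast
    then have "2 * pi * d / l = 2 * pi * of_int n" using l0 by simp
    then show "w = 1" unfolding w_def by (metis cis_multiple_2pi Ints_of_int)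
  qed
  show ?thesis
  proof (cases "int l dvd d")
    case True
    then obtain n where n: "d = int l * n" by blast
    then have "- 2 * pi * r * d / l = 2 * pi * of_int (- int r * n)" using l0 by simp
    then have "cis (- 2 * pi * r * d / l) = 1" by (metis cis_multiple_2pi Ints_of_int)
    moreover have "w = 1" using w1 True by simp
    ultimately show ?thesis using True by (simp only: term_eq) simp
  next
    case False
    then have "w \<noteq> 1" using w1 by simp
    then have "(\<Sum>j<l. w ^ j) = 0" using wl by (simp add: geometric_sum)
    then show ?thesis using False by (simp add: term_eq flip: sum_distrib_left)
  qed
qed

text \<open>With 2 cos x = cis x + cis (-x), the k-th term of the binomial expansion has frequency 2
  (k - m); averaging over the residues keeps exactly the k with \<open>l\<close> dividing k - m.
  These are k = m + j l, and the symmetry of binomial coefficients permits the absolute value. The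
  odd modulus gives a window symmetric about 0 with |\<nu> / l| < 1/2, where the cosine is
  positive.\<close>

lemma sum_cos_power_lattice:
  assumes l: "l = 2 * r + 1"
  shows "(\<Sum>\<nu>\<in>{- int r..int r}. cos (pi * of_int \<nu> / l) ^ (2 * m))
       = l / 4 ^ m * (\<Sum>j\<in>{j. \<bar>j * int l\<bar> \<le> int m}. real ((2 * m) choose (m + nat \<bar>j * int l\<bar>)))"
proof -
  have l0: "real l > 0" using l by simp
  have pow: "(2 * complex_of_real (cos x)) ^ (2 * m)
      = (\<Sum>k\<le>2 * m. of_nat ((2 * m) choose k) * cis (2 * x * of_int (int k - int m)))" for x
  proof -
    have "2 * complex_of_real (cos x) = cis x + cis (- x)"
      by (simp add: complex_eq_iff)
    then have "(2 * complex_of_real (cos x)) ^ (2 * m)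
      = (\<Sum>k\<le>2 * m. of_nat ((2 * m) choose k) * cis x ^ k * cis (- x) ^ (2 * m - k))"
      by (simp add: binomial_ring)
    also have "\<dots> = (\<Sum>k\<le>2 * m. of_nat ((2 * m) choose k) * cis (2 * x * of_int (int k - int m)))"
    proof (intro sum.cong refl)
      fix k assume "k \<in> {..2 * m}"
      then have "cis x ^ k * cis (- x) ^ (2 * m - k) = cis (2 * x * of_int (int k - int m))"
        by (simp only: Complex.DeMoivre cis_mult) (simp add: of_nat_diff algebra_simps)
      then show "of_nat ((2 * m) choose k) * cis x ^ k * cis (- x) ^ (2 * m - k)
          = of_nat ((2 * m) choose k) * cis (2 * x * of_int (int k - int m))"
        by (simp only: mult.assoc)
    qed
    finally show ?thesis .
  qed
  have "(\<Sum>\<nu>\<in>{- int r..int r}. cos (pi * of_int \<nu> / l) ^ (2 * m))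
      = (\<Sum>j<l. cos (pi * (real j - real r) / l) ^ (2 * m))"
    by (rule sum.reindex_bij_witness[of _ "\<lambda>j. int j - int r" "\<lambda>\<nu>. nat (\<nu> + int r)"]) (use l in auto)
  then have "complex_of_real (4 ^ m * (\<Sum>\<nu>\<in>{- int r..int r}. cos (pi * of_int \<nu> / l) ^ (2 * m)))
      = (\<Sum>j<l. (2 * complex_of_real (cos (pi * (real j - real r) / l))) ^ (2 * m))"
    by (simp add: power_mult_distrib power_mult sum_distrib_left)
  also have "\<dots> = (\<Sum>k\<le>2 * m. \<Sum>j<l. of_nat ((2 * m) choose k) *
       cis (2 * pi * (real j - real r) * of_int (int k - int m) / l))"
    unfolding pow by (subst sum.swap) (simp add: mult.assoc)
  also have "\<dots> = (\<Sum>k\<le>2 * m. of_nat ((2 * m) choose k) * (if int l dvd int k - int m then of_nat l else 0))"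
    by (simp only: sum_distrib_left[symmetric] sum_cis_roots_of_unity[OF l])
  also have "\<dots> = of_nat l * (\<Sum>k\<in>{k. k \<le> 2 * m \<and> int l dvd int k - int m}. of_nat ((2 * m) choose k))"
    unfolding sum_distrib_left
    by (intro sum.mono_neutral_cong_right) auto
  also have "(\<Sum>k\<in>{k. k \<le> 2 * m \<and> int l dvd int k - int m}. of_nat ((2 * m) choose k))
      = (\<Sum>j\<in>{j. \<bar>j * int l\<bar> \<le> int m}. complex_of_nat ((2 * m) choose (m + nat \<bar>j * int l\<bar>)))"
  proof (rule sum.reindex_bij_witness[of _ "\<lambda>j. nat (int m + j * int l)" "\<lambda>k. (int k - int m) div int l"])
    fix k assume k: "k \<in> {k. k \<le> 2 * m \<and> int l dvd int k - int m}"
    then have e: "(int k - int m) div int l * int l = int k - int m" by simp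
    show "nat (int m + (int k - int m) div int l * int l) = k" unfolding e by simp
    show "(int k - int m) div int l \<in> {j. \<bar>j * int l\<bar> \<le> int m}" using k unfolding mem_Collect_eq e by auto
    show "of_nat ((2 * m) choose (m + nat \<bar>(int k - int m) div int l * int l\<bar>)) = complex_of_nat ((2 * m) choose k)"
    proof (cases "k \<ge> m")
      case True
      then show ?thesis unfolding e by (simp add: nat_diff_distrib')
    next
      case False
      then have "m + nat \<bar>int k - int m\<bar> = 2 * m - k" by simp
      moreover have "k \<le> 2 * m" using k by simp
      ultimately show ?thesis unfolding e by (metis binomial_symmetric)
    qed
  next
    fix j assume j: "j \<in> {j. \<bar>j * int l\<bar> \<le> int m}"
    then have e: "int (nat (int m + j * int l)) = int m + j * int l" by (auto simp: abs_le_iff)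
    show "(int (nat (int m + j * int l)) - int m) div int l = j" unfolding e using l0 by simp
    show "nat (int m + j * int l) \<in> {k. k \<le> 2 * m \<and> int l dvd int k - int m}"
      using j unfolding mem_Collect_eq e by auto
  qed
  also have "of_nat l * (\<Sum>j\<in>{j. \<bar>j * int l\<bar> \<le> int m}. complex_of_nat ((2 * m) choose (m + nat \<bar>j * int l\<bar>)))
    = complex_of_real (l * (\<Sum>j\<in>{j. \<bar>j * int l\<bar> \<le> int m}. real ((2 * m) choose (m + nat \<bar>j * int l\<bar>))))"
    by simp
  finally have "4 ^ m * (\<Sum>\<nu>\<in>{- int r..int r}. cos (pi * of_int \<nu> / l) ^ (2 * m))
     = l * (\<Sum>j\<in>{j. \<bar>j * int l\<bar> \<le> int m}. real ((2 * m) choose (m + nat \<bar>j * int l\<bar>)))"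
    by (simp only: of_real_eq_iff)
  then show ?thesis by (simp add: field_simps)
qed

section \<open>Asymptotics of central and near-central binomial coefficients\<close>

lemma central_binomial_wallis:
  "(\<Prod>k=1..n. (4 * real k^2) / (4 * real k^2 - 1)) = (4 ^ n / real ((2 * n) choose n))\<^sup>2 / (2 * n + 1)"
proof (induction n)
  case (Suc n)
  have "((2 * Suc n) choose Suc n) * Suc n = (2 * n + 2) * (Suc (2 * n) choose n)"
    using Suc_times_binomial_eq[of "Suc (2 * n)" n] by simp
  moreover have "(Suc (2 * n) choose n) * Suc n = (2 * n + 1) * ((2 * n) choose n)"
    using Suc_times_binomial_eq[of "2 * n" n] binomial_symmetric[of n "Suc (2 * n)"] by simp
  ultimately have "((2 * Suc n) choose Suc n) * Suc n ^ 2 = (2 * n + 1) * (2 * n + 2) * ((2 * n) choose n)"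
    by (metis (no_types, lifting) mult.assoc mult.commute power2_eq_square)
  then have "real ((2 * Suc n) choose Suc n) * real (Suc n) ^ 2
      = real (2 * n + 1) * real (2 * n + 2) * real ((2 * n) choose n)"
    by (metis of_nat_mult of_nat_power)
  moreover have "a = 2 * (2 * real n + 1) / (real n + 1) * b"
    if "a * real (Suc n) ^ 2 = real (2 * n + 1) * real (2 * n + 2) * b" for a b
  proof -
    have "(a * (real n + 1)) * (real n + 1) = (2 * (2 * real n + 1) * b) * (real n + 1)"
      using that by (simp add: power2_eq_square algebra_simps)
    then have "a * (real n + 1) = 2 * (2 * real n + 1) * b"
      by (subst (asm) mult_right_cancel) auto
    then show ?thesis by (simp add: field_simps)
  qed
  ultimately have e: "real ((2 * Suc n) choose Suc n) = 2 * (2 * real n + 1) / (real n + 1) * real ((2 * n) choose n)"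
    by blast
  have "4 * (real (Suc n))\<^sup>2 - 1 = (2 * real n + 1) * (2 * real n + 3)"
    by (simp add: power2_eq_square algebra_simps)
  then have "(\<Prod>k=1..Suc n. (4 * real k^2) / (4 * real k^2 - 1))
      = (4 ^ n / real ((2 * n) choose n))\<^sup>2 / (2 * n + 1) * ((2 * (real n + 1))\<^sup>2 / ((2 * real n + 1) * (2 * real n + 3)))"
    using Suc.IH power_mult_distrib[of 2 "1 + real n" 2] by (simp add: algebra_simps del: power_Suc)
  also have "\<dots> = (4 ^ n / real ((2 * n) choose n) * (2 * (real n + 1) / (2 * real n + 1)))\<^sup>2 / (2 * real n + 3)"
    by (simp add: power_mult_distrib power_divide power2_eq_square add.commute mult_ac)
  also have "4 ^ n / real ((2 * n) choose n) * (2 * (real n + 1) / (2 * real n + 1)) = 4 ^ Suc n / real ((2 * Suc n) choose Suc n)"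
    unfolding e by (simp add: divide_simps) (simp add: algebra_simps)
  also have "2 * real n + 3 = real (2 * Suc n + 1)" by simp
  finally show ?case .
qed simp

text \<open>The partial Wallis products tend to pi / 2 and (2n + 1) / n tends to 2; by the closed
  form of the partial products, the product of the two is the square of the sequence considered
  here.\<close>

lemma central_binomial_asymp:
  "(\<lambda>n. 4 ^ n / (real ((2 * n) choose n) * sqrt n)) \<longlonglongrightarrow> sqrt pi"
proof -
  have "(\<lambda>n::nat. (2 * real n + 1) / n) \<longlonglongrightarrow> 2" by real_asymp
  moreover have half: "pi / 2 * 2 = pi" by simp
  ultimately have "(\<lambda>n. (\<Prod>k=1..n. (4 * real k^2) / (4 * real k^2 - 1)) * ((2 * real n + 1) / n)) \<longlonglongrightarrow> pi"
    using tendsto_mult[OF wallis] by fastforce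
  then
  have "(\<lambda>n. (4 ^ n / real ((2 * n) choose n))\<^sup>2 / (2 * n + 1) * ((2 * real n + 1) / n)) \<longlonglongrightarrow> pi"
    by (simp only: central_binomial_wallis half)
  then have "(\<lambda>n. (4 ^ n / real ((2 * n) choose n))\<^sup>2 / n) \<longlonglongrightarrow> pi"
    by (rule Lim_transform_eventually)
       (auto intro!: always_eventually simp: divide_simps add_pos_nonneg less_imp_neq[THEN not_sym])
  from tendsto_real_sqrt[OF this] show ?thesis
    by (simp add: real_sqrt_divide)
qed

text \<open>Dividing by the central coefficient leaves a quantity with a Gaussian limit. For
  \<open>d > m\<close> it is 0, so sums over a whole lattice of values \<open>d\<close> are finite
  sums.\<close>

definition binomial_ratio :: "nat \<Rightarrow> nat \<Rightarrow> real" where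
  "binomial_ratio m d = real ((2 * m) choose (m + d)) / real ((2 * m) choose m)"

text \<open>The ratio is (m! / (m - d)!) / ((m + d)! / m!); both quotients are products of
  \<open>d\<close> consecutive integers, and the factors m - d + i and m + i are paired.\<close>

lemma binomial_ratio_eq_prod:
  assumes "d \<le> m"
  shows "binomial_ratio m d = (\<Prod>i=1..d. 1 - real d / (real m + real i))"
proof -
  have f: "fact (n + d) = fact n * (\<Prod>i=1..d. real n + real i)" for n d :: nat
    by (induction d) (auto simp: algebra_simps)
  have g: "fact m = fact (m - d) * (\<Prod>i=1..d. real m + real i - real d)"
    using f[of "m - d" d] assms by (simp add: of_nat_diff algebra_simps)
  have "real ((2 * m) choose (m + d)) = fact (2 * m) / (fact (m + d) * fact (m - d))"
    using assms by (subst binomial_fact) (auto simp: mult_2)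
  moreover have "real ((2 * m) choose m) = fact (2 * m) / (fact m * fact m)"
    by (subst binomial_fact) (auto simp: mult_2)
  ultimately have "binomial_ratio m d = fact m * fact m / (fact (m + d) * fact (m - d))"
    by (simp add: binomial_ratio_def)
  also have "\<dots> = (\<Prod>i=1..d. real m + real i - real d) / (\<Prod>i=1..d. real m + real i)"
    unfolding f by (subst (1) g) simp
  also have "\<dots> = (\<Prod>i=1..d. 1 - real d / (real m + real i))"
    unfolding prod_dividef[symmetric]
    by (intro prod.cong refl) (auto simp: field_simps)
  finally show ?thesis .
qed

lemma binomial_ratio_bounds:
  assumes "d \<le> m"
  shows "binomial_ratio m d \<le> (1 - real d / (real m + real d)) ^ d"
    and "(1 - real d / real m) ^ d \<le> binomial_ratio m d"
proof -
  have c: "(\<Prod>i=1..d. x) = x ^ d" for x :: real by simp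
  show "binomial_ratio m d \<le> (1 - real d / (real m + real d)) ^ d"
    unfolding binomial_ratio_eq_prod[OF assms] c[symmetric]
    by (intro prod_mono) (use assms in \<open>auto simp: field_simps intro!: divide_left_mono\<close>)
  show "(1 - real d / real m) ^ d \<le> binomial_ratio m d"
    unfolding binomial_ratio_eq_prod[OF assms] c[symmetric]
    by (rule prod_mono) (use assms in \<open>auto simp: field_simps intro!: divide_left_mono\<close>)
qed

text \<open>A Gaussian majorant that sees \<open>m\<close> only through the upper bound
  \<open>K\<close>, as dominated convergence requires. The 2 arises from m + d \<le> 2 K, valid
  because the ratio vanishes unless d \<le> m.\<close>

lemma binomial_ratio_exp_bound:
  assumes m: "real m \<le> K" and K: "K > 0"
  shows "binomial_ratio m d \<le> exp (- (real d)\<^sup>2 / (2 * K))"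
proof (cases "d \<le> m \<and> d > 0")
  case True
  have "binomial_ratio m d \<le> (1 - real d / (real m + real d)) ^ d"
    using binomial_ratio_bounds True by blast
  also have "\<dots> \<le> (1 - real d / (2 * K)) ^ d"
  proof (rule power_mono)
    have "real d / (2 * K) \<le> real d / (real m + real d)"
      using True m by (intro frac_le) auto
    then show "1 - real d / (real m + real d) \<le> 1 - real d / (2 * K)" by simp
  qed (use True in \<open>simp add: field_simps\<close>)
  also have "\<dots> \<le> exp (- (real d / (2 * K))) ^ d"
  proof (rule power_mono)
    show "1 - real d / (2 * K) \<le> exp (- (real d / (2 * K)))"
      using exp_ge_add_one_self[of "- (real d / (2 * K))"] by simp
    have "real d \<le> 2 * K" using True m by linarith
    then show "0 \<le> 1 - real d / (2 * K)" using K by simp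
  qed
  finally show ?thesis
    by (simp add: power2_eq_square flip: exp_of_nat_mult)
next
  case False
  then show ?thesis using K by (auto simp: binomial_ratio_def binomial_eq_0)
qed

lemma tendsto_one_minus_power_exp:
  fixes a :: "nat \<Rightarrow> real" and b :: "nat \<Rightarrow> nat"
  assumes a0: "a \<longlonglongrightarrow> 0" and ab: "(\<lambda>n. real (b n) * a n) \<longlonglongrightarrow> L"
  shows "(\<lambda>n. (1 - a n) ^ b n) \<longlonglongrightarrow> exp (- L)"
proof -
  \<comment> \<open>With the removable singularity filled in, \<open>x * h x = ln (1 - x)\<close>
    also at 0, so indices with \<open>a n = 0\<close> need no separate treatment.\<close>
  define h where "h x = (if x = 0 then -1 else ln (1 - x) / x)" for x :: real
  have "((\<lambda>x::real. ln (1 - x) / x) \<longlongrightarrow> -1) (at 0)" by real_asymp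
  then have "h \<midarrow>0\<rightarrow> -1"
    by (rule Lim_transform_eventually) (auto simp: h_def eventually_at_filter)
  then have "isCont h 0"
    by (simp add: isCont_def h_def)
  then have "(\<lambda>n. h (a n)) \<longlonglongrightarrow> -1"
    using a0 isCont_tendsto_compose[of 0 h a] by (simp add: h_def)
  from tendsto_exp[OF tendsto_mult[OF ab this]]
  have "(\<lambda>n. exp (real (b n) * a n * h (a n))) \<longlonglongrightarrow> exp (- L)" by simp
  moreover have "\<forall>\<^sub>F n in sequentially. exp (real (b n) * a n * h (a n)) = (1 - a n) ^ b n"
    using order_tendstoD(2)[OF a0 zero_less_one]
  proof eventually_elim
    case (elim n)
    have "a n * h (a n) = ln (1 - a n)" by (simp add: h_def)
    then show ?case using elim by (simp add: mult.assoc exp_of_nat_mult)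
  qed
  ultimately show ?thesis by (rule Lim_transform_eventually)
qed

text \<open>The local de Moivre-Laplace limit. The lower and upper bounds are \<open>d\<close>-th
  powers with bases 1 - d/m and 1 - d/(m + d); since d/m tends to 0, both have the limit exp
  (-L).\<close>

lemma binomial_ratio_tendsto:
  fixes m d :: "nat \<Rightarrow> nat"
  assumes m: "filterlim m at_top sequentially" and dm: "(\<lambda>n. (real (d n))\<^sup>2 / real (m n)) \<longlonglongrightarrow> L"
  shows "(\<lambda>n. binomial_ratio (m n) (d n)) \<longlonglongrightarrow> exp (- L)"
proof -
  have rm: "filterlim (\<lambda>n. real (m n)) at_top sequentially"
    by (rule filterlim_compose[OF filterlim_real_sequentially m])
  have mpos: "\<forall>\<^sub>F n in sequentially. real (m n) > 0"
    using rm unfolding filterlim_at_top_dense by blast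
  have "(\<lambda>n. (real (d n))\<^sup>2 / real (m n) * (1 / real (m n))) \<longlonglongrightarrow> L * 0"
    by (intro tendsto_mult dm tendsto_divide_0[OF tendsto_const] filterlim_at_top_imp_at_infinity rm)
  then have "(\<lambda>n. (real (d n) / real (m n))\<^sup>2) \<longlonglongrightarrow> 0"
    by (simp add: power2_eq_square)
  then have q0: "(\<lambda>n. real (d n) / real (m n)) \<longlonglongrightarrow> 0"
    using tendsto_real_sqrt by fastforce
  have lo: "(\<lambda>n. (1 - real (d n) / real (m n)) ^ d n) \<longlonglongrightarrow> exp (- L)"
    by (rule tendsto_one_minus_power_exp[OF q0]) (use dm in \<open>simp add: power2_eq_square\<close>)
  have e: "\<forall>\<^sub>F n in sequentially. real (d n) / real (m n) / (1 + real (d n) / real (m n)) = real (d n) / (real (m n) + real (d n))"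
    using mpos by eventually_elim (simp add: field_simps)
  have "(\<lambda>n. real (d n) / real (m n) / (1 + real (d n) / real (m n))) \<longlonglongrightarrow> 0 / (1 + 0)"
    by (intro tendsto_intros q0) auto
  then have q1: "(\<lambda>n. real (d n) / (real (m n) + real (d n))) \<longlonglongrightarrow> 0"
    using Lim_transform_eventually[OF _ e] by simp
  have "(\<lambda>n. (real (d n))\<^sup>2 / real (m n) / (1 + real (d n) / real (m n))) \<longlonglongrightarrow> L / (1 + 0)"
    by (intro tendsto_intros q0 dm) auto
  moreover have "\<forall>\<^sub>F n in sequentially. (real (d n))\<^sup>2 / real (m n) / (1 + real (d n) / real (m n)) = real (d n) * (real (d n) / (real (m n) + real (d n)))"
    using mpos by eventually_elim (simp add: field_simps power2_eq_square)
  ultimately have "(\<lambda>n. real (d n) * (real (d n) / (real (m n) + real (d n)))) \<longlonglongrightarrow> L"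
    using Lim_transform_eventually by fastforce
  then have hi: "(\<lambda>n. (1 - real (d n) / (real (m n) + real (d n))) ^ d n) \<longlonglongrightarrow> exp (- L)"
    by (rule tendsto_one_minus_power_exp[OF q1])
  have "\<forall>\<^sub>F n in sequentially. d n \<le> m n"
    using order_tendstoD(2)[OF q0 zero_less_one] mpos by eventually_elim (simp add: field_simps)
  then show ?thesis
    by (intro tendsto_sandwich[OF _ _ lo hi]) (auto elim!: eventually_mono intro: binomial_ratio_bounds)
qed

text \<open>On [0, pi/2] the function exp (y^2 / 2) cos y is nonincreasing and starts at 1: its
  derivative has the sign of y cos y - sin y, which itself decreases from 0 because its derivative
  is - y sin y.\<close>

lemma cos_le_exp:
  fixes y :: real
  assumes "\<bar>y\<bar> \<le> pi / 2"
  shows "cos y \<le> exp (- y\<^sup>2 / 2)"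
proof -
  have main: "cos y \<le> exp (- y\<^sup>2 / 2)" if y: "0 \<le> y" "y \<le> pi / 2" for y :: real
  proof -
    have s: "0 * cos 0 - sin 0 \<ge> x * cos x - sin x" if "0 \<le> x" "x \<le> pi / 2" for x :: real
    proof (rule DERIV_nonpos_imp_nonincreasing[OF that(1)])
      fix t assume t: "0 \<le> t" "t \<le> x"
      have "((\<lambda>x. x * cos x - sin x) has_real_derivative - (t * sin t)) (at t)"
        by (auto intro!: derivative_eq_intros)
      moreover have "t * sin t \<ge> 0" using t that by (intro mult_nonneg_nonneg sin_ge_zero) auto
      ultimately show "\<exists>y. ((\<lambda>x. x * cos x - sin x) has_real_derivative y) (at t) \<and> y \<le> 0" by auto
    qed
    have "exp (0\<^sup>2 / 2) * cos 0 \<ge> exp (y\<^sup>2 / 2) * cos y"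
    proof (rule DERIV_nonpos_imp_nonincreasing[OF y(1)])
      fix t assume t: "0 \<le> t" "t \<le> y"
      have "((\<lambda>x. exp (x\<^sup>2 / 2) * cos x) has_real_derivative (exp (t\<^sup>2 / 2) * (t * cos t - sin t))) (at t)"
        by (auto intro!: derivative_eq_intros simp: algebra_simps)
      moreover have "exp (t\<^sup>2 / 2) * (t * cos t - sin t) \<le> 0"
        using s[of t] t y by (intro mult_nonneg_nonpos) auto
      ultimately show "\<exists>y. ((\<lambda>x. exp (x\<^sup>2 / 2) * cos x) has_real_derivative y) (at t) \<and> y \<le> 0" by blast
    qed
    then show ?thesis by (simp add: exp_minus field_simps)
  qed
  show ?thesis using main[of "\<bar>y\<bar>"] assms by simp
qed


lemma riemann_theta_eq: "riemann_theta t = (\<Sum>\<^sub>\<infinity>n::int. exp (- (pi * t) * (of_int n)\<^sup>2))"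
  unfolding riemann_theta_def by (intro infsum_cong) (simp add: algebra_simps)

theorem riemann_theta_inverse:
  fixes x :: real
  assumes x: "x > 0"
  shows "riemann_theta (1 / x) = sqrt x * riemann_theta x"
proof -
  define l where "l r = 2 * r + 1" for r :: nat
  \<comment> \<open>This scaling makes cos (pi \<nu> / l)^(2m), close to exp (- pi^2 \<nu>^2 m /
    l^2), tend to the term of theta at 1/x, while the binomial ratio at distance j l, close to exp
    (- (j l)^2 / m), tends to the term of theta at x. Rounding up gives m \<ge> l^2 / (pi x)
    exactly, which makes the majorant for the cosine side independent of \<open>r\<close>.\<close>
  define m where "m r = nat \<lceil>(real (l r))\<^sup>2 / (pi * x)\<rceil>" for r
  have lpos: "real (l r) > 0" for r by (simp add: l_def)
  have m_ge: "(real (l r))\<^sup>2 / (pi * x) \<le> real (m r)" for r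
    unfolding m_def by (rule real_nat_ceiling_ge)
  have m_le: "real (m r) \<le> (real (l r))\<^sup>2 / (pi * x) + 1" for r
  proof -
    have "(real (l r))\<^sup>2 / (pi * x) \<ge> 0" using x by simp
    then show ?thesis unfolding m_def by linarith
  qed
  have mpos: "real (m r) > 0" for r
    by (rule less_le_trans[OF _ m_ge]) (use x lpos in auto)
  have l2: "filterlim (\<lambda>r. (real (l r))\<^sup>2) at_top sequentially"
    unfolding l_def by real_asymp
  have ml: "(\<lambda>r. real (m r) / (real (l r))\<^sup>2) \<longlonglongrightarrow> 1 / (pi * x)"
  proof (rule tendsto_sandwich)
    show "\<forall>\<^sub>F r in sequentially. 1 / (pi * x) \<le> real (m r) / (real (l r))\<^sup>2"
      using m_ge lpos x by (intro always_eventually allI) (auto simp: field_simps)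
    show "\<forall>\<^sub>F r in sequentially. real (m r) / (real (l r))\<^sup>2 \<le> 1 / (pi * x) + 1 / (real (l r))\<^sup>2"
      using m_le lpos x by (intro always_eventually allI) (auto simp: field_simps)
    have "(\<lambda>r. 1 / (pi * x) + 1 / (real (l r))\<^sup>2) \<longlonglongrightarrow> 1 / (pi * x) + 0"
      by (intro tendsto_intros tendsto_divide_0[OF tendsto_const] filterlim_at_top_imp_at_infinity l2)
    then show "(\<lambda>r. 1 / (pi * x) + 1 / (real (l r))\<^sup>2) \<longlonglongrightarrow> 1 / (pi * x)" by simp
  qed auto
  have lm: "(\<lambda>r. (real (l r))\<^sup>2 / real (m r)) \<longlonglongrightarrow> pi * x"
    using tendsto_inverse[OF ml] x by (simp add: field_simps)
  have "filterlim (\<lambda>r. (real (l r))\<^sup>2 / (pi * x)) at_top sequentially"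
    unfolding l_def using x by real_asymp
  then have "filterlim (\<lambda>r. real (m r)) at_top sequentially"
    by (rule filterlim_at_top_mono) (use m_ge in auto)
  then have m_top: "filterlim m at_top sequentially"
    by (simp add: filterlim_sequentially_iff_filterlim_real)

  \<comment> \<open>Zero outside the window of residues, so that for every \<open>r\<close> the sum
    runs over all integers and dominated convergence applies.\<close>
  define A where "A r \<nu> = (if \<nu> \<in> {- int r..int r} then cos (pi * of_int \<nu> / real (l r)) ^ (2 * m r) else 0)" for r and \<nu> :: int
  have A_bound: "\<bar>A r \<nu>\<bar> \<le> exp (- (pi * (1 / x)) * (of_int \<nu>)\<^sup>2)" for r \<nu>
  proof (cases "\<nu> \<in> {- int r..int r}")
    case True
    define y where "y = pi * of_int \<nu> / real (l r)"
    have "\<bar>of_int \<nu>\<bar> \<le> real r" using True by auto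
    then have "\<bar>y\<bar> \<le> pi * real r / real (l r)"
      unfolding y_def using lpos[of r] by (simp add: abs_mult divide_right_mono)
    also have "\<dots> \<le> pi / 2" by (simp add: l_def field_simps)
    finally have y: "\<bar>y\<bar> \<le> pi / 2" .
    have "\<bar>A r \<nu>\<bar> = cos y ^ (2 * m r)" using True y
      by (auto simp: A_def y_def power_abs power_even_abs)
    also have "\<dots> \<le> exp (- y\<^sup>2 / 2) ^ (2 * m r)"
      using y by (intro power_mono cos_le_exp cos_ge_zero) auto
    also have "\<dots> = exp (- (real (m r) * y\<^sup>2))" by (simp flip: exp_of_nat_mult)
    finally have A: "\<bar>A r \<nu>\<bar> \<le> exp (- (real (m r) * y\<^sup>2))" .
    have "real (m r) * y\<^sup>2 \<ge> (real (l r))\<^sup>2 / (pi * x) * y\<^sup>2"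
      by (intro mult_right_mono m_ge) auto
    moreover have "(real (l r))\<^sup>2 / (pi * x) * y\<^sup>2 = pi * (1 / x) * (of_int \<nu>)\<^sup>2"
    proof -
      have "(real (l r))\<^sup>2 * y\<^sup>2 = pi\<^sup>2 * (of_int \<nu>)\<^sup>2"
        unfolding y_def using lpos[of r] by (simp add: power_divide power_mult_distrib)
      then have "(real (l r))\<^sup>2 / (pi * x) * y\<^sup>2 = pi\<^sup>2 * (of_int \<nu>)\<^sup>2 / (pi * x)"
        by simp
      then show ?thesis by (simp add: power2_eq_square)
    qed
    ultimately have "exp (- (real (m r) * y\<^sup>2)) \<le> exp (- (pi * (1 / x)) * (of_int \<nu>)\<^sup>2)"
      by simp
    with A show ?thesis by (rule order_trans)
  next
    case False
    then have "A r \<nu> = 0" unfolding A_def by (rule if_not_P)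
    then show ?thesis by simp
  qed
  have A_lim: "(\<lambda>r. A r \<nu>) \<longlonglongrightarrow> exp (- (pi * (1 / x)) * (of_int \<nu>)\<^sup>2)" for \<nu>
  proof -
    define y where "y r = pi * of_int \<nu> / real (l r)" for r
    have y0: "y \<longlonglongrightarrow> 0"
      unfolding y_def l_def by real_asymp
    \<comment> \<open>The filled-in quotient satisfies \<open>g t * t\<^sup>2 = 1 - cos t\<close>
      for all \<open>t\<close>, which covers \<nu> = 0 together with the other indices.\<close>
    define g where "g t = (if t = 0 then 1/2 else (1 - cos t) / t\<^sup>2)" for t :: real
    have "((\<lambda>t::real. (1 - cos t) / t\<^sup>2) \<longlongrightarrow> 1/2) (at 0)" by real_asymp
    then have "g \<midarrow>0\<rightarrow> 1/2"
      by (rule Lim_transform_eventually) (auto simp: g_def eventually_at_filter)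
    then have "isCont g 0" by (simp add: isCont_def g_def)
    then have gl: "(\<lambda>r. g (y r)) \<longlonglongrightarrow> 1/2"
      using y0 isCont_tendsto_compose[of 0 g y] by (simp add: g_def)
    have gy: "g t * t\<^sup>2 = 1 - cos t" for t by (simp add: g_def)
    have "(\<lambda>r. g (y r) * (2 * pi\<^sup>2 * (of_int \<nu>)\<^sup>2 * (real (m r) / (real (l r))\<^sup>2))) \<longlonglongrightarrow>
        1/2 * (2 * pi\<^sup>2 * (of_int \<nu>)\<^sup>2 * (1 / (pi * x)))"
      by (intro tendsto_intros gl ml)
    moreover have "g (y r) * (2 * pi\<^sup>2 * (of_int \<nu>)\<^sup>2 * (real (m r) / (real (l r))\<^sup>2)) = real (2 * m r) * (1 - cos (y r))" for r
      unfolding gy[symmetric] by (simp add: y_def power_divide power_mult_distrib)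
    moreover have "1/2 * (2 * pi\<^sup>2 * (of_int \<nu>)\<^sup>2 * (1 / (pi * x))) = pi * (1 / x) * (of_int \<nu>)\<^sup>2"
      using x by (simp add: power2_eq_square)
    ultimately have c: "(\<lambda>r. real (2 * m r) * (1 - cos (y r))) \<longlonglongrightarrow> pi * (1 / x) * (of_int \<nu>)\<^sup>2"
      by simp
    have "(\<lambda>r. 1 - cos (y r)) \<longlonglongrightarrow> 1 - cos 0" by (intro tendsto_intros y0)
    then have "(\<lambda>r. (1 - (1 - cos (y r))) ^ (2 * m r)) \<longlonglongrightarrow> exp (- (pi * (1 / x) * (of_int \<nu>)\<^sup>2))"
      by (intro tendsto_one_minus_power_exp c) simp
    moreover have "\<forall>\<^sub>F r in sequentially. (1 - (1 - cos (y r))) ^ (2 * m r) = A r \<nu>"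
      using eventually_ge_at_top[of "nat \<bar>\<nu>\<bar>"]
      by eventually_elim (auto simp: A_def y_def)
    ultimately show ?thesis
      using Lim_transform_eventually by fastforce
  qed
  have A_sum: "(\<lambda>r. \<Sum>\<^sub>\<infinity>\<nu>. A r \<nu>) \<longlonglongrightarrow> riemann_theta (1 / x)"
    unfolding riemann_theta_eq
    by (rule infsum_dominated_convergence[where 'b = real, unfolded real_norm_def, OF A_lim A_bound summable_exp_neg_square]) (use x in auto)

  define B where "B r j = binomial_ratio (m r) (nat \<bar>j * int (l r)\<bar>)" for r and j :: int
  \<comment> \<open>Since l^2 \<ge> 1, rounding up costs at most l^2, so m \<le> K = l^2 (1 / (pi x)
    + 1); then (j l)^2 / (2 K) = c j^2, free of \<open>r\<close>.\<close>
  define c where "c = 1 / (2 * (1 / (pi * x) + 1))"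
  have c: "c > 0" unfolding c_def using x by (auto intro!: divide_pos_pos add_pos_pos)
  have B_bound: "\<bar>B r j\<bar> \<le> exp (- c * (of_int j)\<^sup>2)" for r j
  proof -
    define K where "K = (real (l r))\<^sup>2 * (1 / (pi * x) + 1)"
    have K: "K > 0" unfolding K_def using x lpos[of r] by (intro mult_pos_pos add_pos_pos) auto
    have "(1::real) \<le> (real (l r))\<^sup>2" by (simp add: l_def)
    then have "real (m r) \<le> K" unfolding K_def using m_le[of r] by (simp add: algebra_simps)
    from binomial_ratio_exp_bound[OF this K, of "nat \<bar>j * int (l r)\<bar>"]
    have "B r j \<le> exp (- (real (nat \<bar>j * int (l r)\<bar>))\<^sup>2 / (2 * K))" unfolding B_def .
    also have "(real (nat \<bar>j * int (l r)\<bar>))\<^sup>2 = (real (l r))\<^sup>2 * (of_int j)\<^sup>2"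
      by (simp add: abs_mult power_mult_distrib)
    also have "- ((real (l r))\<^sup>2 * (of_int j)\<^sup>2) / (2 * K) = - c * (of_int j)\<^sup>2"
      unfolding K_def c_def using lpos[of r] by simp
    finally show ?thesis by (simp add: B_def binomial_ratio_def)
  qed
  have B_lim: "(\<lambda>r. B r j) \<longlonglongrightarrow> exp (- (pi * x) * (of_int j)\<^sup>2)" for j
  proof -
    have "(\<lambda>r. (of_int j)\<^sup>2 * ((real (l r))\<^sup>2 / real (m r))) \<longlonglongrightarrow> (of_int j)\<^sup>2 * (pi * x)"
      by (intro tendsto_intros lm)
    then have "(\<lambda>r. (real (nat \<bar>j * int (l r)\<bar>))\<^sup>2 / real (m r)) \<longlonglongrightarrow> (of_int j)\<^sup>2 * (pi * x)"
      by (simp add: abs_mult power_mult_distrib)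
    from binomial_ratio_tendsto[OF m_top this] show ?thesis
      unfolding B_def by (simp add: mult.commute)
  qed
  have B_sum: "(\<lambda>r. \<Sum>\<^sub>\<infinity>j. B r j) \<longlonglongrightarrow> riemann_theta x"
    unfolding riemann_theta_eq
    by (rule infsum_dominated_convergence[where 'b = real, unfolded real_norm_def, OF B_lim B_bound summable_exp_neg_square[OF c]])

  define J where "J r = {j. \<bar>j * int (l r)\<bar> \<le> int (m r)}" for r
  define S where "S r = (\<Sum>j\<in>J r. real ((2 * m r) choose (m r + nat \<bar>j * int (l r)\<bar>)))" for r
  \<comment> \<open>The lattice identity, divided by the central binomial coefficient and arranged
    as three factors with separate limits: sqrt pi by Wallis, 1 / sqrt (pi x) by the choice of
    \<open>m\<close>, and the theta series at 1/x.\<close>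
  have AB: "(\<Sum>\<^sub>\<infinity>j. B r j) = (4 ^ m r / (real ((2 * m r) choose m r) * sqrt (m r))) * sqrt (real (m r) / (real (l r))\<^sup>2) * (\<Sum>\<^sub>\<infinity>\<nu>. A r \<nu>)" for r
  proof -
    have fin: "finite (J r)"
    proof (rule finite_subset)
      have "\<bar>j\<bar> \<le> \<bar>j * int (l r)\<bar>" for j
        using mult_left_mono[of 1 "int (l r)" "\<bar>j\<bar>"] by (simp add: abs_mult l_def)
      then have b: "\<bar>j\<bar> \<le> int (m r)" if "\<bar>j * int (l r)\<bar> \<le> int (m r)" for j
        using that order_trans by blast
      show "J r \<subseteq> {- int (m r)..int (m r)}"
      proof
        fix j assume "j \<in> J r"
        then have "\<bar>j\<bar> \<le> int (m r)" using b unfolding J_def by blast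
        then show "j \<in> {- int (m r)..int (m r)}" by (simp add: abs_le_iff minus_le_iff)
      qed
    qed simp
    have "(\<Sum>\<^sub>\<infinity>\<nu>. A r \<nu>) = (\<Sum>\<nu>\<in>{- int r..int r}. A r \<nu>)"
    proof (subst infsum_finite[symmetric], simp, rule infsum_cong_neutral)
      fix \<nu> assume "\<nu> \<in> UNIV - {- int r..int r}"
      then have "\<nu> \<notin> {- int r..int r}" by blast
      then show "A r \<nu> = 0" unfolding A_def by (rule if_not_P)
    qed auto
    also have "\<dots> = real (l r) / 4 ^ m r * S r"
      using sum_cos_power_lattice[OF l_def[of r], of "m r"] by (simp add: A_def S_def J_def)
    finally have A: "(\<Sum>\<^sub>\<infinity>\<nu>. A r \<nu>) = \<dots>" .
    have "(\<Sum>\<^sub>\<infinity>j. B r j) = (\<Sum>j\<in>J r. B r j)"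
    proof (subst infsum_finite[OF fin, symmetric], rule infsum_cong_neutral)
      fix j assume "j \<in> UNIV - J r"
      then have "nat \<bar>j * int (l r)\<bar> > m r" by (simp add: J_def zless_nat_eq_int_zless)
      then show "B r j = 0" by (simp add: B_def binomial_ratio_def binomial_eq_0)
    qed auto
    also have "\<dots> = S r / real ((2 * m r) choose m r)"
      by (simp add: B_def binomial_ratio_def S_def sum_divide_distrib)
    finally show ?thesis
      unfolding A using lpos[of r] mpos[of r] by (simp add: real_sqrt_divide field_simps)
  qed
  have "(\<lambda>r. (4 ^ m r / (real ((2 * m r) choose m r) * sqrt (m r))) * sqrt (real (m r) / (real (l r))\<^sup>2) * (\<Sum>\<^sub>\<infinity>\<nu>. A r \<nu>))
      \<longlonglongrightarrow> sqrt pi * sqrt (1 / (pi * x)) * riemann_theta (1 / x)"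
    by (intro tendsto_intros ml A_sum filterlim_compose[OF central_binomial_asymp m_top])
  then have "riemann_theta x = sqrt pi * sqrt (1 / (pi * x)) * riemann_theta (1 / x)"
    using B_sum unfolding AB by (rule LIMSEQ_unique[rotated])
  also have "sqrt pi * sqrt (1 / (pi * x)) = 1 / sqrt x"
    using x by (simp add: real_sqrt_divide real_sqrt_mult)
  finally show ?thesis using x by simp
qed

section \<open>The product expansion of the theta function\<close>

text \<open>Euler's product over 1 - q^n, encoded through its logarithmic series: positivity is
  immediate, and \<open>ln (euler_phi q)\<close> is already the series whose Mellin transform is
  needed.\<close>

definition euler_phi :: "real \<Rightarrow> real" where
  "euler_phi q = exp (\<Sum>n. ln (1 - q ^ Suc n))"

lemma summable_ln_one_minus_power:
  fixes q :: real
  assumes q: "0 < q" "q < 1"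
  shows "summable (\<lambda>n. ln (1 - q ^ Suc n))"
proof (rule summable_comparison_test)
  show "summable (\<lambda>n. q ^ Suc n / (1 - q))"
    using q by (intro summable_divide summable_mult summable_geometric) (auto simp: summable_mult)
  show "\<exists>N. \<forall>n\<ge>N. norm (ln (1 - q ^ Suc n)) \<le> q ^ Suc n / (1 - q)"
  proof (intro exI allI impI)
    fix n
    have x: "0 < q ^ Suc n" "q ^ Suc n \<le> q" using q power_Suc_le_self[of q n] by (auto simp del: power_Suc)
    define x where "x = q ^ Suc n"
    have x: "0 < x" "x \<le> q" "x < 1" using x q unfolding x_def by (auto simp del: power_Suc)
    have "- ln (1 - x) = ln (1 / (1 - x))" using x by (simp add: ln_div)
    also have "\<dots> \<le> 1 / (1 - x) - 1" using x by (intro ln_le_minus_one) auto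
    also have "\<dots> = x / (1 - x)" using x by (simp add: field_simps)
    also have "\<dots> \<le> x / (1 - q)" using x q by (intro divide_left_mono) auto
    finally show "norm (ln (1 - q ^ Suc n)) \<le> q ^ Suc n / (1 - q)"
      using x unfolding x_def[symmetric] by simp
  qed
qed

section \<open>The finite form of Jacobi's product\<close>

definition euler_partial :: "real \<Rightarrow> nat \<Rightarrow> real" where
  "euler_partial q N = (\<Prod>k<N. 1 - q ^ Suc k)"

lemma euler_partial_pos: "0 < q \<Longrightarrow> q < 1 \<Longrightarrow> euler_partial q N > 0"
  unfolding euler_partial_def by (intro prod_pos) (auto intro: power_Suc_less_one simp del: power_Suc)

lemma euler_partial_le_1: "0 < q \<Longrightarrow> q < 1 \<Longrightarrow> euler_partial q N \<le> 1"
  unfolding euler_partial_def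
  by (intro prod_le_1) (auto intro: power_Suc_less_one less_imp_le simp del: power_Suc)

lemma euler_partial_tendsto:
  assumes q: "0 < q" "q < 1"
  shows "(\<lambda>N. euler_partial q N) \<longlonglongrightarrow> euler_phi q"
proof -
  have "(\<lambda>N. exp (\<Sum>k<N. ln (1 - q ^ Suc k))) \<longlonglongrightarrow> euler_phi q"
    unfolding euler_phi_def
    by (intro tendsto_exp summable_LIMSEQ summable_ln_one_minus_power q)
  moreover have "exp (\<Sum>k<N. ln (1 - q ^ Suc k)) = euler_partial q N" for N
  proof -
    have "1 - q ^ Suc k > 0" for k using power_Suc_less_one[OF q] by simp
    then show ?thesis by (simp add: exp_sum euler_partial_def del: power_Suc)
  qed
  ultimately show ?thesis by simp
qed

lemma euler_partial_ge:
  assumes q: "0 < q" "q < 1"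
  shows "euler_phi q \<le> euler_partial q N"
proof (rule decseq_ge[OF _ euler_partial_tendsto[OF q]])
  have "euler_partial q n * (1 - q ^ Suc n) \<le> euler_partial q n * 1" for n
    using q euler_partial_pos[OF q, of n] by (intro mult_left_mono) auto
  then show "decseq (euler_partial q)" by (intro decseq_SucI) (simp add: euler_partial_def)
qed

text \<open>Extending \<open>1 / euler_partial\<close> by zero to negative indices keeps the recursion valid for
  all integers, so that the recursion for the Gaussian binomials needs no boundary cases.\<close>

definition euler_recip :: "real \<Rightarrow> int \<Rightarrow> real" where
  "euler_recip q k = (if k < 0 then 0 else 1 / euler_partial q (nat k))"

text \<open>At \<open>k = 0\<close> the factor 1 - q^0 vanishes, in agreement with the value 0 at
  index -1; for negative \<open>k\<close> both sides are 0.\<close>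

lemma euler_recip_rec:
  assumes q: "0 < q" "q < 1"
  shows "euler_recip q (k - 1) = (1 - q powi k) * euler_recip q k"
proof (cases "k > 0")
  case True
  then obtain n where k: "k = int (Suc n)" by (metis pos_int_cases Suc_pred)
  have "1 - q ^ Suc n \<noteq> 0" using power_Suc_less_one[OF q, of n] by simp
  moreover have "nat (int (Suc n)) = Suc n" "nat (int (Suc n) - 1) = n" "q powi (int (Suc n)) = q ^ Suc n"
    by (simp_all only: nat_int power_int_of_nat)
  moreover have "\<not> int (Suc n) < 0" "\<not> int (Suc n) - 1 < 0" by auto
  ultimately show ?thesis
    unfolding k euler_recip_def by (simp only: if_False) (simp add: euler_partial_def)
next
  case False
  then show ?thesis by (cases "k = 0") (auto simp: euler_recip_def)
qed

lemma euler_recip_bounds: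
  assumes q: "0 < q" "q < 1"
  shows "0 \<le> euler_recip q k" "euler_recip q k \<le> 1 / euler_phi q"
proof -
  have P: "euler_phi q > 0" by (simp add: euler_phi_def)
  show "0 \<le> euler_recip q k"
    using euler_partial_pos[OF q, of "nat k"] by (simp add: euler_recip_def)
  show "euler_recip q k \<le> 1 / euler_phi q"
    using P euler_partial_ge[OF q, of "nat k"] by (simp add: euler_recip_def frac_le)
qed

text \<open>The Gaussian binomial coefficient \<open>(2N choose N + n)\<close> with base \<open>q\<^sup>2\<close>, times \<open>q ^ n\<^sup>2\<close>.\<close>

definition jacobi_term :: "real \<Rightarrow> nat \<Rightarrow> int \<Rightarrow> real" where
  "jacobi_term q N n = euler_partial (q\<^sup>2) (2 * N) * euler_recip (q\<^sup>2) (int N + n)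
     * euler_recip (q\<^sup>2) (int N - n) * q powi (n\<^sup>2)"

text \<open>\<open>jacobi_term q N n\<close> is meant to be the coefficient of z^n in the product
  over k < N of (1 + q^(2k+1) z) (1 + q^(2k+1) / z). The recursion compares coefficients after
  multiplication by the next factor, 1 + q^(4N+2) + q^(2N+1) (z + 1/z).\<close>

lemma jacobi_term_rec:
  assumes q: "0 < q" "q < 1"
  shows "jacobi_term q (Suc N) n = (1 + (q ^ (2 * N + 1))\<^sup>2) * jacobi_term q N n
     + q ^ (2 * N + 1) * (jacobi_term q N (n - 1) + jacobi_term q N (n + 1))"
proof -
  define Q where "Q = q\<^sup>2"
  have Q: "0 < Q" "Q < 1" using q by (auto simp: Q_def power_less_one_iff)
  \<comment> \<open>All reciprocals that occur are multiples of the two with the largest indices,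
    \<open>A\<close> and \<open>B\<close>; in terms of \<open>X\<close> and \<open>Y\<close>, with X
    Y = q^(2N+2) absorbing the dependence on \<open>N\<close>, the recursion becomes a rational
    identity.\<close>
  define a b X Y where "a = int N + 1 + n" and "b = int N + 1 - n" and "X = q powi a" and "Y = q powi b"
  define A B where "A = euler_recip Q a" and "B = euler_recip Q b"
  have q0: "q \<noteq> 0" using q by simp
  have Qp: "Q powi k = (q powi k)\<^sup>2" for k
    unfolding Q_def by (simp add: power_int_mult_distrib power2_eq_square)
  have A1: "euler_recip Q (a - 1) = (1 - X\<^sup>2) * A" and B1: "euler_recip Q (b - 1) = (1 - Y\<^sup>2) * B"
    using euler_recip_rec[OF Q] by (simp_all add: A_def B_def X_def Y_def Qp)
  have "q powi (a - 1) = X / q" "q powi (b - 1) = Y / q"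
    using q0 by (simp_all add: X_def Y_def power_int_diff)
  then have A2: "euler_recip Q (a - 2) = (1 - X\<^sup>2 / Q) * (1 - X\<^sup>2) * A"
    and B2: "euler_recip Q (b - 2) = (1 - Y\<^sup>2 / Q) * (1 - Y\<^sup>2) * B"
    using euler_recip_rec[OF Q, of "a - 1"] euler_recip_rec[OF Q, of "b - 1"] A1 B1
    by (simp_all only: Qp power_divide flip: Q_def) (simp_all add: Q_def mult.assoc)
  have XY: "X * Y = q ^ (2 * N + 2)"
  proof -
    have "X * Y = q powi (a + b)" using q0 by (simp add: X_def Y_def power_int_add)
    also have "a + b = int (2 * N + 2)" by (simp add: a_def b_def)
    finally show ?thesis by (simp only: power_int_of_nat)
  qed
  then have XYq: "q ^ (2 * N + 1) = X * Y / q" using q0 by simp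
  have P: "euler_partial Q (2 * Suc N) = euler_partial Q (2 * N) * (1 - (X * Y)\<^sup>2 / Q) * (1 - (X * Y)\<^sup>2)"
  proof -
    have "Q ^ Suc (2 * N) = (X * Y)\<^sup>2 / Q" "Q ^ Suc (Suc (2 * N)) = (X * Y)\<^sup>2"
      unfolding XY Q_def using q0 by (simp_all add: power2_eq_square power_mult_distrib)
    then show ?thesis by (simp add: euler_partial_def del: power_Suc)
  qed
  have sq: "q powi ((n + 1)\<^sup>2) = q powi (n\<^sup>2) * (X / Y) * q" "q powi ((n - 1)\<^sup>2) = q powi (n\<^sup>2) * (Y / X) * q"
  proof -
    have e: "(n + 1)\<^sup>2 = n\<^sup>2 + (a - b) + 1" "(n - 1)\<^sup>2 = n\<^sup>2 + (b - a) + 1"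
      by (simp_all add: a_def b_def power2_eq_square algebra_simps)
    show "q powi ((n + 1)\<^sup>2) = q powi (n\<^sup>2) * (X / Y) * q" "q powi ((n - 1)\<^sup>2) = q powi (n\<^sup>2) * (Y / X) * q"
      unfolding e X_def Y_def using q0 by (simp_all add: power_int_add power_int_diff)
  qed
  define E where "E = euler_partial Q (2 * N)"
  define S where "S = q powi (n\<^sup>2)"
  have t: "jacobi_term q (Suc N) n = E * (1 - (X * Y)\<^sup>2 / Q) * (1 - (X * Y)\<^sup>2) * A * B * S"
    unfolding jacobi_term_def Q_def[symmetric] P
    by (simp add: A_def B_def a_def b_def E_def S_def algebra_simps)
  have ia: "int N + n = a - 1" "int N - n = b - 1" "int N + (n - 1) = a - 2" "int N - (n - 1) = b"
    "int N + (n + 1) = a" "int N - (n + 1) = b - 2"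
    by (simp_all add: a_def b_def)
  have t0: "jacobi_term q N n = E * ((1 - X\<^sup>2) * A) * ((1 - Y\<^sup>2) * B) * S"
    unfolding jacobi_term_def Q_def[symmetric] ia A1 B1 E_def S_def ..
  have t1: "jacobi_term q N (n - 1) = E * ((1 - X\<^sup>2 / Q) * (1 - X\<^sup>2) * A) * B * (S * (Y / X) * q)"
    unfolding jacobi_term_def Q_def[symmetric] ia A2 sq E_def S_def B_def ..
  have t2: "jacobi_term q N (n + 1) = E * A * ((1 - Y\<^sup>2 / Q) * (1 - Y\<^sup>2) * B) * (S * (X / Y) * q)"
    unfolding jacobi_term_def Q_def[symmetric] ia B2 sq E_def S_def A_def ..
  have nz: "X \<noteq> 0" "Y \<noteq> 0" using q0 by (auto simp: X_def Y_def)
  have c1: "X * Y / q * (S * (Y / X) * q) = S * Y\<^sup>2" "X * Y / q * (S * (X / Y) * q) = S * X\<^sup>2"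
    using nz q0 by (simp_all add: power2_eq_square)
  have "q ^ (2 * N + 1) * (jacobi_term q N (n - 1) + jacobi_term q N (n + 1))
      = E * ((1 - X\<^sup>2 / Q) * (1 - X\<^sup>2) * A) * B * (X * Y / q * (S * (Y / X) * q))
      + E * A * ((1 - Y\<^sup>2 / Q) * (1 - Y\<^sup>2) * B) * (X * Y / q * (S * (X / Y) * q))"
    unfolding t1 t2 XYq by (simp only: ring_distribs mult_ac)
  also have "\<dots> = E * A * B * S * ((1 - X\<^sup>2 / Q) * (1 - X\<^sup>2) * Y\<^sup>2 + (1 - Y\<^sup>2 / Q) * (1 - Y\<^sup>2) * X\<^sup>2)"
    unfolding c1 by (simp only: ring_distribs mult_ac)
  finally have r: "q ^ (2 * N + 1) * (jacobi_term q N (n - 1) + jacobi_term q N (n + 1)) = \<dots>" .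
  have "(X * Y / q)\<^sup>2 = X\<^sup>2 * Y\<^sup>2 / Q"
    by (simp add: Q_def power_divide power_mult_distrib)
  then have sqq: "(q ^ (2 * N + 1))\<^sup>2 = X\<^sup>2 * Y\<^sup>2 / Q" unfolding XYq .
  \<comment> \<open>The whole recursion after cancelling \<open>E * A * B * S\<close>, to be read
    with x = X^2 and y = Y^2.\<close>
  have id: "(1 - x * y / Q) * (1 - x * y)
      = (1 + x * y / Q) * (1 - x) * (1 - y) + ((1 - x / Q) * (1 - x) * y + (1 - y / Q) * (1 - y) * x)" for x y
    unfolding divide_inverse by algebra
  have "jacobi_term q (Suc N) n = E * A * B * S * ((1 - X\<^sup>2 * Y\<^sup>2 / Q) * (1 - X\<^sup>2 * Y\<^sup>2))"
    unfolding t power_mult_distrib by (simp only: mult_ac)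
  also have "\<dots> = (1 + (q ^ (2 * N + 1))\<^sup>2) * jacobi_term q N n
     + q ^ (2 * N + 1) * (jacobi_term q N (n - 1) + jacobi_term q N (n + 1))"
    unfolding id r unfolding t0 sqq by (simp only: ring_distribs mult_ac)
  finally show ?thesis .
qed

lemma jacobi_term_outside: "\<bar>n\<bar> > int N \<Longrightarrow> jacobi_term q N n = 0"
  by (auto simp: jacobi_term_def euler_recip_def abs_if split: if_splits)

lemma summable_jacobi_term: "jacobi_term q N summable_on UNIV"
proof (rule finite_nonzero_values_imp_summable_on, rule finite_subset)
  show "{x \<in> UNIV. jacobi_term q N x \<noteq> 0} \<subseteq> {- int N..int N}"
  proof
    fix n assume "n \<in> {x \<in> UNIV. jacobi_term q N x \<noteq> 0}"
    then have "\<not> \<bar>n\<bar> > int N" using jacobi_term_outside[of N n q] by blast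
    then show "n \<in> {- int N..int N}" by (simp add: not_less abs_le_iff minus_le_iff)
  qed
qed simp

text \<open>The evaluation at z = 1 of the Laurent polynomial with these coefficients. Sums over all
  integers are invariant under shifts, so each step of the recursion multiplies the sum by 1 + 2 a +
  a^2 with a = q^(2N+1).\<close>

lemma infsum_jacobi_term:
  assumes q: "0 < q" "q < 1"
  shows "(\<Sum>\<^sub>\<infinity>n. jacobi_term q N n) = (\<Prod>k<N. (1 + q ^ (2 * k + 1))\<^sup>2)"
proof (induction N)
  case 0
  have "jacobi_term q 0 n = 0" if "n \<noteq> 0" for n
    using that by (intro jacobi_term_outside) simp
  then have "(\<Sum>\<^sub>\<infinity>n. jacobi_term q 0 n) = (\<Sum>\<^sub>\<infinity>n\<in>{0}. jacobi_term q 0 n)"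
    by (intro infsum_cong_neutral) auto
  then show ?case by (simp add: jacobi_term_def euler_recip_def euler_partial_def)
next
  case (Suc N)
  define J where "J = jacobi_term q N"
  have J: "J summable_on UNIV" unfolding J_def by (rule summable_jacobi_term)
  have bij: "bij (\<lambda>n::int. n - 1)" "bij (\<lambda>n::int. n + 1)"
    by (auto intro!: bijI' simp: algebra_simps exI[of _ "_ - 1"] exI[of _ "_ + 1"])
  have sh: "(\<lambda>n. J (n - 1)) summable_on UNIV" "(\<lambda>n. J (n + 1)) summable_on UNIV"
    using summable_on_reindex_bij_betw[OF bij(1), of J] summable_on_reindex_bij_betw[OF bij(2), of J] J by auto
  have shi: "(\<Sum>\<^sub>\<infinity>n. J (n - 1)) = infsum J UNIV" "(\<Sum>\<^sub>\<infinity>n. J (n + 1)) = infsum J UNIV"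
    using infsum_reindex_bij_betw[OF bij(1), of J] infsum_reindex_bij_betw[OF bij(2), of J] by auto
  have "(\<Sum>\<^sub>\<infinity>n. jacobi_term q (Suc N) n)
      = (\<Sum>\<^sub>\<infinity>n. (1 + (q ^ (2 * N + 1))\<^sup>2) * J n + q ^ (2 * N + 1) * (J (n - 1) + J (n + 1)))"
    unfolding J_def by (intro infsum_cong jacobi_term_rec q)
  also have "\<dots> = (1 + (q ^ (2 * N + 1))\<^sup>2) * infsum J UNIV + q ^ (2 * N + 1) * (infsum J UNIV + infsum J UNIV)"
    using J sh shi by (simp add: infsum_add infsum_cmult_right summable_on_add summable_on_cmult_right del: power_Suc)
  also have "\<dots> = (1 + q ^ (2 * N + 1))\<^sup>2 * infsum J UNIV"
    by (simp add: power2_eq_square algebra_simps)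
  finally show ?case using Suc.IH by (simp add: J_def mult.commute)
qed

text \<open>Products of 1 + x are quotients of products of 1 - x^2 and 1 - x; the odd exponents are
  all exponents up to 2N divided by the even ones.\<close>

lemma prod_one_plus_odd_power:
  fixes q :: real
  assumes q: "0 < q" "q < 1"
  shows "(\<Prod>k<N. 1 + q ^ (2 * k + 1)) = euler_partial (q\<^sup>2) (2 * N) * euler_partial (q\<^sup>2) N
           / (euler_partial q (2 * N) * euler_partial (q ^ 4) N)"
proof -
  have nz: "1 - q ^ Suc k \<noteq> 0" for k using power_Suc_less_one[OF q, of k] by simp
  have p: "euler_partial (q\<^sup>2) M = (\<Prod>k<M. 1 + q ^ Suc k) * euler_partial q M" if "q > 0" "q < 1" for q :: real and M
  proof -
    have "1 - (q\<^sup>2) ^ Suc k = (1 + q ^ Suc k) * (1 - q ^ Suc k)" for k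
      by (simp add: power2_eq_square power_mult_distrib algebra_simps)
    then show ?thesis by (simp only: euler_partial_def prod.distrib)
  qed
  have q2: "0 < q\<^sup>2" "q\<^sup>2 < 1" using q by (auto simp: power_less_one_iff)
  have q4: "0 < q ^ 4" "q ^ 4 < 1" using q by (auto simp: power_less_one_iff)
  have q2p: "(q\<^sup>2) ^ Suc k = q ^ Suc (2 * k + 1)" for k
    by (simp add: power_mult power2_eq_square)
  have split: "(\<Prod>k<2 * N. 1 + q ^ Suc k) = (\<Prod>k<N. 1 + q ^ (2 * k + 1)) * (\<Prod>k<N. 1 + (q\<^sup>2) ^ Suc k)"
    unfolding q2p by (induction N) (simp_all del: power_Suc add: mult_ac)
  have e: "(q\<^sup>2)\<^sup>2 = q ^ 4" by simp
  have "euler_partial (q\<^sup>2) (2 * N) / euler_partial q (2 * N) = (\<Prod>k<2 * N. 1 + q ^ Suc k)"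
    using p[OF q, of "2 * N"] euler_partial_pos[OF q, of "2 * N"] by (simp add: field_simps)
  moreover have "euler_partial (q ^ 4) N / euler_partial (q\<^sup>2) N = (\<Prod>k<N. 1 + (q\<^sup>2) ^ Suc k)"
    using p[OF q2, of N, unfolded e] euler_partial_pos[OF q2, of N] by (simp add: field_simps)
  ultimately have "euler_partial (q\<^sup>2) (2 * N) / euler_partial q (2 * N)
      = (\<Prod>k<N. 1 + q ^ (2 * k + 1)) * (euler_partial (q ^ 4) N / euler_partial (q\<^sup>2) N)"
    using split by simp
  then show ?thesis
    using euler_partial_pos[OF q4, of N] euler_partial_pos[OF q2, of N] euler_partial_pos[OF q, of "2 * N"]
    by (simp add: field_simps)
qed

lemma euler_recip_tendsto:
  assumes q: "0 < q" "q < 1"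
  shows "(\<lambda>N. euler_recip q (int N + n)) \<longlonglongrightarrow> 1 / euler_phi q"
proof -
  have "filterlim (\<lambda>N. nat (int N + n)) at_top sequentially"
    unfolding filterlim_at_top
  proof
    fix Z show "\<forall>\<^sub>F N in sequentially. Z \<le> nat (int N + n)"
      using eventually_ge_at_top[of "Z + nat \<bar>n\<bar>"] by eventually_elim auto
  qed
  then have "(\<lambda>N. 1 / euler_partial q (nat (int N + n))) \<longlonglongrightarrow> 1 / euler_phi q"
    by (intro tendsto_intros filterlim_compose[OF euler_partial_tendsto[OF q]]) (auto simp: euler_phi_def)
  moreover have "\<forall>\<^sub>F N in sequentially. 1 / euler_partial q (nat (int N + n)) = euler_recip q (int N + n)"
    using eventually_ge_at_top[of "nat \<bar>n\<bar>"] by eventually_elim (auto simp: euler_recip_def)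
  ultimately show ?thesis by (rule Lim_transform_eventually)
qed

text \<open>As N grows, the Gaussian binomials tend to 1 / phi(q^2) and the squared product to
  (phi(q^2)^2 / (phi(q) phi(q^4)))^2. The fifth power is thus one factor from the left side and four
  from the right. Each reciprocal is at most 1 / phi(q^2), which supplies the majorant.\<close>

theorem jacobi_theta_product:
  fixes q :: real
  assumes q: "0 < q" "q < 1"
  shows "(\<Sum>\<^sub>\<infinity>n::int. q powi (n\<^sup>2)) = euler_phi (q\<^sup>2) ^ 5 / (euler_phi q ^ 2 * euler_phi (q ^ 4) ^ 2)"
proof -
  have q2: "0 < q\<^sup>2" "q\<^sup>2 < 1" using q by (auto simp: power_less_one_iff)
  have q4: "0 < q ^ 4" "q ^ 4 < 1" using q by (auto simp: power_less_one_iff)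
  define P where "P = euler_phi (q\<^sup>2)"
  have P: "P > 0" by (simp add: P_def euler_phi_def)
  have dbl: "filterlim (\<lambda>N::nat. 2 * N) at_top sequentially"
    by (rule filterlim_subseq) (auto simp: strict_mono_def)
  have q_eq: "q powi (n\<^sup>2) = exp (- (- ln q) * (of_int n)\<^sup>2)" for n
  proof -
    have "q powi (n\<^sup>2) = exp (ln q) powi (n\<^sup>2)" using q by simp
    also have "\<dots> = exp (of_int (n\<^sup>2) * ln q)" by (rule exp_power_int)
    finally show ?thesis by (simp add: mult.commute)
  qed
  have q_summable: "(\<lambda>n::int. q powi (n\<^sup>2)) summable_on UNIV"
    unfolding q_eq by (rule summable_exp_neg_square) (use q in simp)
  have lhs: "(\<lambda>N. \<Sum>\<^sub>\<infinity>n. jacobi_term q N n) \<longlonglongrightarrow> (\<Sum>\<^sub>\<infinity>n. 1 / P * q powi (n\<^sup>2))"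
  proof (rule infsum_dominated_convergence)
    fix n :: int
    have "(\<lambda>N. euler_recip (q\<^sup>2) (int N + - n)) \<longlonglongrightarrow> 1 / P"
      unfolding P_def by (rule euler_recip_tendsto[OF q2])
    then have "(\<lambda>N. jacobi_term q N n) \<longlonglongrightarrow> P * (1 / P) * (1 / P) * q powi (n\<^sup>2)"
      unfolding jacobi_term_def
      by (intro tendsto_mult tendsto_const filterlim_compose[OF euler_partial_tendsto[OF q2, folded P_def] dbl]
            euler_recip_tendsto[OF q2, folded P_def]) simp
    then show "(\<lambda>N. jacobi_term q N n) \<longlonglongrightarrow> 1 / P * q powi (n\<^sup>2)" using P by simp
  next
    fix N n
    have "\<bar>jacobi_term q N n\<bar> = jacobi_term q N n"
      unfolding jacobi_term_def using q
      by (intro abs_of_nonneg mult_nonneg_nonneg euler_recip_bounds[OF q2] less_imp_le[OF euler_partial_pos[OF q2]]) auto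
    also have "\<dots> \<le> 1 * (1 / P) * (1 / P) * q powi (n\<^sup>2)"
      unfolding jacobi_term_def using q P
      by (intro mult_mono euler_recip_bounds[OF q2, folded P_def] euler_partial_le_1[OF q2] mult_nonneg_nonneg) auto
    finally show "norm (jacobi_term q N n) \<le> (1 / P) * (1 / P) * q powi (n\<^sup>2)" by simp
  qed (intro summable_on_cmult_right q_summable)
  have "(\<lambda>N. \<Sum>\<^sub>\<infinity>n. jacobi_term q N n)
    = (\<lambda>N. (euler_partial (q\<^sup>2) (2 * N) * euler_partial (q\<^sup>2) N / (euler_partial q (2 * N) * euler_partial (q ^ 4) N))\<^sup>2)"
    unfolding infsum_jacobi_term[OF q] prod_power_distrib[symmetric] prod_one_plus_odd_power[OF q] ..
  also have "\<dots> \<longlonglongrightarrow> (P * P / (euler_phi q * euler_phi (q ^ 4)))\<^sup>2"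
    unfolding P_def
    by (intro tendsto_intros euler_partial_tendsto q q2 q4
          filterlim_compose[OF euler_partial_tendsto[OF q] dbl] filterlim_compose[OF euler_partial_tendsto[OF q2] dbl])
       (auto simp: euler_phi_def)
  finally have "(\<Sum>\<^sub>\<infinity>n. 1 / P * q powi (n\<^sup>2)) = (P * P / (euler_phi q * euler_phi (q ^ 4)))\<^sup>2"
    using lhs LIMSEQ_unique by blast
  then have "1 / P * (\<Sum>\<^sub>\<infinity>n::int. q powi (n\<^sup>2)) = (P * P / (euler_phi q * euler_phi (q ^ 4)))\<^sup>2"
    using infsum_cmult_right[of "1 / P" "\<lambda>n::int. q powi (n\<^sup>2)" UNIV] q_summable by simp
  then have "(\<Sum>\<^sub>\<infinity>n::int. q powi (n\<^sup>2)) = P * (P * P / (euler_phi q * euler_phi (q ^ 4)))\<^sup>2"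
    using P by (simp add: field_simps)
  then show ?thesis
    by (simp add: P_def power_divide power_mult_distrib eval_nat_numeral mult_ac)
qed

text \<open>Expanding every ln (1 - q^n) gives the terms q^(n k) / k. They are nonnegative, so the
  convergent iterated sum is already an unconditional sum over pairs.\<close>

lemma has_sum_ln_euler_phi:
  assumes q: "0 < q" "q < 1"
  shows "((\<lambda>(n, k). q ^ (Suc n * Suc k) / Suc k) has_sum (- ln (euler_phi q))) UNIV"
proof -
  have row: "((\<lambda>k. x ^ Suc k / Suc k) has_sum (- ln (1 - x))) UNIV" if x: "0 < x" "x < 1" for x :: real
  proof (rule sums_nonneg_imp_has_sum)
    have "(\<lambda>n. - ((- (- x)) ^ n) / real n) sums ln (1 + - x)"
      by (rule ln_series') (use x in auto)
    from sums_minus[OF this] have "(\<lambda>n. x ^ n / real n) sums - ln (1 - x)"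
      by simp
    then show "(\<lambda>k. x ^ Suc k / Suc k) sums - ln (1 - x)"
      by (subst sums_Suc_iff) simp
  qed (use x in auto)
  have x: "0 < q ^ Suc n" "q ^ Suc n < 1" for n
    using q power_Suc_less_one[OF q, of n] by auto
  have col: "((\<lambda>n. - ln (1 - q ^ Suc n)) has_sum (- ln (euler_phi q))) UNIV"
  proof (rule sums_nonneg_imp_has_sum)
    show "(\<lambda>n. - ln (1 - q ^ Suc n)) sums - ln (euler_phi q)"
      unfolding euler_phi_def ln_exp
      by (intro sums_minus summable_sums summable_ln_one_minus_power q)
  qed (use x in \<open>simp add: ln_le_zero_iff less_imp_le del: power_Suc\<close>)
  have r: "((\<lambda>k. q ^ (Suc n * Suc k) / Suc k) has_sum (- ln (1 - q ^ Suc n))) UNIV" for n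
    using row[OF x] unfolding power_mult .
  have "((\<lambda>p. q ^ (Suc (fst p) * Suc (snd p)) / Suc (snd p)) has_sum (- ln (euler_phi q))) (Sigma UNIV (\<lambda>_. UNIV))"
  proof (rule has_sum_SigmaI[OF _ col])
    show "((\<lambda>k. q ^ (Suc (fst (n, k)) * Suc (snd (n, k))) / Suc (snd (n, k))) has_sum (- ln (1 - q ^ Suc n))) UNIV" for n
      using r[of n] by simp
    show "(\<lambda>p. q ^ (Suc (fst p) * Suc (snd p)) / Suc (snd p)) summable_on UNIV \<times> UNIV"
    proof (rule summable_on_SigmaI)
      show "((\<lambda>k. q ^ (Suc (fst (n, k)) * Suc (snd (n, k))) / Suc (snd (n, k))) has_sum (- ln (1 - q ^ Suc n))) UNIV" for n
        using r[of n] by simp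
      show "(\<lambda>n. - ln (1 - q ^ Suc n)) summable_on UNIV" using col by (rule has_sum_imp_summable)
    qed (use q in auto)
  qed
  then show ?thesis by (simp add: case_prod_unfold)
qed

section \<open>Mellin transforms on the logarithmic scale\<close>

lemma half_line_split:
  fixes f :: "real \<Rightarrow> complex"
  assumes f1: "set_integrable lborel {0<..} f" and f2: "set_integrable lborel {0<..} (\<lambda>u. f (- u))"
  shows "integrable lborel f" and "(LINT u|lborel. f u) = (LINT u:{0<..}|lborel. f u + f (- u))"
proof -
  define A where "A = (\<lambda>u::real. indicator {0<..} u *\<^sub>R f u)"
  define B where "B = (\<lambda>u::real. indicator {0<..} u *\<^sub>R f (- u))"
  have A: "integrable lborel A" and B: "integrable lborel B"
    using f1 f2 by (simp_all add: A_def B_def set_integrable_def)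
  have B': "integrable lborel (\<lambda>u. B (- u))"
    using lborel_integrable_real_affine[OF B, of "-1" 0] by simp
  have C: "integrable lborel (\<lambda>u. A u + B (- u))" using A B' by simp
  have eq: "u \<notin> {0} \<Longrightarrow> A u + B (- u) = f u" for u
    by (auto simp: A_def B_def indicator_def)
  \<comment> \<open>Only the two halves are assumed integrable; measurability of \<open>f\<close> is
    recovered from them by putting back the single value at 0, which both halves omit.\<close>
  have meas: "f \<in> borel_measurable lborel"
  proof -
    have "(\<lambda>u. if u = 0 then f 0 else A u + B (- u)) \<in> borel_measurable lborel"
      using C by measurable
    moreover have "(\<lambda>u. if u = 0 then f 0 else A u + B (- u)) = f" using eq by auto
    ultimately show ?thesis by simp
  qed
  have AE: "AE u in lborel. A u + B (- u) = f u"
    using AE_lborel_singleton[of "0::real"] by eventually_elim (use eq in auto)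
  show "integrable lborel f"
    by (rule integrable_cong_AE_imp[OF C meas]) (use AE in auto)
  have "(LINT u|lborel. f u) = (LINT u|lborel. A u + B (- u))"
    using AE C meas by (intro integral_cong_AE) auto
  also have "\<dots> = (LINT u|lborel. A u) + (LINT u|lborel. B (- u))"
    using A B' by (rule Bochner_Integration.integral_add)
  also have "(LINT u|lborel. B (- u)) = (LINT u|lborel. B u)"
    using lborel_integral_real_affine[of "-1" B 0] by simp
  also have "(LINT u|lborel. A u) + \<dots> = (LINT u|lborel. A u + B u)"
    using A B by (rule Bochner_Integration.integral_add[symmetric])
  also have "\<dots> = (LINT u:{0<..}|lborel. f u + f (- u))"
    unfolding set_lebesgue_integral_def A_def B_def
    by (intro Bochner_Integration.integral_cong) (auto simp: algebra_simps)
  finally show "(LINT u|lborel. f u) = (LINT u:{0<..}|lborel. f u + f (- u))" .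
qed

lemma integrable_half_lines:
  fixes f :: "real \<Rightarrow> complex"
  assumes "integrable lborel f"
  shows "set_integrable lborel {0<..} f" and "set_integrable lborel {0<..} (\<lambda>u. f (- u))"
  using assms lborel_integrable_real_affine[OF assms, of "-1" 0]
  by (auto simp: set_integrable_def intro: integrable_mult_indicator)

text \<open>The substitution t = exp u turns dt / t into du. The change of variables takes place for
  the completed measure, and Borel measurability of \<open>f\<close> transfers integrability and
  integral between it and \<open>lborel\<close>.\<close>

lemma exp_substitution:
  fixes f :: "real \<Rightarrow> complex"
  assumes [measurable]: "f \<in> borel_measurable borel"
  shows "set_integrable lborel {0<..} (\<lambda>t. f t / of_real t) \<longleftrightarrow> integrable lborel (\<lambda>u. f (exp u))"
    and "integrable lborel (\<lambda>u. f (exp u)) \<Longrightarrow>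
      (LINT t:{0<..}|lborel. f t / of_real t) = (LINT u|lborel. f (exp u))"
proof -
  define F where "F t = f t / of_real t" for t
  have F[measurable]: "F \<in> borel_measurable borel" unfolding F_def by measurable
  have range: "exp ` (UNIV :: real set) = {0<..}"
    by (auto simp: image_iff) (metis exp_ln)
  have sc: "\<bar>exp u\<bar> *\<^sub>R F (exp u) = f (exp u)" for u
    by (simp add: F_def scaleR_conv_of_real)
  have cv: "(\<lambda>u. f (exp u)) absolutely_integrable_on UNIV \<and> integral UNIV (\<lambda>u. f (exp u)) = b
      \<longleftrightarrow> F absolutely_integrable_on {0<..} \<and> integral {0<..} F = b" for b
    using has_absolute_integral_change_of_variables_real[of UNIV exp exp F b]
    unfolding sc range by (auto intro!: derivative_eq_intros simp: inj_def)
  have m1: "(\<lambda>u. f (exp u)) \<in> borel_measurable lborel" by measurable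
  have m2: "(\<lambda>t. indicator {0<..} t *\<^sub>R F t) \<in> borel_measurable lborel" by measurable
  have i1: "(\<lambda>u. f (exp u)) absolutely_integrable_on UNIV \<longleftrightarrow> integrable lborel (\<lambda>u. f (exp u))"
    using integrable_completion[OF m1] by (simp add: set_integrable_def)
  have i2: "F absolutely_integrable_on {0<..} \<longleftrightarrow> set_integrable lborel {0<..} F"
    using integrable_completion[OF m2] by (simp add: set_integrable_def)
  show iff: "set_integrable lborel {0<..} (\<lambda>t. f t / of_real t) \<longleftrightarrow> integrable lborel (\<lambda>u. f (exp u))"
    using cv i1 i2 unfolding F_def by blast
  assume int: "integrable lborel (\<lambda>u. f (exp u))"
  then have a: "(\<lambda>u. f (exp u)) absolutely_integrable_on UNIV" "F absolutely_integrable_on {0<..}"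
    using i1 i2 iff unfolding F_def by blast+
  have "(LINT t:{0<..}|lborel. F t) = integral {0<..} F"
    using set_lebesgue_integral_eq_integral(2)[OF a(2)] integral_completion[OF m2]
    by (simp add: set_lebesgue_integral_def)
  also have "\<dots> = integral UNIV (\<lambda>u. f (exp u))" using cv a by blast
  also have "\<dots> = (LINT u|lborel. f (exp u))"
    using set_lebesgue_integral_eq_integral(2)[OF a(1)] integral_completion[OF m1]
    by (simp add: set_lebesgue_integral_def)
  finally show "(LINT t:{0<..}|lborel. f t / of_real t) = (LINT u|lborel. f (exp u))"
    unfolding F_def .
qed

lemma Gamma_exp_integral:
  assumes z: "Re z > 0"
  shows "has_bochner_integral lborel (\<lambda>u. of_real (exp (- exp u)) * exp (z * of_real u)) (Gamma z)"
proof -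
  define f where "f t = (if t > 0 then complex_of_real t powr z / of_real (exp t) else 0)" for t :: real
  have [measurable]: "f \<in> borel_measurable borel"
    unfolding f_def powr_def by measurable
  have fe: "f (exp u) = of_real (exp (- exp u)) * exp (z * of_real u)" for u
    by (simp add: f_def powr_def exp_minus divide_inverse mult.commute flip: exp_of_real)
  have feq: "f t / of_real t = complex_of_real t powr (z - 1) / of_real (exp t)" if "t \<in> {0<..}" for t
    using that by (simp add: f_def powr_diff)
  have a: "(\<lambda>t. f t / of_real t) absolutely_integrable_on {0<..}"
  proof -
    have "set_integrable lebesgue {0<..} (\<lambda>t. f t / of_real t)
      = set_integrable lebesgue {0<..} (\<lambda>t. complex_of_real t powr (z - 1) / of_real (exp t))"
      by (intro set_integrable_cong refl feq)
    then show ?thesis using absolutely_integrable_Gamma_integral'[OF z] by blast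
  qed
  have m: "(\<lambda>t. indicator {0<..} t *\<^sub>R (f t / of_real t)) \<in> borel_measurable lborel" by measurable
  have si: "set_integrable lborel {0<..} (\<lambda>t. f t / of_real t)"
    using a integrable_completion[OF m] by (simp add: set_integrable_def)
  then have int: "integrable lborel (\<lambda>u. f (exp u))" by (simp add: exp_substitution)
  have "(LINT u|lborel. f (exp u)) = (LINT t:{0<..}|lborel. f t / of_real t)"
    using exp_substitution(2)[OF _ int] by simp
  also have "\<dots> = integral {0<..} (\<lambda>t. f t / of_real t)"
    using set_lebesgue_integral_eq_integral(2)[OF a] integral_completion[OF m]
    by (simp add: set_lebesgue_integral_def)
  also have "\<dots> = integral {0<..} (\<lambda>t. complex_of_real t powr (z - 1) / of_real (exp t))"
    by (intro Henstock_Kurzweil_Integration.integral_cong feq)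
  also have "\<dots> = Gamma z"
    using Gamma_integral_complex'[OF z] by (rule integral_unique)
  finally show ?thesis using int by (simp add: has_bochner_integral_iff fe)
qed

text \<open>The affine substitution v = ln l + 2 u reduces the claim to the Gamma integral; its
  Jacobian is the final factor 1/2.\<close>

lemma Mellin_exp_integral:
  assumes s: "Re s > 0" and l: "l > 0"
  shows "has_bochner_integral lborel (\<lambda>u. of_real (exp (- l * exp (2 * u))) * exp (s * of_real u))
     (of_real l powr (- (s / 2)) * Gamma (s / 2) / 2)"
proof -
  have z: "Re (s / 2) > 0" using s by simp
  have "has_bochner_integral lborel (\<lambda>u. of_real (exp (- exp (ln l + 2 * u))) * exp (s / 2 * of_real (ln l + 2 * u)))
     (Gamma (s / 2) /\<^sub>R \<bar>2\<bar>)"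
    using lborel_has_bochner_integral_real_affine_iff[of 2 "\<lambda>u. of_real (exp (- exp u)) * exp (s / 2 * of_real u)" "Gamma (s / 2)" "ln l"]
      Gamma_exp_integral[OF z] by simp
  from has_bochner_integral_mult_right[OF this, of "of_real l powr (- (s / 2))"]
  show ?thesis
  proof (rule has_bochner_integral_cong[THEN iffD1, rotated -1])
    fix u
    have "of_real l powr (- (s / 2)) * exp (s / 2 * of_real (ln l + 2 * u)) = exp (s * of_real u)"
      using l by (simp add: powr_def Ln_of_real algebra_simps flip: exp_add)
    then show "of_real l powr (- (s / 2)) * (of_real (exp (- exp (ln l + 2 * u))) * exp (s / 2 * of_real (ln l + 2 * u)))
      = of_real (exp (- l * exp (2 * u))) * exp (s * of_real u)"
      using l by (simp add: exp_add mult_ac)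
  qed (simp_all add: scaleR_conv_of_real)
qed

text \<open>Because the coefficients are nonnegative, the integral of the norm of a term is the same
  closed formula at the real point Re s. Summability of those numbers is therefore the only
  condition for integrating term by term.\<close>

lemma Mellin_sum:
  fixes c l :: "nat \<Rightarrow> real" and F :: "real \<Rightarrow> real"
  assumes s: "Re s > 0" and l: "\<And>i. l i > 0" and c: "\<And>i. c i \<ge> 0"
    and F: "\<And>u. (\<lambda>i. c i * exp (- l i * exp (2 * u))) sums F u"
    and summ: "summable (\<lambda>i. c i * l i powr (- (Re s / 2)))"
  shows "integrable lborel (\<lambda>u. of_real (F u) * exp (s * of_real u))"
    and "(\<lambda>i. of_real (c i) * (of_real (l i) powr (- (s / 2)) * Gamma (s / 2) / 2)) sums
           (LINT u|lborel. of_real (F u) * exp (s * of_real u))"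
proof -
  define f where "f = (\<lambda>i u. complex_of_real (c i) * (of_real (exp (- l i * exp (2 * u))) * exp (s * of_real u)))"
  have f: "has_bochner_integral lborel (f i) (of_real (c i) * (of_real (l i) powr (- (s / 2)) * Gamma (s / 2) / 2))" for i
    unfolding f_def by (intro has_bochner_integral_mult_right Mellin_exp_integral s l)
  have nf: "norm (f i u) = c i * exp (- l i * exp (2 * u)) * exp (Re s * u)" for i u
    using c[of i] by (simp add: f_def norm_mult)
  have intnf: "(LINT u|lborel. norm (f i u)) = c i * l i powr (- (Re s / 2)) * (Gamma (Re s / 2) / 2)" for i
  proof -
    have "has_bochner_integral lborel (\<lambda>u. of_real (c i) * (of_real (exp (- l i * exp (2 * u))) * exp (complex_of_real (Re s) * of_real u)))
      (of_real (c i) * (of_real (l i) powr (- (complex_of_real (Re s) / 2)) * Gamma (complex_of_real (Re s) / 2) / 2))"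
      by (intro has_bochner_integral_mult_right Mellin_exp_integral l) (use s in simp)
    also have "(\<lambda>u. of_real (c i) * (of_real (exp (- l i * exp (2 * u))) * exp (complex_of_real (Re s) * of_real u))) = (\<lambda>u. complex_of_real (norm (f i u)))"
      unfolding nf by (auto simp flip: exp_of_real)
    also have "of_real (c i) * (of_real (l i) powr (- (complex_of_real (Re s) / 2)) * Gamma (complex_of_real (Re s) / 2) / 2)
      = complex_of_real (c i * l i powr (- (Re s / 2)) * (Gamma (Re s / 2) / 2))"
    proof -
      have "of_real (l i) powr (- (complex_of_real (Re s) / 2)) = complex_of_real (l i powr (- (Re s / 2)))"
        using powr_of_real[of "l i" "- (Re s / 2)"] l[of i] by simp
      moreover have "Gamma (complex_of_real (Re s) / 2) = complex_of_real (Gamma (Re s / 2))"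
        using Gamma_complex_of_real[of "Re s / 2"] by simp
      ultimately show ?thesis by simp
    qed
    finally have "(LINT u|lborel. complex_of_real (norm (f i u))) = complex_of_real (c i * l i powr (- (Re s / 2)) * (Gamma (Re s / 2) / 2))"
      by (rule has_bochner_integral_integral_eq)
    then show ?thesis by (simp only: integral_complex_of_real of_real_eq_iff)
  qed
  have fi: "integrable lborel (f i)" for i using f[of i] by (simp add: has_bochner_integral_iff)
  have AE: "AE u in lborel. summable (\<lambda>i. norm (f i u))"
    unfolding nf by (intro AE_I2 summable_mult2 sums_summable[OF F])
  have ints: "summable (\<lambda>i. LINT u|lborel. norm (f i u))"
    unfolding intnf by (intro summable_mult2 summ)
  have sum: "(\<Sum>i. f i u) = of_real (F u) * exp (s * of_real u)" for u
  proof -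
    have "(\<lambda>i. complex_of_real (c i * exp (- l i * exp (2 * u))) * exp (s * of_real u)) sums (of_real (F u) * exp (s * of_real u))"
      by (intro sums_mult2 sums_of_real F)
    then show ?thesis by (intro sums_unique[symmetric]) (simp add: f_def mult_ac)
  qed
  show "integrable lborel (\<lambda>u. of_real (F u) * exp (s * of_real u))"
    using integrable_suminf[OF fi AE ints] unfolding sum .
  show "(\<lambda>i. of_real (c i) * (of_real (l i) powr (- (s / 2)) * Gamma (s / 2) / 2)) sums
           (LINT u|lborel. of_real (F u) * exp (s * of_real u))"
    using sums_integral[OF fi AE ints] unfolding sum has_bochner_integral_integral_eq[OF f] .
qed

text \<open>The integrals without the factor \<open>u\<close> produce the simple poles of the
  continuation; those with it produce the double pole 1 / s^2 that appears at w = 0.\<close>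

lemma exp_integral_half_line:
  fixes a :: complex
  assumes a: "Re a > 0"
  shows "set_integrable lborel {0<..} (\<lambda>u. exp (- a * of_real u))"
    and "(LINT u:{0<..}|lborel. exp (- a * of_real u)) = 1 / a"
    and "set_integrable lborel {0<..} (\<lambda>u. of_real u * exp (- a * of_real u))"
    and "(LINT u:{0<..}|lborel. of_real u * exp (- a * of_real u)) = 1 / a\<^sup>2"
proof -
  define r where "r = Re a"
  have r: "r > 0" using a by (simp add: r_def)
  have a0: "a \<noteq> 0" using a by auto
  have bound: "set_integrable lborel {0<..} (\<lambda>u::real. exp (- (b * u)))" if b: "b > 0" for b :: real
  proof -
    have "set_integrable lborel (einterval 0 \<infinity>) (\<lambda>u::real. exp (- (b * u)))"
    proof (rule interval_integral_FTC_nonneg(1)[where F = "\<lambda>u. - exp (- (b * u)) / b" and A = "- 1 / b" and B = 0])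
      show "((\<lambda>u. - exp (- (b * u)) / b) has_real_derivative exp (- (b * u))) (at u)" for u
        using b by (auto intro!: derivative_eq_intros)
      show "(((\<lambda>u. - exp (- (b * u)) / b) \<circ> real_of_ereal) \<longlongrightarrow> - 1 / b) (at_right 0)"
        unfolding zero_ereal_def o_def ereal_tendsto_simps1
        using b by (auto intro!: tendsto_eq_intros)
      show "(((\<lambda>u. - exp (- (b * u)) / b) \<circ> real_of_ereal) \<longlongrightarrow> 0) (at_left \<infinity>)"
        unfolding ereal_tendsto_simps1 using b by real_asymp
    qed (auto intro!: continuous_intros AE_I2)
    then show ?thesis by (simp add: einterval_def zero_ereal_def greaterThan_def)
  qed
  show i1: "set_integrable lborel {0<..} (\<lambda>u. exp (- a * of_real u))"
    by (rule set_integrable_bound[OF bound[OF r]]) (auto simp: set_borel_measurable_def r_def)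
  show i2: "set_integrable lborel {0<..} (\<lambda>u. of_real u * exp (- a * of_real u))"
  proof (rule set_integrable_bound)
    \<comment> \<open>Half of the exponential decay is given up to absorb the factor
      \<open>u\<close>, by r u / 2 \<le> exp (r u / 2).\<close>
    show "set_integrable lborel {0<..} (\<lambda>u. 2 / r * exp (- (r / 2 * u)))"
      using bound[of "r / 2"] r by (intro set_integrable_mult_right) auto
    show "AE u in lborel. u \<in> {0<..} \<longrightarrow> norm (of_real u * exp (- a * of_real u)) \<le> norm (2 / r * exp (- (r / 2 * u)))"
    proof (intro AE_I2 impI)
      fix u :: real assume u: "u \<in> {0<..}"
      have "r / 2 * u \<le> exp (r / 2 * u)" using exp_ge_add_one_self[of "r / 2 * u"] by linarith
      then have "u \<le> 2 / r * exp (r / 2 * u)" using r by (simp add: field_simps)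
      then have "u * exp (- (r * u)) \<le> 2 / r * exp (r / 2 * u) * exp (- (r * u))"
        by (intro mult_right_mono) auto
      also have "\<dots> = 2 / r * exp (- (r / 2 * u))"
        by (simp add: mult.assoc flip: exp_add)
      finally show "norm (of_real u * exp (- a * of_real u)) \<le> norm (2 / r * exp (- (r / 2 * u)))"
        using u r by (simp add: norm_mult r_def)
    qed
  qed (auto simp: set_borel_measurable_def)
  have dec: "((\<lambda>u. exp (- a * of_real u)) \<longlongrightarrow> 0) at_top"
  proof (rule tendsto_norm_zero_cancel)
    show "((\<lambda>u. norm (exp (- a * complex_of_real u))) \<longlongrightarrow> 0) at_top"
      unfolding norm_exp_eq_Re using r by (simp add: r_def) real_asymp
  qed
  have dec2: "((\<lambda>u. of_real u * exp (- a * of_real u)) \<longlongrightarrow> 0) at_top"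
  proof (rule tendsto_norm_zero_cancel)
    show "((\<lambda>u. norm (of_real u * exp (- a * complex_of_real u))) \<longlongrightarrow> 0) at_top"
      unfolding norm_mult norm_exp_eq_Re using r by (simp add: r_def) real_asymp
  qed
  have ev: "einterval (ereal 0) \<infinity> = {0<..}" by (auto simp: einterval_def)
  have FTC: "(LINT u:{0<..}|lborel. f u) = - F 0"
    if der: "\<And>u. (F has_vector_derivative f u) (at u)" and cont: "\<And>u. isCont f u"
      and int: "set_integrable lborel {0<..} f" and lim: "(F \<longlongrightarrow> 0) at_top" for f F :: "real \<Rightarrow> complex"
  proof -
    have "(LBINT u=ereal 0..\<infinity>. f u) = 0 - F 0"
    proof (rule interval_integral_FTC_integrable[where F = F])
      have "isCont F 0" using der[of 0] has_vector_derivative_continuous by blast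
      then show "((F \<circ> real_of_ereal) \<longlongrightarrow> F 0) (at_right (ereal 0))"
        unfolding ereal_tendsto_simps1
        by (simp add: isCont_def filterlim_at_split)
      show "((F \<circ> real_of_ereal) \<longlongrightarrow> 0) (at_left \<infinity>)"
        unfolding ereal_tendsto_simps1 by (rule lim)
    qed (use der cont int in \<open>auto simp: ev\<close>)
    then show ?thesis by (simp add: interval_lebesgue_integral_def ev)
  qed
  have "(LINT u:{0<..}|lborel. exp (- a * of_real u)) = - (- exp (- a * of_real 0) / a)"
  proof (rule FTC[OF _ _ i1])
    show "((\<lambda>u. - exp (- a * of_real u) / a) has_vector_derivative exp (- a * of_real u)) (at u)" for u
      using a0 by (auto intro!: derivative_eq_intros has_vector_derivative_real_field)
    show "((\<lambda>u. - exp (- a * of_real u) / a) \<longlongrightarrow> 0) at_top"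
      using tendsto_divide[OF tendsto_minus[OF dec] tendsto_const[of a]] a0 by simp
  qed (auto intro!: continuous_intros)
  then show "(LINT u:{0<..}|lborel. exp (- a * of_real u)) = 1 / a" by simp
  have "(LINT u:{0<..}|lborel. of_real u * exp (- a * of_real u))
      = - (- of_real 0 * exp (- a * of_real 0) / a - exp (- a * of_real 0) / a\<^sup>2)"
  proof (rule FTC[OF _ _ i2])
    show "((\<lambda>u. - of_real u * exp (- a * of_real u) / a - exp (- a * of_real u) / a\<^sup>2) has_vector_derivative
        of_real u * exp (- a * of_real u)) (at u)" for u
      using a0 by (auto intro!: derivative_eq_intros has_vector_derivative_real_field simp: field_simps power2_eq_square)
    show "((\<lambda>u. - of_real u * exp (- a * of_real u) / a - exp (- a * of_real u) / a\<^sup>2) \<longlongrightarrow> 0) at_top"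
      using tendsto_diff[OF tendsto_divide[OF tendsto_minus[OF dec2] tendsto_const[of a]] tendsto_divide[OF dec tendsto_const[of "a\<^sup>2"]]] a0
      by simp
  qed (auto intro!: continuous_intros)
  then show "(LINT u:{0<..}|lborel. of_real u * exp (- a * of_real u)) = 1 / a\<^sup>2" by simp
qed

section \<open>Differentiation under the integral; decay of the logarithm of theta\<close>

text \<open>A majorant of both partial derivatives on a ball also bounds the difference quotients
  there, by the mean value inequality. The first-order remainder divided by the norm of the
  increment is thus dominated, and it tends to 0 pointwise.\<close>

lemma holomorphic2_on_integral:
  fixes F A B :: "complex \<times> complex \<Rightarrow> real \<Rightarrow> complex"
  assumes der: "\<And>p u. u \<in> space M \<Longrightarrow> ((\<lambda>p. F p u) has_derivative (\<lambda>h. A p u * fst h + B p u * snd h)) (at p)"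
    and F: "\<And>p. integrable M (F p)"
    and A: "\<And>p. A p \<in> borel_measurable M" and B: "\<And>p. B p \<in> borel_measurable M"
    and dom: "\<And>R. R > 0 \<Longrightarrow> \<exists>g. integrable M g \<and> (\<forall>p u. norm p \<le> R \<longrightarrow> u \<in> space M \<longrightarrow> norm (A p u) \<le> g u \<and> norm (B p u) \<le> g u)"
  shows "holomorphic2_on (\<lambda>p. \<integral>u. F p u \<partial>M) UNIV"
  unfolding holomorphic2_on_def
proof (intro ballI exI)
  fix p :: "complex \<times> complex"
  \<comment> \<open>The extra 1 keeps \<open>p + h\<close> in the ball of the majorant for all
    increments of norm at most 1.\<close>
  define R where "R = norm p + 1"
  have "R > 0" unfolding R_def by (simp add: add_nonneg_pos)
  from dom[OF this] obtain g where g: "integrable M g"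
    and gAB: "\<forall>p u. norm p \<le> R \<longrightarrow> u \<in> space M \<longrightarrow> norm (A p u) \<le> g u \<and> norm (B p u) \<le> g u"
    by (elim exE conjE)
  have gA: "norm (A p u) \<le> g u" and gB: "norm (B p u) \<le> g u" if "norm p \<le> R" "u \<in> space M" for p u
    using gAB[rule_format, OF that] by (rule conjunct1, rule conjunct2)
  have pR: "norm p \<le> R" by (simp add: R_def)
  have intA: "integrable M (A p)"
    by (rule Bochner_Integration.integrable_bound[OF g A]) (auto intro!: AE_I2 order.trans[OF gA[OF pR]])
  have intB: "integrable M (B p)"
    by (rule Bochner_Integration.integrable_bound[OF g B]) (auto intro!: AE_I2 order.trans[OF gB[OF pR]])
  have lin: "norm (A q u * fst h + B q u * snd h) \<le> 2 * g u * norm h"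
    if "norm q \<le> R" "u \<in> space M" for q u h
  proof -
    have g0: "0 \<le> g u" using gA[OF that] norm_ge_zero order_trans by blast
    have "norm (A q u * fst h + B q u * snd h) \<le> norm (A q u) * norm (fst h) + norm (B q u) * norm (snd h)"
      by (metis norm_mult norm_triangle_ineq)
    also have "\<dots> \<le> g u * norm h + g u * norm h"
      using g0 gA[OF that] gB[OF that] norm_fst_le[of "fst h" "snd h"] norm_snd_le[of "snd h" "fst h"]
      by (intro add_mono mult_mono) auto
    finally show ?thesis by (simp add: mult_ac)
  qed
  have lip: "norm (F (p + h) u - F p u) \<le> 2 * g u * norm h"
    if h: "norm h \<le> 1" and u: "u \<in> space M" for h u
  proof -
    have "norm (F (p + h) u - F p u) \<le> 2 * g u * norm ((p + h) - p)"
    proof (rule differentiable_bound[where S = "cball 0 R"])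
      show "((\<lambda>p. F p u) has_derivative (\<lambda>h. A q u * fst h + B q u * snd h)) (at q within cball 0 R)" for q
        using der[OF u] has_derivative_at_withinI by blast
      show "onorm (\<lambda>h. A q u * fst h + B q u * snd h) \<le> 2 * g u" if "q \<in> cball 0 R" for q
        by (rule onorm_le) (use that u lin in auto)
      show "p + h \<in> cball 0 R"
        using norm_triangle_ineq[of p h] h by (simp add: R_def)
    qed (use pR in auto)
    then show ?thesis by simp
  qed
  define E where "E h u = F (p + h) u - F p u - (A p u * fst h + B p u * snd h)" for h u
  have intE: "integrable M (E h)" for h
    unfolding E_def by (intro Bochner_Integration.integrable_diff Bochner_Integration.integrable_add
        integrable_mult_left F intA intB)
  have Ebound: "norm (E h u) / norm h \<le> 4 * g u" if "norm h \<le> 1" "u \<in> space M" for h u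
  proof (cases "h = 0")
    case False
    have "norm (E h u) \<le> norm (F (p + h) u - F p u) + norm (A p u * fst h + B p u * snd h)"
      unfolding E_def by (rule norm_triangle_ineq4)
    also have "\<dots> \<le> 2 * g u * norm h + 2 * g u * norm h"
      by (intro add_mono lip lin that pR)
    finally show ?thesis using False by (simp add: field_simps)
  next
    case True
    have "0 \<le> g u" using gA[OF pR that(2)] norm_ge_zero order_trans by blast
    with True show ?thesis by simp
  qed
  have lim: "((\<lambda>h. (\<integral>u. norm (E h u) / norm h \<partial>M)) \<longlongrightarrow> 0) (at 0)"
    unfolding tendsto_at_iff_sequentially
  proof (intro allI impI)
    fix X :: "nat \<Rightarrow> complex \<times> complex"
    assume X: "\<forall>i. X i \<in> UNIV - {0}" "X \<longlonglongrightarrow> 0"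
    then obtain N where N: "\<And>n. n \<ge> N \<Longrightarrow> norm (X n) < 1"
      using LIMSEQ_D[of X 0 1] by auto
    \<comment> \<open>Shifting by \<open>N\<close> discards the increments that are too large for
      the bound \<open>Ebound\<close>.\<close>
    have "(\<lambda>n. \<integral>u. norm (E (X (n + N)) u) / norm (X (n + N)) \<partial>M) \<longlonglongrightarrow> (\<integral>u. 0 \<partial>M)"
    proof (rule integral_dominated_convergence)
      show "integrable M (\<lambda>u. 4 * g u)" using g by simp
      show "(\<lambda>u. norm (E (X (n + N)) u) / norm (X (n + N))) \<in> borel_measurable M" for n
        using intE by (intro borel_measurable_divide borel_measurable_norm borel_measurable_integrable) auto
      show "AE u in M. (\<lambda>n. norm (E (X (n + N)) u) / norm (X (n + N))) \<longlonglongrightarrow> 0"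
      proof (rule AE_I2)
        fix u assume u: "u \<in> space M"
        have "((\<lambda>h. norm (E h u) / norm h) \<longlongrightarrow> 0) (at 0)"
          using der[OF u, of p] unfolding has_derivative_at E_def by simp
        then have "(\<lambda>n. norm (E (X n) u) / norm (X n)) \<longlonglongrightarrow> 0"
          using X by (auto simp: tendsto_at_iff_sequentially o_def)
        then show "(\<lambda>n. norm (E (X (n + N)) u) / norm (X (n + N))) \<longlonglongrightarrow> 0"
          by (rule LIMSEQ_ignore_initial_segment)
      qed
      show "AE u in M. norm (norm (E (X (n + N)) u) / norm (X (n + N))) \<le> 4 * g u" for n
        using Ebound[of "X (n + N)"] N[of "n + N"] by (intro AE_I2) simp
    qed simp
    then show "((\<lambda>h. \<integral>u. norm (E h u) / norm h \<partial>M) \<circ> X) \<longlonglongrightarrow> 0"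
      unfolding o_def using LIMSEQ_offset[of "\<lambda>n. \<integral>u. norm (E (X n) u) / norm (X n) \<partial>M" N 0] by simp
  qed
  have eq: "(\<integral>u. F (p + h) u \<partial>M) - (\<integral>u. F p u \<partial>M) - ((\<integral>u. A p u \<partial>M) * fst h + (\<integral>u. B p u \<partial>M) * snd h) = (\<integral>u. E h u \<partial>M)" for h
    unfolding E_def using F intA intB by simp
  have "((\<lambda>h. norm (\<integral>u. E h u \<partial>M) / norm h) \<longlongrightarrow> 0) (at 0)"
  proof (rule tendsto_sandwich[OF _ _ tendsto_const lim])
    show "\<forall>\<^sub>F h in at 0. norm (\<integral>u. E h u \<partial>M) / norm h \<le> (\<integral>u. norm (E h u) / norm h \<partial>M)"
      by (intro always_eventually allI) (simp add: divide_right_mono)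
  qed auto
  moreover have "bounded_linear (\<lambda>h::complex \<times> complex. (\<integral>u. A p u \<partial>M) * fst h + (\<integral>u. B p u \<partial>M) * snd h)"
    by (intro bounded_linear_add bounded_linear_const_mult bounded_linear_fst bounded_linear_snd)
  ultimately show "((\<lambda>p. \<integral>u. F p u \<partial>M) has_derivative (\<lambda>h. (\<integral>u. A p u \<partial>M) * fst h + (\<integral>u. B p u \<partial>M) * snd h)) (at p within UNIV)"
    unfolding has_derivative_at eq by simp
qed

section \<open>The entire function (exp z - 1) / z and its derivative\<close>

definition expm1_quot :: "complex \<Rightarrow> complex" where
  "expm1_quot z = (\<Sum>n. (1 / fact (Suc n)) * z ^ n)"

definition expm1_quot' :: "complex \<Rightarrow> complex" where
  "expm1_quot' z = (\<Sum>n. diffs (\<lambda>n. 1 / fact (Suc n)) n * z ^ n)"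

lemma norm_inverse_fact_Suc_le: "norm (1 / fact (Suc n) :: complex) \<le> 1 / fact n"
proof -
  have "(fact n :: real) \<le> fact (Suc n)" by (rule fact_mono) simp
  then show ?thesis by (simp add: norm_divide frac_le del: fact_Suc)
qed

lemma norm_expm1_quot_coeff_le: "norm ((1 / fact (Suc n)) * z ^ n :: complex) \<le> norm z ^ n /\<^sub>R fact n"
  using mult_right_mono[OF norm_inverse_fact_Suc_le[of n], of "norm z ^ n"]
  by (simp add: norm_mult norm_power divide_inverse del: fact_Suc)

lemma summable_norm_expm1_quot: "summable (\<lambda>n. norm ((1 / fact (Suc n)) * z ^ n :: complex))"
proof (rule summable_comparison_test'[where N = 0])
  show "summable (\<lambda>n. norm z ^ n /\<^sub>R fact n)" by (rule summable_exp_generic)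
  show "norm (norm ((1 / fact (Suc n)) * z ^ n)) \<le> norm z ^ n /\<^sub>R fact n" for n
    unfolding real_norm_def abs_norm_cancel by (rule norm_expm1_quot_coeff_le)
qed

lemma expm1_quot_mult: "z * expm1_quot z = exp z - 1"
proof -
  have "(\<lambda>n. (1 / fact (Suc n)) * z ^ n) sums expm1_quot z"
    unfolding expm1_quot_def by (rule summable_sums[OF summable_norm_cancel[OF summable_norm_expm1_quot]])
  then have "(\<lambda>n. z * ((1 / fact (Suc n)) * z ^ n)) sums (z * expm1_quot z)" by (rule sums_mult)
  moreover have "(\<lambda>n. z * ((1 / fact (Suc n)) * z ^ n)) sums (exp z - 1)"
  proof -
    have "(\<lambda>n. z ^ n /\<^sub>R fact n) sums exp z" by (rule exp_converges)
    then have "(\<lambda>n. z ^ Suc n /\<^sub>R fact (Suc n)) sums (exp z - 1)"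
      by (subst sums_Suc_iff) simp
    then show ?thesis by (simp add: scaleR_conv_of_real divide_inverse mult_ac del: fact_Suc)
  qed
  ultimately show ?thesis by (rule sums_unique2)
qed

lemma expm1_quot_0 [simp]: "expm1_quot 0 = 1"
  unfolding expm1_quot_def by (subst powser_zero) simp

lemma has_field_derivative_expm1_quot: "(expm1_quot has_field_derivative expm1_quot' z) (at z)"
  unfolding expm1_quot_def[abs_def] expm1_quot'_def
  by (rule termdiffs_strong_converges_everywhere) (rule summable_norm_cancel[OF summable_norm_expm1_quot])

lemma norm_expm1_quot_le: "norm (expm1_quot z) \<le> exp (norm z)"
proof -
  have "norm (expm1_quot z) \<le> (\<Sum>n. norm z ^ n /\<^sub>R fact n)"
    unfolding expm1_quot_def
    by (rule norm_suminf_le[OF norm_expm1_quot_coeff_le summable_exp_generic])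
  then show ?thesis by (simp add: exp_def)
qed

lemma norm_expm1_quot'_le: "norm (expm1_quot' z) \<le> exp (norm z)"
proof -
  have "norm (expm1_quot' z) \<le> (\<Sum>n. norm z ^ n /\<^sub>R fact n)"
    unfolding expm1_quot'_def
  proof (rule norm_suminf_le[OF _ summable_exp_generic])
    fix n
    have "norm (diffs (\<lambda>n. 1 / fact (Suc n)) n :: complex) = real (Suc n) / fact (Suc (Suc n))"
      by (simp add: diffs_def norm_mult norm_divide del: fact_Suc of_nat_Suc)
    also have "\<dots> \<le> 1 / fact n"
    proof -
      have "real (Suc n) * fact n = fact (Suc n)" by simp
      also have "\<dots> \<le> (fact (Suc (Suc n)) :: real)" by (rule fact_mono) simp
      finally show ?thesis by (simp add: field_simps del: fact_Suc of_nat_Suc)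
    qed
    finally show "norm (diffs (\<lambda>n. 1 / fact (Suc n)) n * z ^ n) \<le> norm z ^ n /\<^sub>R fact n"
      by (auto simp: norm_mult norm_power divide_inverse intro!: mult_right_mono)
  qed
  then show ?thesis by (simp add: exp_def)
qed

lemma isCont_expm1_quot': "isCont expm1_quot' z"
proof -
  have "expm1_quot holomorphic_on UNIV"
    using has_field_derivative_expm1_quot by (auto simp: holomorphic_on_def field_differentiable_def)
  then have "deriv expm1_quot holomorphic_on UNIV" by (intro holomorphic_deriv) auto
  moreover have "deriv expm1_quot = expm1_quot'"
    using has_field_derivative_expm1_quot by (intro ext DERIV_imp_deriv)
  ultimately have "continuous_on UNIV expm1_quot'"
    using holomorphic_on_imp_continuous_on by metis
  then show ?thesis by (simp add: continuous_on_eq_continuous_at)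
qed

lemma borel_measurable_expm1_quot [measurable]: "expm1_quot \<in> borel_measurable borel"
proof (rule borel_measurable_continuous_onI, rule continuous_at_imp_continuous_on, rule ballI)
  show "isCont expm1_quot z" for z by (rule DERIV_isCont[OF has_field_derivative_expm1_quot])
qed

lemma borel_measurable_expm1_quot' [measurable]: "expm1_quot' \<in> borel_measurable borel"
  by (rule borel_measurable_continuous_onI, rule continuous_at_imp_continuous_on) (simp add: isCont_expm1_quot')

section \<open>Positivity and decay of theta and of its logarithm\<close>

lemma riemann_theta_has_sum:
  assumes t: "t > 0"
  shows "((\<lambda>n::nat. 2 * exp (- (pi * (real (Suc n))\<^sup>2) * t)) has_sum (riemann_theta t - 1)) UNIV"
proof -
  have a: "pi * t > 0" using t by simp
  obtain S where S: "((\<lambda>n::nat. exp (- (pi * t) * (real (Suc n))\<^sup>2)) has_sum S) UNIV"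
    using summable_exp_neg_Suc_square[OF a] by (auto simp: summable_on_def)
  have "((\<lambda>n::int. exp (- (pi * t) * (of_int n)\<^sup>2)) has_sum (1 + 2 * S)) UNIV"
    using has_sum_int_even[of "\<lambda>n. exp (- (pi * t) * (of_int n)\<^sup>2)" S] S by simp
  then have "riemann_theta t = 1 + 2 * S"
    unfolding riemann_theta_eq by (rule infsumI)
  then show ?thesis
    using has_sum_cmult_right[OF S, of 2] by (simp add: mult_ac)
qed

lemma riemann_theta_gt_1:
  assumes t: "t > 0"
  shows "riemann_theta t > 1"
proof -
  have "2 * exp (- (pi * (real (Suc 0))\<^sup>2) * t) \<le> riemann_theta t - 1"
    using finite_sum_le_has_sum[OF riemann_theta_has_sum[OF t], of "{0}"] by simp
  then show ?thesis using exp_gt_zero[of "- (pi * (real (Suc 0))\<^sup>2) * t"] by linarith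
qed

text \<open>By n^2 \<ge> n, the series is bounded by a geometric one in x = exp (- pi t); for t
  \<ge> 1 this x is at most 1/2, so 2 x / (1 - x) \<le> 4 x.\<close>

lemma riemann_theta_minus_1_le:
  assumes t: "t \<ge> 1"
  shows "riemann_theta t - 1 \<le> 4 * exp (- (pi * t))"
proof -
  define x where "x = exp (- (pi * t))"
  have "(2::real) \<le> exp 1" using exp_ge_add_one_self[of 1] by simp
  also have "\<dots> \<le> exp (pi * t)"
    using t pi_gt3 mult_mono[of 1 pi 1 t] by simp
  finally have x: "0 < x" "x \<le> 1 / 2" by (auto simp: x_def exp_minus field_simps)
  have "(\<lambda>n. x ^ n) sums (1 / (1 - x))" using x by (intro geometric_sums) auto
  from sums_mult[OF this, of "2 * x"] have g: "(\<lambda>n. 2 * x * x ^ n) sums (2 * x * (1 / (1 - x)))" .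
  have h: "(\<lambda>n. 2 * exp (- (pi * (real (Suc n))\<^sup>2) * t)) sums (riemann_theta t - 1)"
    using t by (intro has_sum_imp_sums riemann_theta_has_sum) simp
  have "riemann_theta t - 1 \<le> 2 * x * (1 / (1 - x))"
  proof (rule sums_le[OF _ h g])
    fix n
    have "real (Suc n) * 1 \<le> real (Suc n) * real (Suc n)" by (intro mult_left_mono) auto
    then have "real (Suc n) * (pi * t) \<le> (real (Suc n))\<^sup>2 * (pi * t)"
      using t by (intro mult_right_mono) (auto simp: power2_eq_square)
    then have "exp (- (pi * (real (Suc n))\<^sup>2) * t) \<le> exp (real (Suc n) * (- (pi * t)))"
      by (simp add: mult_ac del: of_nat_Suc)
    also have "\<dots> = x * x ^ n" unfolding exp_of_nat_mult x_def by simp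
    finally show "2 * exp (- (pi * (real (Suc n))\<^sup>2) * t) \<le> 2 * x * x ^ n" by simp
  qed
  also have "\<dots> \<le> 4 * x" using x by (simp add: field_simps)
  finally show ?thesis by (simp add: x_def)
qed

definition log_theta :: "real \<Rightarrow> real" where
  "log_theta u = ln (riemann_theta (exp (2 * u)))"

lemma log_theta_pos: "log_theta u > 0"
  using riemann_theta_gt_1[of "exp (2 * u)"] by (simp add: log_theta_def)

lemma exp_log_theta: "exp (log_theta u) = riemann_theta (exp (2 * u))"
  using riemann_theta_gt_1[of "exp (2 * u)"] by (simp add: log_theta_def)

text \<open>The transformation formula on the logarithmic scale. The summand \<open>u\<close> is
  what keeps the folded integrals from being entire: exponentiated, it gives the terms with
  poles.\<close>

lemma log_theta_uminus: "log_theta (- u) = log_theta u + u"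
proof -
  have t: "riemann_theta (exp (2 * u)) > 0" using riemann_theta_gt_1[of "exp (2 * u)"] by simp
  have "riemann_theta (exp (2 * - u)) = sqrt (exp (2 * u)) * riemann_theta (exp (2 * u))"
    using riemann_theta_inverse[of "exp (2 * u)"] by (simp add: exp_minus divide_inverse)
  also have "sqrt (exp (2 * u)) = exp u"
    by (simp add: exp_double)
  finally show ?thesis using t by (simp add: log_theta_def ln_mult)
qed

lemma borel_measurable_log_theta [measurable]: "log_theta \<in> borel_measurable borel"
proof -
  have "riemann_theta (exp (2 * u)) = 1 + (\<Sum>n. 2 * exp (- (pi * (real (Suc n))\<^sup>2) * exp (2 * u)))" for u
    using sums_unique[OF has_sum_imp_sums[OF riemann_theta_has_sum[of "exp (2 * u)"]]] by simp
  then show ?thesis unfolding log_theta_def[abs_def] by simp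
qed

text \<open>From ln y \<le> y - 1, log theta is at most 4 exp (- pi exp (2u)); since exp (2u) \<ge>
  u^2, completing the square beats any linear exponent. Working with K + 1 in place of
  \<open>K\<close> leaves the integrable factor exp (-u).\<close>

lemma log_theta_decay:
  assumes u: "u \<ge> 0" and K: "K \<ge> 0"
  shows "log_theta u * exp (K * u) \<le> 4 * exp ((K + 1)\<^sup>2) * exp (- u)"
proof -
  have "log_theta u \<le> riemann_theta (exp (2 * u)) - 1"
    unfolding log_theta_def using riemann_theta_gt_1[of "exp (2 * u)"] by (intro ln_le_minus_one) simp
  also have "\<dots> \<le> 4 * exp (- (pi * exp (2 * u)))"
    using u by (intro riemann_theta_minus_1_le) simp
  also have "pi * exp (2 * u) \<ge> (K + 1) * u - (K + 1)\<^sup>2"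
  proof -
    have "u\<^sup>2 \<le> 1 + 2 * u + (2 * u)\<^sup>2 / 2" using u by (simp add: power2_eq_square)
    also have "\<dots> \<le> exp (2 * u)" using u by (intro exp_lower_Taylor_quadratic) simp
    also have "\<dots> \<le> pi * exp (2 * u)" using pi_gt3 by simp
    finally have "u\<^sup>2 \<le> pi * exp (2 * u)" .
    moreover have "0 \<le> (u - (K + 1) / 2)\<^sup>2" by simp
    then have "(K + 1) * u - (K + 1)\<^sup>2 / 4 \<le> u\<^sup>2" by (simp add: power2_eq_square field_simps)
    moreover have "(K + 1)\<^sup>2 / 4 \<le> (K + 1)\<^sup>2" by simp
    ultimately show ?thesis by linarith
  qed
  then have "4 * exp (- (pi * exp (2 * u))) \<le> 4 * exp ((K + 1)\<^sup>2 - (K + 1) * u)" by simp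
  finally have "log_theta u * exp (K * u) \<le> 4 * exp ((K + 1)\<^sup>2 - (K + 1) * u) * exp (K * u)"
    by (intro mult_right_mono) auto
  also have "\<dots> = 4 * exp ((K + 1)\<^sup>2) * exp (- u)"
    by (simp add: algebra_simps flip: exp_add)
  finally show ?thesis .
qed

lemma log_theta_bound:
  assumes u: "u \<ge> 0"
  shows "log_theta u \<le> 4 * exp 1"
proof -
  have "log_theta u \<le> 4 * exp 1 * exp (- u)" using log_theta_decay[OF u, of 0] by simp
  also have "\<dots> \<le> 4 * exp 1 * 1" using u by (intro mult_left_mono) auto
  finally show ?thesis by simp
qed

section \<open>The entire part of the two-variable zeta function\<close>

text \<open>The first two factors are the quotient (exp (w L) - 1) / w in a form that is also
  defined at w = 0, where it is \<open>L\<close>.\<close>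

definition ZQ_kernel :: "complex \<Rightarrow> complex \<Rightarrow> real \<Rightarrow> complex" where
  "ZQ_kernel w s u = of_real (log_theta u) * expm1_quot (w * of_real (log_theta u)) *
     (exp (s * of_real u) + exp ((w - s) * of_real u))"

definition ZQ_entire :: "complex \<Rightarrow> complex \<Rightarrow> complex" where
  "ZQ_entire w s = (LINT u:{0<..}|lborel. ZQ_kernel w s u)"

lemma ZQ_kernel_mult:
  "w * ZQ_kernel w s u = (exp (w * of_real (log_theta u)) - 1) * (exp (s * of_real u) + exp ((w - s) * of_real u))"
  using expm1_quot_mult[of "w * of_real (log_theta u)"] by (simp add: ZQ_kernel_def mult_ac)

lemma borel_measurable_ZQ_kernel [measurable]: "ZQ_kernel w s \<in> borel_measurable borel"
  unfolding ZQ_kernel_def[abs_def] by measurable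

lemma ZQ_entire_symmetric: "ZQ_entire w (w - s) = ZQ_entire w s"
  by (simp add: ZQ_entire_def ZQ_kernel_def add.commute)

lemma set_integrable_exp_neg: "set_integrable lborel {0<..} (\<lambda>u::real. C * exp (- u))"
proof -
  have "set_integrable lborel {0<..} (\<lambda>u. exp (- 1 * complex_of_real u))"
    by (rule exp_integral_half_line) simp
  then have "set_integrable lborel {0<..} (\<lambda>u. norm (exp (- 1 * complex_of_real u)))"
    by (rule set_integrable_norm)
  then show ?thesis by simp
qed

text \<open>One factor \<open>log_theta\<close> compensates every exponential growth rate, so
  integrability of all the kernels reduces to a pointwise bound of this shape.\<close>

lemma set_integrable_log_theta_bound:
  fixes f :: "real \<Rightarrow> complex"
  assumes [measurable]: "f \<in> borel_measurable borel" and K: "K \<ge> 0"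
    and f: "\<And>u. u > 0 \<Longrightarrow> norm (f u) \<le> C * (log_theta u * exp (K * u))"
  shows "set_integrable lborel {0<..} f"
proof (rule set_integrable_bound)
  show "set_integrable lborel {0<..} (\<lambda>u. \<bar>C\<bar> * (4 * exp ((K + 1)\<^sup>2)) * exp (- u))"
    by (rule set_integrable_exp_neg)
  show "AE u in lborel. u \<in> {0<..} \<longrightarrow> norm (f u) \<le> norm (\<bar>C\<bar> * (4 * exp ((K + 1)\<^sup>2)) * exp (- u))"
  proof (intro AE_I2 impI)
    fix u :: real assume u: "u \<in> {0<..}"
    have "norm (f u) \<le> C * (log_theta u * exp (K * u))" using f u by simp
    also have "\<dots> \<le> \<bar>C\<bar> * (log_theta u * exp (K * u))"
      using log_theta_pos[of u] by (intro mult_right_mono) auto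
    also have "\<dots> \<le> \<bar>C\<bar> * (4 * exp ((K + 1)\<^sup>2) * exp (- u))"
      using u K by (intro mult_left_mono log_theta_decay) auto
    finally show "norm (f u) \<le> norm (\<bar>C\<bar> * (4 * exp ((K + 1)\<^sup>2)) * exp (- u))" by simp
  qed
qed (simp add: set_borel_measurable_def)

text \<open>Bounds uniform for \<open>w\<close> and \<open>s\<close> of norm at most
  \<open>R\<close>: here \<open>4 * exp 1\<close> is the maximum allowed for
  \<open>log_theta\<close> by \<open>log_theta_bound\<close>, and \<open>2 * R\<close> bounds the
  real parts of both s and w - s.\<close>

lemma ZQ_factor_bounds:
  assumes u: "u > 0" and R: "norm w \<le> R" "norm s \<le> R"
  shows "norm (expm1_quot (w * of_real (log_theta u))) \<le> exp (R * (4 * exp 1))"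
    and "norm (expm1_quot' (w * of_real (log_theta u))) \<le> exp (R * (4 * exp 1))"
    and "norm (exp (s * of_real u)) \<le> exp (2 * R * u)"
    and "norm (exp ((w - s) * of_real u)) \<le> exp (2 * R * u)"
proof -
  have R0: "R \<ge> 0" using R(1) norm_ge_zero order_trans by blast
  have "norm (w * of_real (log_theta u)) \<le> R * (4 * exp 1)"
    using log_theta_bound[of u] log_theta_pos[of u] u R0 R(1)
    by (auto simp: norm_mult intro!: mult_mono)
  then show "norm (expm1_quot (w * of_real (log_theta u))) \<le> exp (R * (4 * exp 1))"
    and "norm (expm1_quot' (w * of_real (log_theta u))) \<le> exp (R * (4 * exp 1))"
    using norm_expm1_quot_le norm_expm1_quot'_le exp_le_cancel_iff order_trans by blast+
  have "Re s \<le> 2 * R" using complex_Re_le_cmod[of s] R R0 by linarith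
  then show "norm (exp (s * of_real u)) \<le> exp (2 * R * u)"
    using u by (simp add: mult_right_mono)
  have "Re (w - s) \<le> 2 * R"
    using complex_Re_le_cmod[of "w - s"] norm_triangle_ineq4[of w s] R by linarith
  then show "norm (exp ((w - s) * of_real u)) \<le> exp (2 * R * u)"
    using u by (simp add: mult_right_mono)
qed

lemma norm_ZQ_kernel_le:
  assumes u: "u > 0" and R: "norm w \<le> R" "norm s \<le> R"
  shows "norm (ZQ_kernel w s u) \<le> exp (R * (4 * exp 1)) * 2 * (log_theta u * exp (2 * R * u))"
proof -
  note b = ZQ_factor_bounds[OF u R]
  have "norm (exp (s * of_real u) + exp ((w - s) * of_real u)) \<le> 2 * exp (2 * R * u)"
    by (rule norm_triangle_le) (use b(3,4) in linarith)
  then have "norm (ZQ_kernel w s u) \<le> log_theta u * exp (R * (4 * exp 1)) * (2 * exp (2 * R * u))"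
    unfolding ZQ_kernel_def norm_mult using log_theta_pos[of u] b(1)
    by (intro mult_mono) (auto intro!: mult_nonneg_nonneg)
  then show ?thesis by (simp add: mult_ac)
qed

lemma set_integrable_ZQ_kernel: "set_integrable lborel {0<..} (ZQ_kernel w s)"
proof (rule set_integrable_log_theta_bound)
  define R where "R = max (norm w) (norm s)"
  show "0 \<le> 2 * R" by (simp add: R_def le_max_iff_disj)
  show "norm (ZQ_kernel w s u) \<le> exp (R * (4 * exp 1)) * 2 * (log_theta u * exp (2 * R * u))" if "u > 0" for u
    using norm_ZQ_kernel_le[OF that, of w R s] by (simp add: R_def)
qed simp

lemma holomorphic2_ZQ_entire: "holomorphic2_on (\<lambda>p. ZQ_entire (fst p) (snd p)) UNIV"
proof -
  define L where "L = (\<lambda>u. complex_of_real (log_theta u))"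
  have Lm: "L \<in> borel_measurable borel" unfolding L_def by measurable
  define e1 where "e1 = (\<lambda>(p::complex \<times> complex) u. exp (snd p * complex_of_real u))"
  define e2 where "e2 = (\<lambda>(p::complex \<times> complex) u. exp ((fst p - snd p) * complex_of_real u))"
  have em: "e1 p \<in> borel_measurable borel" "e2 p \<in> borel_measurable borel" for p
    unfolding e1_def e2_def by measurable
  \<comment> \<open>\<open>A\<close> and \<open>B\<close> are the partial derivatives of the kernel
    in \<open>w\<close> and in \<open>s\<close>, set to 0 off the half line.\<close>
  define A where "A = (\<lambda>(p::complex \<times> complex) u. indicator {0<..} u *\<^sub>R
     (L u * (L u * expm1_quot' (fst p * L u) * (e1 p u + e2 p u)
      + expm1_quot (fst p * L u) * (of_real u * e2 p u))))"
  define B where "B = (\<lambda>(p::complex \<times> complex) u. indicator {0<..} u *\<^sub>R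
     (L u * expm1_quot (fst p * L u) * (of_real u * (e1 p u - e2 p u))))"
  define F where "F = (\<lambda>(p::complex \<times> complex) u. indicator {0<..} u *\<^sub>R ZQ_kernel (fst p) (snd p) u)"
  have "holomorphic2_on (\<lambda>p. LINT u|lborel. F p u) UNIV"
  proof (rule holomorphic2_on_integral[where A = A and B = B])
    fix p :: "complex \<times> complex" and u :: real
    have e: "((\<lambda>p. expm1_quot (fst p * L u)) has_derivative (\<lambda>h. expm1_quot' (fst p * L u) * (fst h * L u))) (at p)"
    proof -
      have "((\<lambda>p. fst p * L u) has_derivative (\<lambda>h. fst h * L u)) (at p)"
        by (auto intro!: derivative_eq_intros)
      from has_derivative_compose[OF this has_field_derivative_expm1_quot[of "fst p * L u", unfolded has_field_derivative_def]]
      show ?thesis by simp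
    qed
    show "((\<lambda>p. F p u) has_derivative (\<lambda>h. A p u * fst h + B p u * snd h)) (at p)"
    proof (cases "u > 0")
      case True
      have d1: "((\<lambda>p. e1 p u) has_derivative (\<lambda>h. e1 p u * (snd h * of_real u))) (at p)"
      proof -
        have "((\<lambda>p. snd p * of_real u) has_derivative (\<lambda>h. snd h * of_real u)) (at p)"
          by (auto intro!: derivative_eq_intros)
        from has_derivative_compose[OF this DERIV_exp[of "snd p * of_real u", unfolded has_field_derivative_def]]
        show ?thesis by (simp add: e1_def)
      qed
      have d2: "((\<lambda>p. e2 p u) has_derivative
          (\<lambda>h. e2 p u * ((fst h - snd h) * of_real u))) (at p)"
      proof -
        have "((\<lambda>p. (fst p - snd p) * of_real u) has_derivative (\<lambda>h. (fst h - snd h) * of_real u)) (at p)"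
          by (auto intro!: derivative_eq_intros)
        from has_derivative_compose[OF this DERIV_exp[of "(fst p - snd p) * of_real u", unfolded has_field_derivative_def]]
        show ?thesis by (simp add: e2_def)
      qed
      have "((\<lambda>p. L u * expm1_quot (fst p * L u) * (e1 p u + e2 p u))
          has_derivative (\<lambda>h. A p u * fst h + B p u * snd h)) (at p)"
        by (rule has_derivative_eq_rhs[OF has_derivative_mult[OF has_derivative_mult[OF has_derivative_const e]
              has_derivative_add[OF d1 d2]]])
           (use True in \<open>simp add: A_def B_def algebra_simps\<close>)
      then show ?thesis using True by (simp add: F_def ZQ_kernel_def L_def e1_def e2_def)
    qed (simp add: F_def A_def B_def)
  next
    show "integrable lborel (F p)" for p
      using set_integrable_ZQ_kernel unfolding F_def set_integrable_def .
    show "A p \<in> borel_measurable lborel" for p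
      unfolding A_def using Lm em by measurable
    show "B p \<in> borel_measurable lborel" for p
      unfolding B_def using Lm em by measurable
  next
    fix R :: real assume R0: "R > 0"
    define c where "c = 4 * exp (1::real)"
    define E where "E = exp (R * c)"
    \<comment> \<open>One factor \<open>log_theta\<close> is kept for the decay, and a second one,
      from differentiating in \<open>w\<close>, is bounded by \<open>c\<close>. The factor
      \<open>u\<close> raises the rate from 2R to 2R + 1, and the decay lemma adds another 1. The
      derivatives need the coefficients (2c + 1) E and 2 E, and 2c + 2 covers both.\<close>
    define g where "g = (\<lambda>u. indicator {0<..} u *\<^sub>R ((2 * c + 2) * E * (4 * exp ((2 * R + 1 + 1)\<^sup>2)) * exp (- u)))"
    have c0: "c > 0" by (simp add: c_def)
    have E0: "E > 0" by (simp add: E_def)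
    have "norm (A p u) \<le> g u \<and> norm (B p u) \<le> g u" if p: "norm p \<le> R" for p u
    proof (cases "u > 0")
      case u: True
      have R: "norm (fst p) \<le> R" "norm (snd p) \<le> R"
        using p norm_fst_le[of "fst p" "snd p"] norm_snd_le[of "snd p" "fst p"] by auto
      note b = ZQ_factor_bounds[OF u R, folded c_def, folded E_def, folded L_def[THEN fun_cong] e1_def[THEN fun_cong, THEN fun_cong] e2_def[THEN fun_cong, THEN fun_cong]]
      have Lu: "norm (L u) = log_theta u" using log_theta_pos[of u] by (simp add: L_def)
      have Lc: "log_theta u \<le> c" using log_theta_bound[of u] u by (simp add: c_def)
      have ux: "u * exp (2 * R * u) \<le> exp ((2 * R + 1) * u)"
      proof -
        have "u \<le> exp u" using exp_ge_add_one_self[of u] by linarith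
        then have "u * exp (2 * R * u) \<le> exp u * exp (2 * R * u)" by (intro mult_right_mono) auto
        then show ?thesis by (simp add: algebra_simps flip: exp_add)
      qed
      have x1: "exp (2 * R * u) \<le> exp ((2 * R + 1) * u)" using u by (simp add: algebra_simps)
      have s: "norm (e1 p u + e2 p u) \<le> 2 * exp ((2 * R + 1) * u)"
        by (rule norm_triangle_le) (use b(3,4) x1 in linarith)
      have d: "norm (of_real u * (e1 p u - e2 p u)) \<le> 2 * exp ((2 * R + 1) * u)"
      proof -
        have "norm (e1 p u - e2 p u) \<le> 2 * exp (2 * R * u)"
          by (rule norm_triangle_le_diff) (use b(3,4) in linarith)
        then have "u * norm (e1 p u - e2 p u) \<le> u * (2 * exp (2 * R * u))"
          by (rule mult_left_mono) (use u in simp)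
        also have "\<dots> = 2 * (u * exp (2 * R * u))" by simp
        also have "\<dots> \<le> 2 * exp ((2 * R + 1) * u)" using ux by simp
        finally have "u * norm (e1 p u - e2 p u) \<le> 2 * exp ((2 * R + 1) * u)" .
        moreover have "norm (complex_of_real u) = u" using u by simp
        ultimately show ?thesis unfolding norm_mult by (simp only:)
      qed
      have d2: "norm (of_real u * e2 p u) \<le> exp ((2 * R + 1) * u)"
      proof -
        have "norm (of_real u * e2 p u) = u * norm (e2 p u)"
          using u unfolding norm_mult by simp
        also have "\<dots> \<le> u * exp (2 * R * u)"
          by (rule mult_left_mono[OF b(4)]) (use u in simp)
        finally show ?thesis using ux by linarith
      qed
      have dec: "C * (log_theta u * exp ((2 * R + 1) * u)) \<le> g u" if "0 \<le> C" "C \<le> (2 * c + 2) * E" for C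
      proof -
        have "C * (log_theta u * exp ((2 * R + 1) * u)) \<le> (2 * c + 2) * E * (4 * exp ((2 * R + 1 + 1)\<^sup>2) * exp (- u))"
          using that u R0 log_theta_pos[of u] c0 E0
          by (intro mult_mono log_theta_decay) auto
        then show ?thesis using u by (simp add: g_def mult.assoc)
      qed
      have "norm (A p u) \<le> norm (L u) * (norm (L u) * norm (expm1_quot' (fst p * L u)) * norm (e1 p u + e2 p u)
      + norm (expm1_quot (fst p * L u)) * norm (of_real u * e2 p u))"
        using u unfolding A_def by (simp add: norm_mult) (intro mult_left_mono norm_triangle_le; simp add: norm_mult)
      also have "\<dots> \<le> log_theta u * (c * E * (2 * exp ((2 * R + 1) * u)) + E * exp ((2 * R + 1) * u))"
        unfolding Lu using log_theta_pos[of u] c0 E0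
        by (intro mult_left_mono add_mono mult_mono Lc b s d2) (auto intro!: mult_nonneg_nonneg)
      also have "\<dots> = ((2 * c + 1) * E) * (log_theta u * exp ((2 * R + 1) * u))"
        by (simp add: algebra_simps)
      also have "\<dots> \<le> g u" using c0 E0 by (intro dec) (auto intro!: mult_right_mono)
      finally have 1: "norm (A p u) \<le> g u" .
      have "norm (B p u) = norm (L u) * norm (expm1_quot (fst p * L u)) * norm (of_real u * (e1 p u - e2 p u))"
        using u unfolding B_def by (simp add: norm_mult)
      also have "\<dots> \<le> log_theta u * E * (2 * exp ((2 * R + 1) * u))"
        unfolding Lu using log_theta_pos[of u] E0 by (intro mult_mono b d) (auto intro!: mult_nonneg_nonneg)
      also have "\<dots> = (2 * E) * (log_theta u * exp ((2 * R + 1) * u))"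
        by (simp add: algebra_simps)
      also have "\<dots> \<le> g u" using c0 E0 by (intro dec) (auto intro!: mult_right_mono)
      finally show ?thesis using 1 by blast
    qed (simp add: A_def B_def g_def)
    moreover have "integrable lborel g"
      using set_integrable_exp_neg unfolding g_def set_integrable_def .
    ultimately show "\<exists>g. integrable lborel g \<and> (\<forall>p u. norm p \<le> R \<longrightarrow> u \<in> space lborel \<longrightarrow> norm (A p u) \<le> g u \<and> norm (B p u) \<le> g u)"
      by blast
  qed
  then show ?thesis by (simp add: ZQ_entire_def set_lebesgue_integral_def F_def)
qed

text \<open>The common folding step. With \<open>c = w\<close> it evaluates the two-variable
  integral, and at w = 1 the Mellin transform of theta - 1.\<close>

lemma ZQ_full_line:
  fixes h :: "real \<Rightarrow> complex"
  assumes a: "Re a > 0" and b: "Re b > 0"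
    and 1: "\<And>u. u > 0 \<Longrightarrow> h u + h (- u) = c * ZQ_kernel w s u + \<alpha> * exp (- a * of_real u) + \<beta> * exp (- b * of_real u)"
    and int: "set_integrable lborel {0<..} h" "set_integrable lborel {0<..} (\<lambda>u. h (- u))"
  shows "integrable lborel h" "(LINT u|lborel. h u) = c * ZQ_entire w s + \<alpha> / a + \<beta> / b"
proof -
  show "integrable lborel h" using half_line_split[OF int] by blast
  have "(LINT u|lborel. h u) = (LINT u:{0<..}|lborel. h u + h (- u))"
    using half_line_split[OF int] by blast
  also have "\<dots> = (LINT u:{0<..}|lborel. c * ZQ_kernel w s u + \<alpha> * exp (- a * of_real u) + \<beta> * exp (- b * of_real u))"
    using 1 by (intro set_lebesgue_integral_cong) auto
  also have "\<dots> = c * ZQ_entire w s + \<alpha> / a + \<beta> / b"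
    using set_integrable_ZQ_kernel[of w s] exp_integral_half_line[OF a] exp_integral_half_line[OF b]
    by (simp add: set_integral_add set_integrable_mult_right ZQ_entire_def del: mult_minus_left)
  finally show "(LINT u|lborel. h u) = c * ZQ_entire w s + \<alpha> / a + \<beta> / b" .
qed

text \<open>Split exp (w L) into 1 and a multiple of \<open>L\<close>: the first part is integrable
  by the sign of Re a, the second by the decay of \<open>L\<close>.\<close>

lemma set_integrable_ZQ_half:
  assumes a: "Re a < 0"
  shows "set_integrable lborel {0<..} (\<lambda>u. exp (w * of_real (log_theta u)) * exp (a * of_real u))"
proof -
  define R where "R = max (norm w) (norm a)"
  define f where "f u = w * (of_real (log_theta u) * expm1_quot (w * of_real (log_theta u))) * exp (a * of_real u)" for u
  have 1: "set_integrable lborel {0<..} (\<lambda>u. exp (- (- a) * of_real u))"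
    by (rule exp_integral_half_line) (use a in simp)
  have [measurable]: "f \<in> borel_measurable borel" unfolding f_def by measurable
  have 2: "set_integrable lborel {0<..} f"
  proof (rule set_integrable_log_theta_bound)
    show "0 \<le> 2 * R" by (simp add: R_def le_max_iff_disj)
    show "norm (f u) \<le> norm w * exp (R * (4 * exp 1)) * (log_theta u * exp (2 * R * u))" if u: "u > 0" for u
    proof -
      have "norm (f u) \<le> norm w * (log_theta u * exp (R * (4 * exp 1))) * exp (2 * R * u)"
        unfolding f_def norm_mult using ZQ_factor_bounds(1,3)[OF u, of w R a] log_theta_pos[of u]
        by (intro mult_mono) (auto simp: R_def intro!: mult_nonneg_nonneg)
      then show ?thesis by (simp add: mult_ac)
    qed
  qed simp
  have "exp (w * of_real (log_theta u)) * exp (a * of_real u) = f u + exp (- (- a) * of_real u)" for u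
  proof -
    have e: "exp (w * of_real (log_theta u)) = w * (of_real (log_theta u) * expm1_quot (w * of_real (log_theta u))) + 1"
      using expm1_quot_mult[of "w * of_real (log_theta u)"] by (simp add: mult.assoc)
    show ?thesis unfolding f_def e by (simp add: ring_distribs)
  qed
  then show ?thesis using 1 2 by (simp add: set_integral_add)
qed

lemma ZQ_integral_eq:
  assumes "(w, s) \<in> ZQ_cone"
  shows "ZQ_integral w s = w * ZQ_entire w s + w / (s * (s - w))"
proof -
  have ws: "Re w < Re s" "Re s < 0" using assms by (auto simp: ZQ_cone_def)
  define f where "f t = (if t > 0 then complex_of_real (riemann_theta (t\<^sup>2)) powr s *
     complex_of_real (riemann_theta (1 / t\<^sup>2)) powr (w - s) else 0)" for t :: real
  define h where "h u = exp (s * of_real (log_theta u)) * exp ((w - s) * of_real (log_theta (- u)))" for u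
  have pw: "complex_of_real (riemann_theta (exp (2 * u))) powr z = exp (z * of_real (log_theta u))" for u z
    unfolding exp_log_theta[symmetric] by (simp add: powr_def Ln_of_real)
  have feq: "f (exp u) = h u" for u
  proof -
    have "(exp u)\<^sup>2 = exp (2 * u)" by (simp add: exp_double)
    moreover have "1 / exp (2 * u) = exp (2 * (- u))" by (simp add: exp_minus divide_inverse)
    ultimately show ?thesis by (simp only: f_def h_def pw exp_gt_zero if_True)
  qed
  have [measurable]: "h \<in> borel_measurable borel" unfolding h_def by measurable
  have "f = (\<lambda>t. if t > 0 then h (ln t) else 0)"
    using feq by (auto simp: fun_eq_iff f_def) (metis exp_ln feq f_def)
  then have [measurable]: "f \<in> borel_measurable borel" by simp
  \<comment> \<open>By L(-u) = L(u) + u both halves contain the same factor exp (w L). The remaining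
    exponents w - s and s have negative real parts exactly on the cone.\<close>
  have hp: "h u = exp (w * of_real (log_theta u)) * exp ((w - s) * of_real u)" for u
    unfolding h_def log_theta_uminus by (simp add: algebra_simps flip: exp_add)
  have hm: "h (- u) = exp (w * of_real (log_theta u)) * exp (s * of_real u)" for u
    unfolding h_def log_theta_uminus minus_minus by (simp add: algebra_simps flip: exp_add)
  have i: "set_integrable lborel {0<..} h" "set_integrable lborel {0<..} (\<lambda>u. h (- u))"
  proof -
    have eq: "h = (\<lambda>u. exp (w * of_real (log_theta u)) * exp ((w - s) * of_real u))"
      by (rule ext, rule hp)
    show "set_integrable lborel {0<..} h"
      unfolding eq using ws by (intro set_integrable_ZQ_half) simp
    show "set_integrable lborel {0<..} (\<lambda>u. h (- u))"
      unfolding hm using ws by (intro set_integrable_ZQ_half)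
  qed
  \<comment> \<open>Splitting 1 off exp (w L) leaves two pure exponentials, whose integrals -1/s and
    1/(s - w) add up to w / (s (s - w)).\<close>
  have sum: "h u + h (- u) = w * ZQ_kernel w s u + 1 * exp (- (- s) * of_real u) + 1 * exp (- (s - w) * of_real u)" for u
    unfolding ZQ_kernel_mult hm unfolding hp by (simp add: algebra_simps)
  have "integrable lborel h" "(LINT u|lborel. h u) = w * ZQ_entire w s + 1 / (- s) + 1 / (s - w)"
    using ws by (intro ZQ_full_line[OF _ _ sum i]; simp)+
  moreover have "ZQ_integral w s = (LINT t:{0<..}|lborel. f t / of_real t)"
    unfolding ZQ_integral_def by (intro set_lebesgue_integral_cong) (auto simp: f_def)
  ultimately have "ZQ_integral w s = w * ZQ_entire w s + 1 / (- s) + 1 / (s - w)"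
    using exp_substitution(2)[of f] by (simp add: feq)
  moreover have "s \<noteq> 0" "s - w \<noteq> 0" using ws by auto
  ultimately show ?thesis by (simp add: field_simps)
qed

section \<open>Continuation of the Riemann zeta function\<close>

text \<open>Restriction to a holomorphic curve; it gives access to one-variable results such as the
  identity theorem along lines and slices.\<close>

lemma holomorphic2_on_compose:
  assumes f: "holomorphic2_on f D" and D: "open D" and S: "open S"
    and g: "g holomorphic_on S" and h: "h holomorphic_on S" and gh: "\<And>z. z \<in> S \<Longrightarrow> (g z, h z) \<in> D"
  shows "(\<lambda>z. f (g z, h z)) holomorphic_on S"
  unfolding holomorphic_on_open[OF S]
proof
  fix z assume z: "z \<in> S"
  obtain a b where "(f has_derivative (\<lambda>k. a * fst k + b * snd k)) (at (g z, h z) within D)"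
    using f gh[OF z] unfolding holomorphic2_on_def by blast
  then have fd: "(f has_derivative (\<lambda>k. a * fst k + b * snd k)) (at (g z, h z))"
    using at_within_open[OF gh[OF z] D] by simp
  obtain g' h' where d: "(g has_field_derivative g') (at z)" "(h has_field_derivative h') (at z)"
    using g h z unfolding holomorphic_on_open[OF S] by blast
  have "((\<lambda>z. (g z, h z)) has_derivative (\<lambda>k. (g' * k, h' * k))) (at z)"
    using d unfolding has_field_derivative_def by (intro has_derivative_Pair)
  from has_derivative_compose[OF this fd]
  have "((\<lambda>z. f (g z, h z)) has_field_derivative (a * g' + b * h')) (at z)"
    unfolding has_field_derivative_def
    by (rule has_derivative_eq_rhs) (auto simp: algebra_simps)
  then show "\<exists>f'. ((\<lambda>z. f (g z, h z)) has_field_derivative f') (at z)" by blast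
qed

lemma ZQ_entire_holomorphic:
  assumes "open S" "g holomorphic_on S" "h holomorphic_on S"
  shows "(\<lambda>z. ZQ_entire (g z) (h z)) holomorphic_on S"
  using holomorphic2_on_compose[OF holomorphic2_ZQ_entire open_UNIV assms] by simp

text \<open>The completed zeta function away from 0 and 1, in partial fractions so that the pole at
  0 can be cancelled separately by the reciprocal Gamma factor.\<close>

definition Lambda_fun :: "complex \<Rightarrow> complex" where
  "Lambda_fun s = ZQ_entire 1 s + 1 / (s - 1) - 1 / s"

lemma Lambda_fun_reflect: "Lambda_fun (1 - s) = Lambda_fun s"
proof -
  have "1 / (1 - s - 1) = - (1 / s)" "1 / (1 - s) = - (1 / (s - 1))"
    by simp (metis minus_diff_eq minus_divide_right)
  then show ?thesis
    using ZQ_entire_symmetric[of 1 s] by (simp add: Lambda_fun_def)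
qed

text \<open>The zero of 1 / Gamma(s/2) at 0 cancels the pole 1/s; the left side is the result
  without a division by \<open>s\<close>.\<close>

lemma rGamma_half_plus1: "s \<noteq> 0 \<Longrightarrow> rGamma (s / 2 + 1) / 2 = rGamma (s / 2) * (1 / s)" for s :: complex
  using rGamma_plus1[of "s / 2"] by (simp add: field_simps)

lemma Lambda_fun_holomorphic: "Lambda_fun holomorphic_on - {0, 1}"
  unfolding Lambda_fun_def[abs_def]
  by (intro holomorphic_intros ZQ_entire_holomorphic) auto

definition dirichlet_term :: "complex \<Rightarrow> nat \<Rightarrow> complex" where
  "dirichlet_term s n = exp (- s * of_real (ln (real n)))"

lemma dirichlet_term_eq: "dirichlet_term s (Suc n) = 1 / of_nat (Suc n) powr s"
proof -
  have "of_nat (Suc n) powr s = exp (s * of_real (ln (real (Suc n))))"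
    using Ln_of_real[of "real (Suc n)"] by (simp add: powr_def del: of_nat_Suc)
  then show ?thesis
    by (simp only: dirichlet_term_def mult_minus_left exp_minus divide_inverse mult_1)
qed

text \<open>The Mellin transform of theta - 1 is computed twice: term by term it is the Gamma factor
  times the Dirichlet series, and folded at u = 0 it is \<open>Lambda_fun s\<close>.\<close>

lemma Lambda_fun_Mellin:
  assumes s: "Re s > 1"
  shows "(\<lambda>n. 1 / of_nat (Suc n) powr s) sums (of_real pi powr (s / 2) * rGamma (s / 2) * Lambda_fun s)"
proof -
  define F where "F u = riemann_theta (exp (2 * u)) - 1" for u
  define h where "h u = of_real (F u) * exp (s * of_real u)" for u
  have F: "(\<lambda>n. 2 * exp (- (pi * (real (Suc n))\<^sup>2) * exp (2 * u))) sums F u" for u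
    unfolding F_def by (intro has_sum_imp_sums riemann_theta_has_sum) simp
  have term_powr: "(pi * (real (Suc n))\<^sup>2) powr (- (Re s / 2)) = pi powr (- (Re s / 2)) * real (Suc n) powr (- Re s)" for n
  proof -
    have "((real (Suc n))\<^sup>2) powr (- (Re s / 2)) = real (Suc n) powr (- Re s)"
      using powr_powr[of "real (Suc n)" 2 "- (Re s / 2)"] by (simp del: of_nat_Suc)
    then show ?thesis by (simp add: powr_mult del: of_nat_Suc)
  qed
  have "summable (\<lambda>n. real (Suc n) powr (- Re s))"
    unfolding summable_Suc_iff[of "\<lambda>n. real n powr (- Re s)"] summable_real_powr_iff using s by simp
  then have summ: "summable (\<lambda>n. 2 * (pi * (real (Suc n))\<^sup>2) powr (- (Re s / 2)))"
    unfolding term_powr by (intro summable_mult)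
  have 0: "Re s > 0" "\<And>n. 0 < pi * (real (Suc n))\<^sup>2" using s by auto
  have int: "integrable lborel h"
    and sums: "(\<lambda>n. of_real 2 * (of_real (pi * (real (Suc n))\<^sup>2) powr (- (s / 2)) * Gamma (s / 2) / 2)) sums (LINT u|lborel. h u)"
    unfolding h_def using Mellin_sum[OF 0(1) 0(2) _ F summ] by auto
  have Fp: "complex_of_real (F u) = exp (of_real (log_theta u)) - 1" for u
    unfolding F_def exp_log_theta[symmetric] by (simp add: exp_of_real)
  \<comment> \<open>The two extra exponentials come from exp (L(-u)) = exp (L) exp (u) and from the
    subtracted 1; they integrate to 1 / (s - 1) and -1/s.\<close>
  have e: "h u + h (- u) = 1 * ZQ_kernel 1 s u + 1 * exp (- (s - 1) * of_real u) + (- 1) * exp (- s * of_real u)" for u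
  proof -
    have "1 * ZQ_kernel 1 s u = (exp (of_real (log_theta u)) - 1) * (exp (s * of_real u) + exp ((1 - s) * of_real u))"
      using ZQ_kernel_mult[of 1 s u] by simp
    moreover have "h (- u) = (exp (of_real (log_theta u)) * exp (of_real u) - 1) * exp (- s * of_real u)"
      by (simp add: h_def Fp log_theta_uminus exp_add)
    moreover have "exp (of_real u) * exp (- s * of_real u) = exp ((1 - s) * of_real u)"
      by (simp add: algebra_simps flip: exp_add)
    moreover have "exp (- (s - 1) * of_real u) = exp ((1 - s) * of_real u)" by simp
    ultimately show ?thesis
      by (simp only: h_def Fp) (simp only: ring_distribs mult.assoc, simp)
  qed
  have "(LINT u|lborel. h u) = 1 * ZQ_entire 1 s + 1 / (s - 1) + (- 1) / s"
    by (rule ZQ_full_line(2)[OF _ _ e integrable_half_lines[OF int]]) (use s in auto)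
  then have L: "(LINT u|lborel. h u) = Lambda_fun s" by (simp add: Lambda_fun_def)
  have nz: "Gamma (s / 2) \<noteq> 0" using s by (intro Gamma_nonzero) (auto elim!: nonpos_Ints_cases simp: complex_eq_iff)
  have "of_real pi powr (s / 2) * rGamma (s / 2) * (of_real 2 * (of_real (pi * (real (Suc n))\<^sup>2) powr (- (s / 2)) * Gamma (s / 2) / 2))
     = 1 / of_nat (Suc n) powr s" for n
  proof -
    have "complex_of_real (pi * (real (Suc n))\<^sup>2) powr (- (s / 2)) = exp (- (s / 2) * of_real (ln pi + 2 * ln (real (Suc n))))"
      using pi_gt_zero by (simp add: powr_def Ln_of_real ln_mult ln_realpow del: of_nat_Suc of_real_mult)
    also have "\<dots> = exp (- (s / 2) * of_real (ln pi)) * exp (- (s * of_real (ln (real (Suc n)))))"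
      by (simp add: algebra_simps flip: exp_add)
    also have "exp (- (s / 2) * of_real (ln pi)) = 1 / of_real pi powr (s / 2)"
    proof -
      have "of_real pi powr (s / 2) = exp (s / 2 * of_real (ln pi))" by (simp add: powr_def Ln_of_real)
      then show ?thesis by (simp only: mult_minus_left exp_minus divide_inverse mult_1)
    qed
    also have "exp (- (s * of_real (ln (real (Suc n))))) = 1 / of_nat (Suc n) powr s"
      using dirichlet_term_eq[of s n] unfolding dirichlet_term_def mult_minus_left .
    finally show ?thesis using nz by (simp add: rGamma_inverse_Gamma)
  qed
  with sums_mult[OF sums, of "of_real pi powr (s / 2) * rGamma (s / 2)"] show ?thesis
    unfolding L by simp
qed

text \<open>The definite description is resolved by an explicit witness, unique by the identity
  theorem because the plane without 1 is connected. The third fact is the formula of the witness,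
  with \<open>rGamma (s / 2 + 1) / 2\<close> making it regular at 0.\<close>

lemma riemann_zeta_properties:
  shows "riemann_zeta holomorphic_on - {1}"
    and "Re s > 1 \<Longrightarrow> (\<lambda>n. 1 / of_nat (Suc n) powr s) sums riemann_zeta s"
    and "s \<noteq> 1 \<Longrightarrow> riemann_zeta s = of_real pi powr (s / 2) *
       (rGamma (s / 2) * (ZQ_entire 1 s + 1 / (s - 1)) - rGamma (s / 2 + 1) / 2)"
proof -
  define Z where "Z s = (if s = 1 then 0 else of_real pi powr (s / 2) *
       (rGamma (s / 2) * (ZQ_entire 1 s + 1 / (s - 1)) - rGamma (s / 2 + 1) / 2))" for s :: complex
  define P where "P f \<longleftrightarrow> f holomorphic_on - {1} \<and> f 1 = 0 \<and>
     (\<forall>s. Re s > 1 \<longrightarrow> (\<lambda>n. 1 / of_nat (Suc n) powr s) sums f s)" for f :: "complex \<Rightarrow> complex"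
  have "(\<lambda>s. of_real pi powr (s / 2) * (rGamma (s / 2) * (ZQ_entire 1 s + 1 / (s - 1)) - rGamma (s / 2 + 1) / 2))
      holomorphic_on - {1}"
    by (intro holomorphic_intros ZQ_entire_holomorphic) auto
  then have hol: "Z holomorphic_on - {1}"
    by (rule holomorphic_transform) (auto simp: Z_def)
  have PZ: "P Z"
    unfolding P_def
  proof (intro conjI hol allI impI)
    fix s :: complex assume s: "Re s > 1"
    then have s0: "s \<noteq> 0" "s \<noteq> 1" by auto
    have "Z s = of_real pi powr (s / 2) * rGamma (s / 2) * Lambda_fun s"
      unfolding Z_def Lambda_fun_def rGamma_half_plus1[OF s0(1)] right_diff_distrib[symmetric] using s0(2)
      by simp
    with Lambda_fun_Mellin[OF s] show "(\<lambda>n. 1 / of_nat (Suc n) powr s) sums Z s" by simp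
  qed (simp add: Z_def)
  have uniq: "f = Z" if f: "P f" for f
  proof
    fix z
    show "f z = Z z"
    proof (cases "z = 1")
      case False
      show ?thesis
      proof (rule analytic_continuation_open[where s = "{s. Re s > 1}" and s' = "- {1}" and f = f and g = Z])
        show "open {s. Re s > 1}" by (rule open_halfspace_Re_gt)
        have "2 \<in> {s. Re s > 1}" by simp
        then show "{s. Re s > 1} \<noteq> {}" by blast
        show "connected (- {1 :: complex})" by (rule connected_punctured_universe) simp
        show "f s = Z s" if "s \<in> {s. Re s > 1}" for s
          using f PZ that unfolding P_def by (auto dest: sums_unique2)
      qed (use f hol False in \<open>auto simp: P_def\<close>)
    qed (use f PZ in \<open>auto simp: P_def\<close>)
  qed
  have "(THE f. P f) = Z" by (rule the_equality[of P, OF PZ uniq])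
  then have eq: "riemann_zeta = Z" unfolding riemann_zeta_def P_def .
  show "riemann_zeta holomorphic_on - {1}" unfolding eq by (rule hol)
  show "Re s > 1 \<Longrightarrow> (\<lambda>n. 1 / of_nat (Suc n) powr s) sums riemann_zeta s"
    using PZ unfolding eq P_def by blast
  show "s \<noteq> 1 \<Longrightarrow> riemann_zeta s = of_real pi powr (s / 2) *
       (rGamma (s / 2) * (ZQ_entire 1 s + 1 / (s - 1)) - rGamma (s / 2 + 1) / 2)"
    by (simp add: eq Z_def)
qed

lemma riemann_zeta_eq_Lambda_fun:
  assumes "s \<noteq> 0" "s \<noteq> 1"
  shows "riemann_zeta s = of_real pi powr (s / 2) * rGamma (s / 2) * Lambda_fun s"
  unfolding riemann_zeta_properties(3)[OF assms(2)] Lambda_fun_def rGamma_half_plus1[OF assms(1)]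
    right_diff_distrib[symmetric] by simp

text \<open>The poles of Gamma(z/2) are the zeros of an entire function that does not vanish
  identically, hence isolated; this includes the case that \<open>s\<close> itself is such a
  point.\<close>

lemma eventually_half_notin_nonpos_Ints: "eventually (\<lambda>z::complex. z / 2 \<notin> \<int>\<^sub>\<le>\<^sub>0) (at s)"
proof -
  have "\<forall>\<^sub>F z in at s. rGamma (z / 2) \<noteq> 0 \<and> z \<in> UNIV"
  proof (rule non_zero_neighbour_alt)
    show "(\<lambda>z::complex. rGamma (z / 2)) holomorphic_on UNIV" by (intro holomorphic_intros) auto
    show "rGamma (2 / 2 :: complex) \<noteq> 0" by simp
  qed auto
  then show ?thesis by eventually_elim (simp add: rGamma_eq_zero_iff)
qed

text \<open>Near \<open>s\<close> the defining product agrees with \<open>Lambda_fun\<close> outside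
  the poles of the Gamma factor, and \<open>Lambda_fun\<close> is continuous at \<open>s\<close>;
  thus \<open>remove_sings\<close> returns its value, also at -2, -4 and so on.\<close>

lemma completed_zeta_eq:
  assumes s: "s \<noteq> 0" "s \<noteq> 1"
  shows "completed_zeta s = Lambda_fun s"
  unfolding completed_zeta_def
proof (rule remove_sings_eqI)
  have "Lambda_fun \<midarrow>s\<rightarrow> Lambda_fun s"
    using Lambda_fun_holomorphic s holomorphic_on_imp_continuous_on[OF Lambda_fun_holomorphic]
    by (auto simp: continuous_on_eq_continuous_at open_Compl isCont_def)
  moreover have "eventually (\<lambda>z. z \<noteq> 0 \<and> z \<noteq> 1 \<and> z / 2 \<notin> \<int>\<^sub>\<le>\<^sub>0) (at s)"
    using s by (intro eventually_conj eventually_half_notin_nonpos_Ints eventually_neq_at_within)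
  then have "eventually (\<lambda>z. Lambda_fun z = of_real pi powr (- z / 2) * Gamma (z / 2) * riemann_zeta z) (at s)"
  proof eventually_elim
    case (elim z)
    have "of_real pi powr (- z / 2) * of_real pi powr (z / 2) = (1 :: complex)"
      by (simp flip: powr_add)
    moreover have "Gamma (z / 2) * rGamma (z / 2) = 1"
      using elim by (simp add: rGamma_inverse_Gamma Gamma_eq_zero_iff)
    ultimately show ?case using elim
      by (simp add: riemann_zeta_eq_Lambda_fun) (simp add: mult.assoc[symmetric] mult.left_commute mult.commute)
  qed
  ultimately show "(\<lambda>s. of_real pi powr (- s / 2) * Gamma (s / 2) * riemann_zeta s) \<midarrow>s\<rightarrow> Lambda_fun s"
    by (rule Lim_transform_eventually)
qed

section \<open>Non-vanishing of zeta on the line with real part one\<close>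

lemma dirichlet_term_1 [simp]: "dirichlet_term s (Suc 0) = 1"
  by (simp add: dirichlet_term_def)

lemma dirichlet_term_mult:
  "m > 0 \<Longrightarrow> n > 0 \<Longrightarrow> dirichlet_term s (m * n) = dirichlet_term s m * dirichlet_term s n"
  by (simp add: dirichlet_term_def ln_mult algebra_simps flip: exp_add)

lemma norm_dirichlet_term: "n > 0 \<Longrightarrow> norm (dirichlet_term s n) = real n powr (- Re s)"
  by (simp add: dirichlet_term_def powr_def)

lemma summable_dirichlet_term:
  assumes "Re s > 1"
  shows "summable (\<lambda>n. norm (dirichlet_term s (Suc n)))"
proof -
  have "summable (\<lambda>n. real (Suc n) powr (- Re s))"
    unfolding summable_Suc_iff[of "\<lambda>n. real n powr (- Re s)"] summable_real_powr_iff using assms by simp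
  then show ?thesis by (simp add: norm_dirichlet_term del: of_nat_Suc)
qed

lemma dirichlet_term_has_sum:
  assumes "Re s > 1"
  shows "(dirichlet_term s has_sum riemann_zeta s) {0<..}"
proof -
  have "(\<lambda>n. dirichlet_term s (Suc n)) sums riemann_zeta s"
    unfolding dirichlet_term_eq by (rule riemann_zeta_properties(2)[OF assms])
  with summable_dirichlet_term[OF assms]
  have "((\<lambda>n. dirichlet_term s (Suc n)) has_sum riemann_zeta s) UNIV"
    by (rule norm_summable_imp_has_sum)
  then have "((dirichlet_term s \<circ> Suc) has_sum riemann_zeta s) UNIV" by (simp add: o_def)
  then have "(dirichlet_term s has_sum riemann_zeta s) (range Suc)"
    by (subst has_sum_reindex) auto
  moreover have "range Suc = {0<..}" by (auto simp: image_iff gr0_conv_Suc)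
  ultimately show ?thesis by simp
qed

text \<open>The sieve of Eratosthenes: among the numbers free of primes from \<open>P\<close>, the
  multiples of a new prime p are p times such numbers, so removing them multiplies the sum by 1 -
  p^(-s).\<close>

lemma sieve_has_sum:
  assumes s: "Re s > 1" and P: "finite P" "\<And>p. p \<in> P \<Longrightarrow> prime p"
  shows "(dirichlet_term s has_sum (riemann_zeta s * (\<Prod>p\<in>P. 1 - dirichlet_term s p)))
           {n. n > 0 \<and> (\<forall>p\<in>P. \<not> p dvd n)}"
  using P
proof (induction P rule: finite_induct)
  case empty
  then show ?case using dirichlet_term_has_sum[OF s] by (simp add: greaterThan_def)
next
  case (insert p P)
  define A where "A = {n. n > 0 \<and> (\<forall>p\<in>P. \<not> p dvd n)}"
  define S where "S = riemann_zeta s * (\<Prod>p\<in>P. 1 - dirichlet_term s p)"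
  have A: "(dirichlet_term s has_sum S) A"
    using insert unfolding A_def S_def by simp
  have p: "prime p" "p > 0" using insert.prems by (auto intro: prime_gt_0_nat)
  have "((\<lambda>m. dirichlet_term s p * dirichlet_term s m) has_sum (dirichlet_term s p * S)) A"
    by (rule has_sum_cmult_right[OF A])
  also have "?this \<longleftrightarrow> ((dirichlet_term s \<circ> (*) p) has_sum (dirichlet_term s p * S)) A"
    by (rule has_sum_cong) (use p in \<open>auto simp: A_def dirichlet_term_mult\<close>)
  finally have B: "(dirichlet_term s has_sum (dirichlet_term s p * S)) ((*) p ` A)"
    by (subst has_sum_reindex) (use p in \<open>auto simp: inj_on_def\<close>)
  have im: "(*) p ` A = {n \<in> A. p dvd n}"
  proof
    show "(*) p ` A \<subseteq> {n \<in> A. p dvd n}"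
    proof
      fix n assume "n \<in> (*) p ` A"
      then obtain m where m: "m \<in> A" "n = p * m" by blast
      have "\<not> q dvd n" if q: "q \<in> P" for q
      proof
        assume "q dvd n"
        moreover have "prime q" using insert.prems q by simp
        ultimately have "q dvd p \<or> q dvd m" using m by (simp add: prime_dvd_mult_iff)
        moreover have "\<not> q dvd m" using m q by (simp add: A_def)
        ultimately have "q = p" using primes_dvd_imp_eq[OF \<open>prime q\<close> p(1)] by blast
        with q insert.hyps show False by blast
      qed
      then show "n \<in> {n \<in> A. p dvd n}" using m p by (auto simp: A_def)
    qed
    show "{n \<in> A. p dvd n} \<subseteq> (*) p ` A"
    proof
      fix n assume n: "n \<in> {n \<in> A. p dvd n}"
      then obtain m where m: "n = p * m" by blast
      then have "m \<in> A" using n by (auto simp: A_def)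
      with m show "n \<in> (*) p ` A" by blast
    qed
  qed
  have "(dirichlet_term s has_sum (S - dirichlet_term s p * S)) (A - {n \<in> A. p dvd n})"
    by (rule has_sum_Diff[OF A B[unfolded im]]) auto
  moreover have "A - {n \<in> A. p dvd n} = {n. n > 0 \<and> (\<forall>q\<in>insert p P. \<not> q dvd n)}"
    by (auto simp: A_def)
  moreover have "S - dirichlet_term s p * S = riemann_zeta s * (\<Prod>p\<in>insert p P. 1 - dirichlet_term s p)"
    using insert.hyps by (simp add: S_def algebra_simps)
  ultimately show ?case by simp
qed

text \<open>The Euler product with all factors on one side, so no reciprocals occur. After sieving
  by the primes up to N, only 1 and numbers above N remain, and the latter vanish in the limit by
  dominated convergence.\<close>

lemma zeta_euler_product:
  assumes s: "Re s > 1"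
  shows "(\<lambda>N. riemann_zeta s * (\<Prod>p\<in>{p. prime p \<and> p \<le> N}. 1 - dirichlet_term s p)) \<longlonglongrightarrow> 1"
proof -
  define P where "P N = {p::nat. prime p \<and> p \<le> N}" for N
  define A where "A N = {n. n > 0 \<and> (\<forall>p\<in>P N. \<not> p dvd n)}" for N
  define f where "f N n = (if n \<in> A N then dirichlet_term s n else 0)" for N n
  have P: "finite (P N)" "\<And>p. p \<in> P N \<Longrightarrow> prime p" for N
    using finite_subset[of "P N" "{..N}"] by (auto simp: P_def)
  have "(dirichlet_term s has_sum (riemann_zeta s * (\<Prod>p\<in>P N. 1 - dirichlet_term s p))) (A N)" for N
    unfolding A_def by (rule sieve_has_sum[OF s P])
  then have "infsum (dirichlet_term s) (A N) = riemann_zeta s * (\<Prod>p\<in>P N. 1 - dirichlet_term s p)" for N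
    by (rule infsumI)
  moreover have "infsum (dirichlet_term s) (A N) = infsum (f N) UNIV" for N
    by (rule infsum_cong_neutral) (auto simp: f_def)
  ultimately have eq: "riemann_zeta s * (\<Prod>p\<in>P N. 1 - dirichlet_term s p) = infsum (f N) UNIV" for N
    by simp
  have M: "(\<lambda>n. if n > 0 then norm (dirichlet_term s n) else 0) summable_on UNIV"
  proof -
    have "(\<lambda>n. norm (dirichlet_term s (Suc n))) summable_on UNIV"
      using summable_dirichlet_term[OF s] by (rule summable_nonneg_imp_summable_on) auto
    then have "(\<lambda>n. norm (dirichlet_term s n)) summable_on (range Suc)"
      by (subst summable_on_reindex) (auto simp: o_def)
    also have "?this \<longleftrightarrow> ?thesis"
      by (rule summable_on_cong_neutral) (auto simp: image_iff gr0_conv_Suc)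
    finally show ?thesis .
  qed
  have "(\<lambda>N. infsum (f N) UNIV) \<longlonglongrightarrow> (\<Sum>\<^sub>\<infinity>n::nat. if n = 1 then 1 else (0 :: complex))"
  proof (rule infsum_dominated_convergence[OF _ _ M])
    fix n
    have "\<forall>\<^sub>F N in sequentially. f N n = (if n = 1 then 1 else 0)"
      using eventually_ge_at_top[of n]
    proof eventually_elim
      case (elim N)
      show ?case
      proof (cases "n > 1")
        case True
        then obtain p where "prime p" "p dvd n" using prime_factor_nat[of n] by auto
        moreover from this have "p \<le> N" using True elim dvd_imp_le[of p n] by simp
        ultimately show ?thesis using True by (auto simp: f_def A_def P_def)
      next
        case False
        then have "n = 0 \<or> n = 1" by auto
        then show ?thesis by (auto simp: f_def A_def P_def)
      qed
    qed
    then show "(\<lambda>N. f N n) \<longlonglongrightarrow> (if n = 1 then 1 else 0)"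
      by (rule tendsto_eventually)
    show "norm (f N n) \<le> (if n > 0 then norm (dirichlet_term s n) else 0)" for N
      by (auto simp: f_def A_def)
  qed
  also have "(\<Sum>\<^sub>\<infinity>n::nat. if n = 1 then 1 else (0 :: complex)) = (\<Sum>\<^sub>\<infinity>n\<in>{1::nat}. 1 :: complex)"
    by (rule infsum_cong_neutral) auto
  finally show ?thesis unfolding P_def[symmetric] eq by simp
qed

text \<open>The logarithm of the left side is minus the sum of r^n / n times 3 + 4 Re z^n + Re
  z^(2n). With c = Re z^n this bracket is 3 + 4 c + (2 c^2 - 1) = 2 (1 + c)^2, Mertens'
  inequality.\<close>

lemma norm_one_minus_341:
  fixes r :: real and z :: complex
  assumes r: "0 \<le> r" "r < 1" and z: "norm z = 1"
  shows "norm (1 - complex_of_real r) ^ 3 * norm (1 - r * z) ^ 4 * norm (1 - r * z\<^sup>2) \<le> 1"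
proof -
  have ln_sums: "(\<lambda>n. - Re (w ^ n) / n) sums ln (norm (1 - w))" if w: "norm w < 1" for w
  proof -
    have w1: "1 - w \<noteq> 0" using w by auto
    have "(\<lambda>n. - ((- (- w)) ^ n) / of_nat n) sums Ln (1 + - w)"
      by (rule Ln_series') (use w in simp)
    from sums_Re[OF this] show ?thesis using w1 by (simp add: Re_Ln)
  qed
  have rz: "norm (of_real r * y) < 1" if "norm y = 1" for y :: complex
    using that r by (simp add: norm_mult)
  define g where "g n = 3 * (- Re (of_real r ^ n) / n) + 4 * (- Re ((r * z) ^ n) / n) + - Re ((r * z\<^sup>2) ^ n) / n" for n :: nat
  have "g sums (3 * ln (norm (1 - complex_of_real r)) + 4 * ln (norm (1 - r * z)) + ln (norm (1 - r * z\<^sup>2)))"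
    unfolding g_def using rz[of 1] rz[OF z] rz[of "z\<^sup>2"] z
    by (intro sums_add sums_mult ln_sums) (auto simp: norm_power)
  moreover have "g n \<le> 0" for n
  proof -
    define c where "c = Re (z ^ n)"
    have "norm (z ^ n) = 1" using z by (simp add: norm_power)
    then have "c\<^sup>2 + (Im (z ^ n))\<^sup>2 = 1" unfolding c_def by (simp add: cmod_def)
    then have "Re ((z ^ n)\<^sup>2) = 2 * c\<^sup>2 - 1" by (simp add: c_def Re_power2)
    then have z2: "Re ((z\<^sup>2) ^ n) = 2 * c\<^sup>2 - 1" by (simp add: power_mult[symmetric] mult.commute)
    have Rr: "Re (of_real r ^ n * y) = r ^ n * Re y" for y by (simp flip: of_real_power)
    have "g n = - (r ^ n * (3 + 4 * c + (2 * c\<^sup>2 - 1)) / n)"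
      unfolding g_def power_mult_distrib Rr z2 using Rr[of 1]
      by (simp add: c_def add_divide_distrib diff_divide_distrib algebra_simps)
    also have "3 + 4 * c + (2 * c\<^sup>2 - 1) = 2 * (1 + c)\<^sup>2" by (simp add: power2_eq_square algebra_simps)
    finally show ?thesis using r by simp
  qed
  ultimately have ln_le: "3 * ln (norm (1 - complex_of_real r)) + 4 * ln (norm (1 - r * z)) + ln (norm (1 - r * z\<^sup>2)) \<le> 0"
    using sums_le[of g "\<lambda>_. 0" _ 0] by simp
  have pos: "norm (1 - of_real r * y) > 0" if "norm y = 1" for y :: complex
    using rz[OF that] by auto
  have p: "norm (1 - complex_of_real r) > 0" "norm (1 - r * z) > 0" "norm (1 - r * z\<^sup>2) > 0"
    using pos[of 1] pos[OF z] pos[of "z\<^sup>2"] z by (simp_all add: norm_power)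
  then have "ln (norm (1 - complex_of_real r) ^ 3 * norm (1 - r * z) ^ 4 * norm (1 - r * z\<^sup>2)) \<le> 0"
    using ln_le by (simp add: ln_mult ln_realpow)
  then show ?thesis using p by (subst (asm) ln_le_zero_iff) (auto intro!: mult_pos_pos)
qed

text \<open>Multiplying the inequality for single primes bounds the finite Euler factors by 1. Their
  product with the zeta values tends to 1, so the zeta values alone are at least 1.\<close>

lemma zeta_341:
  fixes \<sigma> t :: real
  assumes \<sigma>: "\<sigma> > 1"
  shows "norm (riemann_zeta \<sigma>) ^ 3 * norm (riemann_zeta (Complex \<sigma> t)) ^ 4 * norm (riemann_zeta (Complex \<sigma> (2 * t))) \<ge> 1"
proof -
  define P where "P f = norm (f (of_real \<sigma>)) ^ 3 * norm (f (Complex \<sigma> t)) ^ 4 * norm (f (Complex \<sigma> (2 * t)))"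
    for f :: "complex \<Rightarrow> complex"
  define E where "E N s = (\<Prod>p\<in>{p. prime p \<and> p \<le> N}. 1 - dirichlet_term s p)" for s and N :: nat
  have P0: "P f \<ge> 0" for f by (simp add: P_def)
  have P_mult: "P (\<lambda>s. f s * g s) = P f * P g" for f g
    by (simp add: P_def norm_mult power_mult_distrib mult_ac)
  have "(\<lambda>N. P (\<lambda>s. riemann_zeta s * E N s)) \<longlonglongrightarrow> norm (1::complex) ^ 3 * norm (1::complex) ^ 4 * norm (1::complex)"
    unfolding P_def E_def using \<sigma> by (intro tendsto_intros zeta_euler_product) auto
  moreover have "P (\<lambda>s. riemann_zeta s * E N s) \<le> P riemann_zeta" for N
  proof -
    have "P (E N) = (\<Prod>p\<in>{p. prime p \<and> p \<le> N}. P (\<lambda>s. 1 - dirichlet_term s p))"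
      by (simp add: P_def E_def prod_norm[symmetric] prod.distrib prod_power_distrib)
    also have "\<dots> \<le> 1"
    proof (rule prod_le_1)
      fix p :: nat assume "p \<in> {p. prime p \<and> p \<le> N}"
      then have p: "p > 1" using prime_gt_1_nat[of p] by simp
      define r where "r = exp (- \<sigma> * ln p)"
      define z where "z = exp (- \<i> * t * ln p)"
      have r: "0 \<le> r" "r < 1" using p \<sigma> by (auto simp: r_def)
      have z: "norm z = 1" by (simp add: z_def)
      have "dirichlet_term \<sigma> p = r" by (simp add: dirichlet_term_def r_def exp_of_real[symmetric])
      moreover have "dirichlet_term (Complex \<sigma> t) p = r * z"
        by (simp add: dirichlet_term_def r_def z_def exp_of_real[symmetric] Complex_eq algebra_simps flip: exp_add)
      moreover have "dirichlet_term (Complex \<sigma> (2 * t)) p = r * z\<^sup>2"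
        by (simp add: dirichlet_term_def r_def z_def exp_of_real[symmetric] Complex_eq algebra_simps flip: exp_add exp_double)
      ultimately have "P (\<lambda>s. 1 - dirichlet_term s p) \<le> 1"
        unfolding P_def using norm_one_minus_341[OF r z] by simp
      with P0 show "0 \<le> P (\<lambda>s. 1 - dirichlet_term s p) \<and> P (\<lambda>s. 1 - dirichlet_term s p) \<le> 1" by blast
    qed
    finally have "P riemann_zeta * P (E N) \<le> P riemann_zeta * 1"
      by (rule mult_left_mono) (rule P0)
    then show ?thesis unfolding P_mult by simp
  qed
  ultimately have "norm (1::complex) ^ 3 * norm (1::complex) ^ 4 * norm (1::complex) \<le> P riemann_zeta"
    by (intro LIMSEQ_le_const2) auto
  then show ?thesis by (simp add: P_def)
qed

text \<open>A zero at 1 + i t would enter with order at least four and the pole at 1 with order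
  three. As \<sigma> decreases to 1, a factor \<sigma> - 1 would be left over, forcing the product
  in \<open>zeta_341\<close> to 0.\<close>

theorem riemann_zeta_nonzero_Re_1:
  fixes t :: real
  assumes t: "t \<noteq> 0"
  shows "riemann_zeta (Complex 1 t) \<noteq> 0"
proof
  assume zero: "riemann_zeta (Complex 1 t) = 0"
  define \<sigma> where "\<sigma> n = 1 + 1 / real (Suc n)" for n
  have \<sigma>1: "\<sigma> n > 1" for n by (simp add: \<sigma>_def)
  have \<sigma>_lim: "\<sigma> \<longlonglongrightarrow> 1" unfolding \<sigma>_def by real_asymp
  have cont: "isCont riemann_zeta s" if "s \<noteq> 1" for s
    using holomorphic_on_imp_continuous_on[OF riemann_zeta_properties(1)] that
    by (auto simp: continuous_on_eq_continuous_at open_Compl)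
  have Clim: "(\<lambda>n. Complex (\<sigma> n) x) \<longlonglongrightarrow> Complex 1 x" for x
    by (intro tendsto_Complex \<sigma>_lim tendsto_const)
  \<comment> \<open>The product (s - 1) zeta(s), written so that it is visibly entire; its
    continuity at 1 expresses that the pole of zeta has order at most one.\<close>
  define H where "H s = of_real pi powr (s / 2) *
       (rGamma (s / 2) * ((s - 1) * ZQ_entire 1 s + 1) - (s - 1) * rGamma (s / 2 + 1) / 2)" for s :: complex
  have "H holomorphic_on UNIV"
    unfolding H_def by (intro holomorphic_intros ZQ_entire_holomorphic) auto
  then have "isCont H 1"
    using holomorphic_on_imp_continuous_on by (fastforce simp: continuous_on_eq_continuous_at)
  then have Hlim: "(\<lambda>n. H (of_real (\<sigma> n))) \<longlonglongrightarrow> H 1"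
    by (rule isCont_tendsto_compose) (use tendsto_of_real[OF \<sigma>_lim] in simp)
  have H_eq: "(s - 1) * riemann_zeta s = H s" if "s \<noteq> 1" for s
    using that unfolding riemann_zeta_properties(3)[OF that] H_def by (simp add: field_simps)
  have "Complex 1 t \<in> - {1}" using t by (auto simp: complex_eq_iff)
  then obtain d where "(riemann_zeta has_field_derivative d) (at (Complex 1 t))"
    using riemann_zeta_properties(1) unfolding holomorphic_on_open[OF open_Compl[OF closed_singleton]]
    by blast
  then have "(\<lambda>h. (riemann_zeta (Complex 1 t + h) - riemann_zeta (Complex 1 t)) / h) \<midarrow>0\<rightarrow> d"
    by (rule DERIV_D)
  then have "(\<lambda>n. (riemann_zeta (Complex 1 t + of_real (\<sigma> n - 1)) - riemann_zeta (Complex 1 t)) / of_real (\<sigma> n - 1)) \<longlonglongrightarrow> d"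
  proof (rule filterlim_compose)
    have "(\<lambda>n. complex_of_real (\<sigma> n - 1)) \<longlonglongrightarrow> of_real (1 - 1)"
      by (intro tendsto_intros \<sigma>_lim)
    then show "filterlim (\<lambda>n. complex_of_real (\<sigma> n - 1)) (at 0) sequentially"
      using \<sigma>1 by (auto simp: filterlim_at less_imp_neq[THEN not_sym] simp del: of_real_diff)
  qed
  moreover have "Complex 1 t + of_real (\<sigma> n - 1) = Complex (\<sigma> n) t" for n
    by (simp add: complex_eq_iff)
  ultimately have dlim: "(\<lambda>n. riemann_zeta (Complex (\<sigma> n) t) / of_real (\<sigma> n - 1)) \<longlonglongrightarrow> d"
    using zero by simp
  have "(\<lambda>n. norm (H (of_real (\<sigma> n))) ^ 3 * norm (riemann_zeta (Complex (\<sigma> n) t) / of_real (\<sigma> n - 1)) ^ 4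
        * norm (riemann_zeta (Complex (\<sigma> n) (2 * t))) * (\<sigma> n - 1))
      \<longlonglongrightarrow> norm (H 1) ^ 3 * norm d ^ 4 * norm (riemann_zeta (Complex 1 (2 * t))) * (1 - 1)"
    using t by (intro tendsto_intros Hlim dlim \<sigma>_lim isCont_tendsto_compose[OF cont Clim]) (auto simp: complex_eq_iff)
  moreover have "norm (H (of_real (\<sigma> n))) ^ 3 * norm (riemann_zeta (Complex (\<sigma> n) t) / of_real (\<sigma> n - 1)) ^ 4
        * norm (riemann_zeta (Complex (\<sigma> n) (2 * t))) * (\<sigma> n - 1) \<ge> 1" for n
  proof -
    define e where "e = \<sigma> n - 1"
    have e: "e > 0" using \<sigma>1 by (simp add: e_def)
    have "norm (H (of_real (\<sigma> n))) = e * norm (riemann_zeta (of_real (\<sigma> n)))"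
    proof -
      have "of_real (\<sigma> n) \<noteq> (1 :: complex)" using \<sigma>1[of n] by (metis less_irrefl of_real_eq_1_iff)
      from H_eq[OF this] have "norm (H (of_real (\<sigma> n))) = norm (of_real e * riemann_zeta (of_real (\<sigma> n)))"
        by (simp add: e_def)
      then show ?thesis using e by (simp add: norm_mult)
    qed
    note h1 = this
    have h2: "norm (riemann_zeta (Complex (\<sigma> n) t) / of_real e) = norm (riemann_zeta (Complex (\<sigma> n) t)) / e"
      using e by (simp add: norm_divide)
    have h3: "(e * a) ^ 3 * (b / e) ^ 4 * c * e = a ^ 3 * b ^ 4 * c" for a b c :: real
      using e by (simp add: power_mult_distrib power_divide eval_nat_numeral)
    show ?thesis
      unfolding e_def[symmetric] h1 h2 h3 by (rule zeta_341[OF \<sigma>1])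
  qed
  ultimately have "1 \<le> norm (H 1) ^ 3 * norm d ^ 4 * norm (riemann_zeta (Complex 1 (2 * t))) * (1 - 1)"
    by (intro LIMSEQ_le_const) auto
  then show False by simp
qed

section \<open>The Mellin transform of the logarithm of theta\<close>

text \<open>The logarithm of the product formula at q = exp (- pi exp (2u)). Since
  \<open>E a\<close> is minus the logarithm of phi(q^a), the numerator enters with the coefficient
  -5.\<close>

lemma log_theta_eq_euler_phi:
  defines "E \<equiv> \<lambda>a u. - ln (euler_phi (exp (- (pi * a * exp (2 * u)))))"
  shows "log_theta u = 2 * E 1 u + 2 * E 4 u - 5 * E 2 u"
proof -
  define q where "q = exp (- (pi * exp (2 * u)))"
  have q: "0 < q" "q < 1" by (simp_all add: q_def)
  have qp: "q ^ k = exp (- (pi * real k * exp (2 * u)))" for k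
    by (simp add: q_def mult_ac flip: exp_of_nat_mult)
  have q_eq: "exp (- (pi * exp (2 * u)) * (of_int n)\<^sup>2) = q powi (n\<^sup>2)" for n
    by (simp add: q_def exp_power_int mult.commute)
  have "riemann_theta (exp (2 * u)) = euler_phi (q\<^sup>2) ^ 5 / (euler_phi q ^ 2 * euler_phi (q ^ 4) ^ 2)"
    unfolding riemann_theta_eq q_eq by (rule jacobi_theta_product[OF q])
  moreover have "euler_phi x \<noteq> 0" for x by (simp add: euler_phi_def)
  ultimately have "log_theta u = 5 * ln (euler_phi (q\<^sup>2)) - (2 * ln (euler_phi q) + 2 * ln (euler_phi (q ^ 4)))"
    unfolding log_theta_def by (simp add: ln_div ln_mult ln_realpow)
  moreover have "q = exp (- (pi * 1 * exp (2 * u)))" by (simp add: q_def)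
  ultimately show ?thesis unfolding E_def qp by (simp add: q_def)
qed

lemma has_sum_product_nat:
  fixes f g :: "nat \<Rightarrow> complex"
  assumes f: "summable (\<lambda>n. norm (f n))" and g: "summable (\<lambda>n. norm (g n))"
  shows "((\<lambda>(n, k). f n * g k) has_sum (suminf f * suminf g)) UNIV"
    and "(\<lambda>(n, k). norm (f n) * norm (g k)) summable_on UNIV"
proof -
  have gs: "((\<lambda>k. norm (g k)) has_sum (\<Sum>k. norm (g k))) UNIV"
    using sums_nonneg_imp_has_sum[OF summable_sums[OF g]] by simp
  have fs: "((\<lambda>k. norm (f k)) has_sum (\<Sum>k. norm (f k))) UNIV"
    using sums_nonneg_imp_has_sum[OF summable_sums[OF f]] by simp
  have nn: "(\<lambda>p. norm (f (fst p)) * norm (g (snd p))) summable_on (UNIV \<times> UNIV)"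
  proof (rule summable_on_SigmaI)
    show "((\<lambda>k. norm (f (fst (n, k))) * norm (g (snd (n, k)))) has_sum (norm (f n) * (\<Sum>k. norm (g k)))) UNIV" for n
      using has_sum_cmult_right[OF gs] by simp
    show "(\<lambda>n. norm (f n) * (\<Sum>k. norm (g k))) summable_on UNIV"
      using has_sum_imp_summable[OF fs] by (rule summable_on_cmult_left)
  qed auto
  then show "(\<lambda>(n, k). norm (f n) * norm (g k)) summable_on UNIV" by (simp add: case_prod_unfold)
  have "(\<lambda>p. f (fst p) * g (snd p)) summable_on (UNIV \<times> UNIV)"
    by (rule abs_summable_summable) (use nn in \<open>simp add: norm_mult\<close>)
  then have "((\<lambda>p. f (fst p) * g (snd p)) has_sum (suminf f * suminf g)) (UNIV \<times> UNIV)"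
  proof (rule has_sum_SigmaI[rotated 2])
    show "((\<lambda>k. f (fst (n, k)) * g (snd (n, k))) has_sum (f n * suminf g)) UNIV" for n
      using has_sum_cmult_right[OF norm_summable_imp_has_sum[OF g summable_sums[OF summable_norm_cancel[OF g]]]] by simp
    show "((\<lambda>n. f n * suminf g) has_sum (suminf f * suminf g)) UNIV"
      using has_sum_cmult_left[OF norm_summable_imp_has_sum[OF f summable_sums[OF summable_norm_cancel[OF f]]]] by simp
  qed
  then show "((\<lambda>(n, k). f n * g k) has_sum (suminf f * suminf g)) UNIV" by (simp add: case_prod_unfold)
qed

text \<open>The double series has the terms exp (- pi a n k exp (2u)) / k. Their transforms contain
  (n k)^(-z) / k = n^(-z) k^(-(z + 1)) with z = s/2, hence the product of zeta(z) and zeta(z + 1).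
  Pairs are enumerated by \<open>prod_decode\<close> to fit the single series of
  \<open>Mellin_sum\<close>.\<close>

lemma Mellin_ln_euler_phi:
  fixes a :: real
  assumes a: "a > 0" and s: "Re s > 2"
  shows "has_bochner_integral lborel
     (\<lambda>u. of_real (- ln (euler_phi (exp (- (pi * a * exp (2 * u)))))) * exp (s * of_real u))
     (of_real (pi * a) powr (- (s / 2)) * Gamma (s / 2) / 2 * (riemann_zeta (s / 2) * riemann_zeta (s / 2 + 1)))"
proof -
  define z where "z = s / 2"
  have z: "Re z > 1" using s by (simp add: z_def)
  define c where "c i = 1 / real (Suc (snd (prod_decode i)))" for i
  define l where "l i = pi * a * (real (Suc (fst (prod_decode i))) * real (Suc (snd (prod_decode i))))" for i
  define F where "F u = - ln (euler_phi (exp (- (pi * a * exp (2 * u)))))" for u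
  have bij: "bij_betw prod_decode UNIV UNIV" by (simp add: bij_prod_decode)
  have l: "l i > 0" for i using a unfolding l_def by (intro mult_pos_pos) auto
  have c: "c i \<ge> 0" for i by (simp add: c_def)
  have F: "(\<lambda>i. c i * exp (- l i * exp (2 * u))) sums F u" for u
  proof -
    define q where "q = exp (- (pi * a * exp (2 * u)))"
    have q: "0 < q" "q < 1" using a by (simp_all add: q_def)
    have "((\<lambda>i. (\<lambda>(n, k). q ^ (Suc n * Suc k) / Suc k) (prod_decode i)) has_sum (- ln (euler_phi q))) UNIV"
      by (subst has_sum_reindex_bij_betw[OF bij]) (rule has_sum_ln_euler_phi[OF q])
    moreover have "(\<lambda>(n, k). q ^ (Suc n * Suc k) / Suc k) (prod_decode i) = c i * exp (- l i * exp (2 * u))" for i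
    proof -
      have "q ^ m = exp (- (pi * a * real m) * exp (2 * u))" for m
        by (simp add: q_def mult_ac flip: exp_of_nat_mult)
      then show ?thesis
        by (simp only: case_prod_unfold c_def l_def of_nat_mult) simp
    qed
    ultimately show ?thesis unfolding F_def q_def[symmetric] by (simp add: has_sum_imp_sums)
  qed
  have fz: "summable (\<lambda>n. norm (dirichlet_term w (Suc n)))" "suminf (\<lambda>n. dirichlet_term w (Suc n)) = riemann_zeta w"
    if "Re w > 1" for w
    using summable_dirichlet_term[OF that] sums_unique[OF riemann_zeta_properties(2)[OF that]]
    by (simp_all only: dirichlet_term_eq)
  have z1: "Re (z + 1) > 1" using z by simp
  define d where "d i = dirichlet_term z (Suc (fst (prod_decode i))) * dirichlet_term (z + 1) (Suc (snd (prod_decode i)))" for i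
  have prod_eq: "of_real (c i) * of_real (l i) powr (- z)
      = of_real (pi * a) powr (- z) * d i" for i
  proof -
    define n k where "n = real (Suc (fst (prod_decode i)))" and "k = real (Suc (snd (prod_decode i)))"
    have nk: "n > 0" "k > 0" by (simp_all add: n_def k_def)
    have "of_real (l i) powr (- z) = exp (- z * of_real (ln (pi * a) + ln n + ln k))"
      using nk a unfolding l_def n_def[symmetric] k_def[symmetric]
      by (simp add: powr_def Ln_of_real ln_mult add_ac del: of_real_mult of_real_add)
    also have "\<dots> = exp (- z * of_real (ln (pi * a))) * (exp (- z * of_real (ln n)) * exp (- z * of_real (ln k)))"
      by (simp add: algebra_simps flip: exp_add)
    also have "exp (- z * of_real (ln (pi * a))) = of_real (pi * a) powr (- z)"
      using a by (simp add: powr_def Ln_of_real del: of_real_mult)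
    finally have 1: "of_real (l i) powr (- z) = of_real (pi * a) powr (- z) * (exp (- z * of_real (ln n)) * exp (- z * of_real (ln k)))" .
    have "exp (- (z + 1) * of_real (ln k)) = exp (- z * of_real (ln k)) * exp (- of_real (ln k))"
      by (simp add: algebra_simps flip: exp_add)
    also have "exp (- complex_of_real (ln k)) = of_real (1 / k)"
      using nk by (simp add: exp_minus exp_of_real divide_inverse)
    finally have 2: "exp (- (z + 1) * of_real (ln k)) = exp (- z * of_real (ln k)) * of_real (c i)"
      by (simp only: c_def k_def)
    show ?thesis
      unfolding 1 d_def dirichlet_term_def n_def[symmetric] k_def[symmetric] 2 by (simp only: mult_ac)
  qed
  note sum_prod = has_sum_product_nat[OF fz(1)[OF z] fz(1)[OF z1], unfolded fz(2)[OF z] fz(2)[OF z1]]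
  have s0: "Re s > 0" using s by simp
  \<comment> \<open>Up to a constant these are the norms of the terms of the product series for
    zeta(z) zeta(z + 1), which converges absolutely for Re z > 1.\<close>
  have summ: "summable (\<lambda>i. c i * l i powr (- (Re s / 2)))"
  proof -
    have "(\<lambda>i. (\<lambda>(n, k). norm (dirichlet_term z (Suc n)) * norm (dirichlet_term (z + 1) (Suc k))) (prod_decode i)) summable_on UNIV"
      by (subst summable_on_reindex_bij_betw[OF bij]) (rule sum_prod(2))
    then have "summable (\<lambda>i. norm (d i))"
      by (simp add: summable_on_imp_summable case_prod_unfold d_def norm_mult)
    then have "summable (\<lambda>i. norm (complex_of_real (pi * a) powr (- z)) * norm (d i))"
      by (rule summable_mult)
    also have "(\<lambda>i. norm (complex_of_real (pi * a) powr (- z)) * norm (d i)) = (\<lambda>i. norm (of_real (c i) * of_real (l i) powr (- z)))"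
      unfolding prod_eq norm_mult ..
    also have "\<dots> = (\<lambda>i. c i * l i powr (- (Re s / 2)))"
    proof
      fix i
      have "norm (complex_of_real (l i) powr (- z)) = l i powr Re (- z)"
        using l[of i] by (subst norm_powr_real_powr) auto
      then show "norm (of_real (c i) * of_real (l i) powr (- z)) = c i * l i powr (- (Re s / 2))"
        using c[of i] by (simp add: norm_mult z_def)
    qed
    finally show ?thesis .
  qed
  have int: "integrable lborel (\<lambda>u. of_real (F u) * exp (s * of_real u))"
    and sums: "(\<lambda>i. of_real (c i) * (of_real (l i) powr (- z) * Gamma z / 2)) sums (LINT u|lborel. of_real (F u) * exp (s * of_real u))"
    unfolding z_def using Mellin_sum[OF s0 l c F summ] by auto
  have "((\<lambda>i. (\<lambda>(n, k). dirichlet_term z (Suc n) * dirichlet_term (z + 1) (Suc k)) (prod_decode i)) has_sum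
      (riemann_zeta z * riemann_zeta (z + 1))) UNIV"
    by (subst has_sum_reindex_bij_betw[OF bij]) (rule sum_prod(1))
  then have "d sums (riemann_zeta z * riemann_zeta (z + 1))"
    unfolding case_prod_unfold d_def[symmetric] by (rule has_sum_imp_sums)
  from sums_mult[OF this, of "of_real (pi * a) powr (- z) * Gamma z / 2"]
  have "(\<lambda>i. of_real (c i) * (of_real (l i) powr (- z) * Gamma z / 2)) sums
     (of_real (pi * a) powr (- z) * Gamma z / 2 * (riemann_zeta z * riemann_zeta (z + 1)))"
  proof (rule sums_cong[THEN iffD1, rotated])
    fix i
    have "A * G / 2 * D = c * (L * G / 2)" if "c * L = A * D" for A G D c L :: complex
    proof -
      have "A * G / 2 * D = (A * D) * (G / 2)" by simp
      also have "\<dots> = c * (L * G / 2)" unfolding that[symmetric] by simp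
      finally show ?thesis .
    qed
    from this[OF prod_eq] show "of_real (pi * a) powr (- z) * Gamma z / 2 * d i = of_real (c i) * (of_real (l i) powr (- z) * Gamma z / 2)" .
  qed
  with sums have "(LINT u|lborel. of_real (F u) * exp (s * of_real u)) = of_real (pi * a) powr (- z) * Gamma z / 2 * (riemann_zeta z * riemann_zeta (z + 1))"
    by (rule sums_unique2)
  then show ?thesis using int by (simp add: has_bochner_integral_iff F_def z_def)
qed

lemma ZQ_entire_0_eq:
  assumes s: "Re s > 2"
  shows "ZQ_entire 0 s + 1 / s\<^sup>2 =
     - (1 - 2 powr (1 + s / 2)) * (1 - 2 powr (1 - s / 2)) * Lambda_fun (s / 2) * Lambda_fun (- (s / 2)) / 4"
proof -
  define h where "h u = of_real (log_theta u) * exp (s * of_real u)" for u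
  define E where "E a u = - ln (euler_phi (exp (- (pi * a * exp (2 * u)))))" for a u :: real
  define z where "z = s / 2"
  have z: "Re z > 1" using s by (simp add: z_def)
  have z0: "z \<noteq> 0" "z \<noteq> 1" "z + 1 \<noteq> 0" "z + 1 \<noteq> 1" "s \<noteq> 0" using z s by (auto simp: complex_eq_iff)
  define I where "I a = of_real (pi * a) powr (- z) * Gamma z / 2 * (riemann_zeta z * riemann_zeta (z + 1))" for a :: real
  have EI: "has_bochner_integral lborel (\<lambda>u. of_real (E a u) * exp (s * of_real u)) (I a)" if "a > 0" for a
    using Mellin_ln_euler_phi[OF that s] by (simp add: E_def I_def z_def)
  have "has_bochner_integral lborel (\<lambda>u. 2 * (of_real (E 1 u) * exp (s * of_real u)) + 2 * (of_real (E 4 u) * exp (s * of_real u))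
       - 5 * (of_real (E 2 u) * exp (s * of_real u))) (2 * I 1 + 2 * I 4 - 5 * I 2)"
    by (intro has_bochner_integral_add has_bochner_integral_diff has_bochner_integral_mult_right EI) auto
  moreover have "2 * (of_real (E 1 u) * exp (s * of_real u)) + 2 * (of_real (E 4 u) * exp (s * of_real u))
       - 5 * (of_real (E 2 u) * exp (s * of_real u)) = h u" for u
    unfolding h_def log_theta_eq_euler_phi[of u] E_def by (simp add: algebra_simps)
  ultimately have hI: "has_bochner_integral lborel h (2 * I 1 + 2 * I 4 - 5 * I 2)" by simp
  then have int: "integrable lborel h" and I: "(LINT u|lborel. h u) = 2 * I 1 + 2 * I 4 - 5 * I 2"
    by (simp_all add: has_bochner_integral_iff)
  \<comment> \<open>At w = 0 the kernel is L times a sum of two exponentials, and the summand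
    \<open>u\<close> of L(-u) is left over; it integrates to 1 / s^2.\<close>
  have hs: "h u + h (- u) = ZQ_kernel 0 s u + of_real u * exp (- s * of_real u)" for u
    by (simp add: h_def ZQ_kernel_def log_theta_uminus algebra_simps)
  have "(LINT u|lborel. h u) = (LINT u:{0<..}|lborel. h u + h (- u))"
    by (rule half_line_split[OF integrable_half_lines[OF int]])
  also have "\<dots> = ZQ_entire 0 s + 1 / s\<^sup>2"
    unfolding hs ZQ_entire_def using set_integrable_ZQ_kernel[of 0 s] exp_integral_half_line[of s] s
    by (simp add: set_integral_add del: mult_minus_left)
  finally have "ZQ_entire 0 s + 1 / s\<^sup>2 = 2 * I 1 + 2 * I 4 - 5 * I 2" using I by simp
  \<comment> \<open>X = 2^z; the scalings 1, 2, 4 contribute the factors 1, 1/X, 1/X^2.\<close>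
  define X where "X = exp (z * of_real (ln 2))"
  have X0: "X \<noteq> 0" by (simp add: X_def)
  have p2: "complex_of_real (pi * a) powr (- z) = of_real pi powr (- z) * exp (- z * of_real (ln a))" if "a > 0" for a
    using that by (simp add: powr_def Ln_of_real ln_mult algebra_simps del: of_real_mult flip: exp_add)
  have X2: "exp (- z * of_real (ln 2)) = 1 / X" by (simp add: X_def exp_minus divide_inverse)
  have "ln (4 :: real) = 2 * ln 2" using ln_realpow[of 2 2] by simp
  then have "exp (- z * of_real (ln 4)) = exp (- z * of_real (ln 2) + - z * of_real (ln 2))" by (simp add: algebra_simps)
  then have X4: "exp (- z * of_real (ln 4)) = 1 / X * (1 / X)" unfolding exp_add X2 .
  define W where "W = of_real pi powr (- z) * Gamma z / 2 * (riemann_zeta z * riemann_zeta (z + 1))"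
  have I1: "I 1 = W" and I2: "I 2 = W / X" and I4: "I 4 = W / X\<^sup>2"
    using X2 X4 unfolding I_def W_def by (simp_all add: p2 power2_eq_square del: of_real_mult mult_minus_left)
  \<comment> \<open>Writing both zeta values through \<open>Lambda_fun\<close> brings in 1 /
    (Gamma(z/2) Gamma((z + 1)/2)), which Legendre duplication cancels against Gamma(z) up to X / (2
    sqrt pi); the functional equation then replaces z + 1 by -z.\<close>
  have W: "W = X / 4 * (Lambda_fun z * Lambda_fun (- z))"
  proof -
    have g: "z / 2 \<notin> \<int>\<^sub>\<le>\<^sub>0" "z / 2 + 1 / 2 \<notin> \<int>\<^sub>\<le>\<^sub>0"
      using z by (auto elim!: nonpos_Ints_cases simp: complex_eq_iff)
    have L: "Lambda_fun (z + 1) = Lambda_fun (- z)"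
      using Lambda_fun_reflect[of "- z"] by (simp add: add.commute)
    have dup: "Gamma (z / 2) * Gamma (z / 2 + 1 / 2) = exp ((1 - z) * of_real (ln 2)) * of_real (sqrt pi) * Gamma z"
      using Gamma_legendre_duplication[OF g] by simp
    have nz: "Gamma (z / 2) \<noteq> 0" "Gamma (z / 2 + 1 / 2) \<noteq> 0" using g by (simp_all add: Gamma_eq_zero_iff)
    have "exp ((1 - z) * of_real (ln 2)) = 2 / X"
      by (simp add: X_def algebra_simps exp_diff exp_of_real)
    with dup have "Gamma z = Gamma (z / 2) * Gamma (z / 2 + 1 / 2) * X / (2 * of_real (sqrt pi))"
      using X0 by (simp add: field_simps)
    then have G: "Gamma z * (rGamma (z / 2) * rGamma (z / 2 + 1 / 2)) = X / (2 * of_real (sqrt pi))"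
      using nz by (simp add: rGamma_inverse_Gamma field_simps)
    have P: "of_real pi powr (- z) * (of_real pi powr (z / 2) * of_real pi powr ((z + 1) / 2)) = complex_of_real (sqrt pi)"
    proof -
      have "of_real pi powr (- z) * (of_real pi powr (z / 2) * of_real pi powr ((z + 1) / 2)) = complex_of_real pi powr (- z + (z / 2 + (z + 1) / 2))"
        by (simp only: powr_add)
      also have "- z + (z / 2 + (z + 1) / 2) = of_real (1 / 2)" by (simp add: field_simps)
      also have "complex_of_real pi powr of_real (1 / 2) = of_real (pi powr (1 / 2))"
        by (rule powr_of_real) auto
      finally show ?thesis by (simp add: powr_half_sqrt)
    qed
    have e: "(z + 1) / 2 = z / 2 + 1 / 2" by (simp add: add_divide_distrib)
    have "W = (of_real pi powr (- z) * (of_real pi powr (z / 2) * of_real pi powr ((z + 1) / 2)))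
        * (Gamma z * (rGamma (z / 2) * rGamma ((z + 1) / 2))) / 2 * (Lambda_fun z * Lambda_fun (z + 1))"
      unfolding W_def riemann_zeta_eq_Lambda_fun[OF z0(1,2)] riemann_zeta_eq_Lambda_fun[OF z0(3,4)] by simp
    also have "\<dots> = X / 4 * (Lambda_fun z * Lambda_fun (- z))"
      unfolding P unfolding e G L by simp
    finally show ?thesis .
  qed
  have "(2::complex) powr (1 + z) = 2 * X" "(2::complex) powr (1 - z) = 2 / X"
  proof -
    have Ln2: "Ln 2 = of_real (ln 2)" using Ln_of_real[of 2] by simp
    show "(2::complex) powr (1 + z) = 2 * X" "(2::complex) powr (1 - z) = 2 / X"
      by (simp_all add: powr_def Ln2 X_def algebra_simps exp_add exp_diff exp_of_real)
  qed
  \<comment> \<open>The quadratic 2 - 5/X + 2/X^2 equals - (1 - 2 X) (1 - 2 / X) / X; the factor X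
    contained in \<open>W\<close> clears the last denominator.\<close>
  moreover have "2 * W + 2 * (W / X\<^sup>2) - 5 * (W / X) = - (1 - 2 * X) * (1 - 2 / X) * Lambda_fun z * Lambda_fun (- z) / 4"
    unfolding W using X0 by (simp add: field_simps power2_eq_square)
  ultimately show ?thesis
    using \<open>ZQ_entire 0 s + 1 / s\<^sup>2 = 2 * I 1 + 2 * I 4 - 5 * I 2\<close> unfolding I1 I2 I4 z_def[symmetric] by simp
qed

section \<open>The function xi and holomorphy in two variables\<close>

definition xi_Q :: "complex \<times> complex \<Rightarrow> complex" where
  "xi_Q p = 1 / 2 + snd p * (snd p - fst p) / 2 * ZQ_entire (fst p) (snd p)"

lemma xi_Q_0_holomorphic: "(\<lambda>s. xi_Q (0, s)) holomorphic_on UNIV"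
  unfolding xi_Q_def by (auto intro!: holomorphic_intros ZQ_entire_holomorphic)

lemma isCont_xi_Q_0: "isCont (\<lambda>s. xi_Q (0, s)) s"
  using holomorphic_on_imp_continuous_on[OF xi_Q_0_holomorphic] by (simp add: continuous_on_eq_continuous_at)

lemma neg_half_eq_1_iff: "- (s / 2) = 1 \<longleftrightarrow> s = -2" for s :: complex
proof
  assume "- (s / 2) = 1"
  then have "-2 * (- (s / 2)) = -2 * 1" by (rule arg_cong)
  then show "s = -2" by simp
qed simp

text \<open>The excluded points are those where s/2 or -s/2 is a pole 0 or 1 of
  \<open>Lambda_fun\<close>. The plane without them is connected, so the identity known for Re s > 2
  extends to all of it.\<close>

lemma xi_Q_0_eq_Lambda_fun:
  assumes s: "s \<notin> {0, 2, -2}"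
  shows "xi_Q (0, s) = - (s\<^sup>2 / 8) * (1 - 2 powr (1 + s / 2)) * (1 - 2 powr (1 - s / 2))
     * Lambda_fun (s / 2) * Lambda_fun (- (s / 2))"
proof -
  define R where "R s = - (s\<^sup>2 / 8) * (1 - 2 powr (1 + s / 2)) * (1 - 2 powr (1 - s / 2))
     * Lambda_fun (s / 2) * Lambda_fun (- (s / 2))" for s
  have "(\<lambda>s. Lambda_fun (s / 2)) holomorphic_on - {0, 2, -2}"
    unfolding Lambda_fun_def
    by (intro holomorphic_intros ZQ_entire_holomorphic) (auto simp: field_simps)
  moreover have "(\<lambda>s. Lambda_fun (- (s / 2))) holomorphic_on - {0, 2, -2}"
    unfolding Lambda_fun_def
    by (intro holomorphic_intros ZQ_entire_holomorphic) (auto simp: neg_half_eq_1_iff)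
  ultimately have R: "R holomorphic_on - {0, 2, -2}"
    unfolding R_def by (intro holomorphic_intros) auto
  have "xi_Q (0, s) = R s"
  proof (rule analytic_continuation_open[where s = "{s. Re s > 2}" and s' = "- {0, 2, -2}"
        and f = "\<lambda>s. xi_Q (0, s)" and g = R])
    show "open {s. Re s > 2}" by (rule open_halfspace_Re_gt)
    have "3 \<in> {s. Re s > 2}" by simp
    then show "{s. Re s > 2} \<noteq> {}" by blast
    have "connected (UNIV - {0, 2, -2 :: complex})"
      by (rule connected_open_delete_finite) auto
    then show "connected (- {0, 2, -2 :: complex})" by (simp add: Compl_eq_Diff_UNIV)
    show "(\<lambda>s. xi_Q (0, s)) holomorphic_on - {0, 2, -2}"
      by (rule holomorphic_on_subset[OF xi_Q_0_holomorphic]) simp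
    fix s assume "s \<in> {s. Re s > 2}"
    then have s: "Re s > 2" by simp
    then have "s \<noteq> 0" by auto
    then have "xi_Q (0, s) = s\<^sup>2 / 2 * (ZQ_entire 0 s + 1 / s\<^sup>2)"
      by (simp add: xi_Q_def field_simps power2_eq_square)
    also have "\<dots> = R s"
    proof -
      have "x / 2 * (- A * B * C * D / 4) = - (x / 8) * A * B * C * D" for x A B C D :: complex by simp
      then show ?thesis unfolding ZQ_entire_0_eq[OF s] R_def .
    qed
    finally show "xi_Q (0, s) = R s" .
  qed (use R s in \<open>auto simp: open_Compl\<close>)
  then show ?thesis unfolding R_def .
qed

lemma xi_Q_0_eq_completed_zeta:
  assumes s: "s \<notin> {0, 2, -2}"
  shows "xi_Q (0, s) = - (s\<^sup>2 / 8) * (1 - 2 powr (1 + s / 2)) * (1 - 2 powr (1 - s / 2))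
     * completed_zeta (s / 2) * completed_zeta (- (s / 2))"
proof -
  have n: "s / 2 \<noteq> 0" "s / 2 \<noteq> 1" "- (s / 2) \<noteq> 0" "- (s / 2) \<noteq> 1"
    using s by (auto simp: neg_half_eq_1_iff)
  show ?thesis
    unfolding completed_zeta_eq[OF n(1,2)] completed_zeta_eq[OF n(3,4)] by (rule xi_Q_0_eq_Lambda_fun[OF s])
qed

text \<open>The left side is continuous everywhere and equals the formula off three points; this
  gives the values at 0, 2 and -2 as limits.\<close>

lemma xi_Q_0_eq_remove_sings:
  "xi_Q (0, s) = remove_sings (\<lambda>s. - (s\<^sup>2 / 8) * (1 - 2 powr (1 + s / 2)) * (1 - 2 powr (1 - s / 2))
     * completed_zeta (s / 2) * completed_zeta (- (s / 2))) s"
proof (rule remove_sings_eqI[symmetric], rule Lim_transform_eventually)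
  show "(\<lambda>s. xi_Q (0, s)) \<midarrow>s\<rightarrow> xi_Q (0, s)"
    using isCont_xi_Q_0 by (simp add: isCont_def)
  have "\<forall>\<^sub>F z in at s. z \<noteq> 0 \<and> z \<noteq> 2 \<and> z \<noteq> -2"
    by (intro eventually_conj eventually_neq_at_within)
  then show "\<forall>\<^sub>F z in at s. xi_Q (0, z) = - (z\<^sup>2 / 8) * (1 - 2 powr (1 + z / 2)) * (1 - 2 powr (1 - z / 2))
     * completed_zeta (z / 2) * completed_zeta (- (z / 2))"
    by eventually_elim (intro xi_Q_0_eq_completed_zeta, simp)
qed

section \<open>Values on the imaginary axis\<close>

lemma Lambda_fun_cnj: "Lambda_fun (cnj s) = cnj (Lambda_fun s)"
proof -
  \<comment> \<open>At w = 1 the kernel is an expression in exponentials with real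
    \<open>log_theta\<close>, so conjugation need not pass through the power series of
    \<open>expm1_quot\<close>.\<close>
  have k: "ZQ_kernel 1 (cnj s) u = cnj (ZQ_kernel 1 s u)" for u
    using ZQ_kernel_mult[of 1 s u] ZQ_kernel_mult[of 1 "cnj s" u] by (simp add: exp_cnj)
  have "ZQ_entire 1 (cnj s) = cnj (ZQ_entire 1 s)"
    unfolding ZQ_entire_def set_lebesgue_integral_def k
    using Bochner_Integration.integral_cnj[of lborel "\<lambda>u. indicator {0<..} u *\<^sub>R ZQ_kernel 1 s u"]
    by (simp add: scaleR_conv_of_real)
  then show ?thesis by (simp add: Lambda_fun_def)
qed

text \<open>At \<open>t = 0\<close> the factor t^2 makes this 0, whereas xi is 1/2 there; hence
  equality is claimed only for \<open>t \<noteq> 0\<close>, and the value at 0 is obtained as a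
  limit.\<close>

definition xi_Q_axis :: "real \<Rightarrow> real" where
  "xi_Q_axis t = t\<^sup>2 / 8 * (cmod (1 - 2 powr (1 + \<i> * of_real t / 2)))\<^sup>2
           * (cmod (completed_zeta (\<i> * of_real t / 2)))\<^sup>2"

text \<open>For imaginary s, -s/2 is the conjugate of s/2, so the factors pair into squared absolute
  values, and - s^2 = t^2. They do not vanish: 2^(1 + s/2) has norm 2, and Lambda(s/2) = Lambda(1 -
  s/2) is nonzero because zeta has no zeros on the line Re s = 1.\<close>

lemma xi_Q_imaginary_axis:
  fixes t :: real
  assumes t: "t \<noteq> 0"
  shows "xi_Q (0, \<i> * of_real t) = of_real (xi_Q_axis t)"
    and "0 < xi_Q_axis t"
proof -
  define s where "s = \<i> * complex_of_real t"
  have s: "s \<notin> {0, 2, -2}" using t by (auto simp: s_def complex_eq_iff)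
  have s2: "s / 2 \<noteq> 0" "s / 2 \<noteq> 1" using s by auto
  have c: "- (s / 2) = cnj (s / 2)" by (simp add: s_def)
  have Ln2: "Ln 2 = of_real (ln 2)" using Ln_of_real[of 2] by simp
  have p: "(2 :: complex) powr (1 - s / 2) = cnj (2 powr (1 + s / 2))"
    by (simp add: powr_def Ln2 exp_cnj s_def)
  have "xi_Q (0, s) = - (s\<^sup>2 / 8) * ((1 - 2 powr (1 + s / 2)) * cnj (1 - 2 powr (1 + s / 2)))
      * (Lambda_fun (s / 2) * cnj (Lambda_fun (s / 2)))"
    unfolding xi_Q_0_eq_Lambda_fun[OF s] p c Lambda_fun_cnj by simp
  also have "\<dots> = - (s\<^sup>2 / 8) * of_real ((cmod (1 - 2 powr (1 + s / 2)))\<^sup>2) * of_real ((cmod (Lambda_fun (s / 2)))\<^sup>2)"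
    unfolding complex_norm_square ..
  also have "s\<^sup>2 = - of_real (t\<^sup>2)" by (simp add: s_def power_mult_distrib)
  finally show "xi_Q (0, \<i> * of_real t) = of_real (xi_Q_axis t)"
    unfolding xi_Q_axis_def s_def[symmetric] completed_zeta_eq[OF s2] by simp
  have "norm ((2 :: complex) powr (1 + s / 2)) = 2"
    by (simp add: powr_def Ln2 s_def)
  then have n1: "1 - 2 powr (1 + s / 2) \<noteq> 0" by force
  have "Complex 1 (- t / 2) = 1 - s / 2" by (simp add: s_def complex_eq_iff)
  then have "riemann_zeta (1 - s / 2) \<noteq> 0" using riemann_zeta_nonzero_Re_1[of "- t / 2"] t by simp
  moreover have "1 - s / 2 \<noteq> 0" "1 - s / 2 \<noteq> 1" using s2 by auto
  ultimately have "Lambda_fun (s / 2) \<noteq> 0"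
    using riemann_zeta_eq_Lambda_fun[of "1 - s / 2"] by (auto simp: Lambda_fun_reflect)
  then show "0 < xi_Q_axis t"
    unfolding xi_Q_axis_def s_def[symmetric] completed_zeta_eq[OF s2] using n1 t by (intro mult_pos_pos) auto
qed

section \<open>Closure properties of holomorphy in two variables\<close>

lemma holomorphic2_onI:
  assumes "\<And>p. p \<in> D \<Longrightarrow> (f has_derivative f' p) (at p within D)"
    and "\<And>p h. p \<in> D \<Longrightarrow> f' p h = a p * fst h + b p * snd h"
  shows "holomorphic2_on f D"
  unfolding holomorphic2_on_def
proof
  fix p assume p: "p \<in> D"
  have "f' p = (\<lambda>h. a p * fst h + b p * snd h)" using assms(2)[OF p] by (intro ext)
  then show "\<exists>a b. (f has_derivative (\<lambda>h. a * fst h + b * snd h)) (at p within D)"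
    using assms(1)[OF p] by metis
qed

lemma holomorphic2_onE:
  assumes "holomorphic2_on f D"
  obtains a b where "\<forall>p\<in>D. (f has_derivative (\<lambda>h. a p * fst h + b p * snd h)) (at p within D)"
  using assms unfolding holomorphic2_on_def by metis

lemma holomorphic2_on_const: "holomorphic2_on (\<lambda>p. c) D"
  by (rule holomorphic2_onI[where f' = "\<lambda>p h. 0" and a = "\<lambda>_. 0" and b = "\<lambda>_. 0"]) auto

lemma holomorphic2_on_fst: "holomorphic2_on fst D"
  by (rule holomorphic2_onI[where f' = "\<lambda>p h. fst h" and a = "\<lambda>_. 1" and b = "\<lambda>_. 0"])
     (auto intro: derivative_intros)

lemma holomorphic2_on_snd: "holomorphic2_on snd D"
  by (rule holomorphic2_onI[where f' = "\<lambda>p h. snd h" and a = "\<lambda>_. 0" and b = "\<lambda>_. 1"])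
     (auto intro: derivative_intros)

lemma holomorphic2_on_add:
  assumes "holomorphic2_on f D" "holomorphic2_on g D"
  shows "holomorphic2_on (\<lambda>p. f p + g p) D"
proof -
  from assms(1) obtain a b where f: "\<forall>p\<in>D. (f has_derivative (\<lambda>h. a p * fst h + b p * snd h)) (at p within D)"
    by (rule holomorphic2_onE)
  from assms(2) obtain c d where g: "\<forall>p\<in>D. (g has_derivative (\<lambda>h. c p * fst h + d p * snd h)) (at p within D)"
    by (rule holomorphic2_onE)
  show ?thesis
  proof (rule holomorphic2_onI[where a = "\<lambda>p. a p + c p" and b = "\<lambda>p. b p + d p"])
    show "((\<lambda>p. f p + g p) has_derivative (\<lambda>h. (a p * fst h + b p * snd h) + (c p * fst h + d p * snd h))) (at p within D)"
      if "p \<in> D" for p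
      by (rule has_derivative_add[OF bspec[OF f that] bspec[OF g that]])
  qed (simp add: algebra_simps)
qed

lemma holomorphic2_on_mult:
  assumes "holomorphic2_on f D" "holomorphic2_on g D"
  shows "holomorphic2_on (\<lambda>p. f p * g p) D"
proof -
  from assms(1) obtain a b where f: "\<forall>p\<in>D. (f has_derivative (\<lambda>h. a p * fst h + b p * snd h)) (at p within D)"
    by (rule holomorphic2_onE)
  from assms(2) obtain c d where g: "\<forall>p\<in>D. (g has_derivative (\<lambda>h. c p * fst h + d p * snd h)) (at p within D)"
    by (rule holomorphic2_onE)
  show ?thesis
  proof (rule holomorphic2_onI[where a = "\<lambda>p. f p * c p + a p * g p" and b = "\<lambda>p. f p * d p + b p * g p"])
    show "((\<lambda>p. f p * g p) has_derivative (\<lambda>h. f p * (c p * fst h + d p * snd h) + (a p * fst h + b p * snd h) * g p)) (at p within D)"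
      if "p \<in> D" for p
      by (rule has_derivative_mult[OF bspec[OF f that] bspec[OF g that]])
  qed (simp add: algebra_simps)
qed

lemma holomorphic2_on_diff:
  assumes "holomorphic2_on f D" "holomorphic2_on g D"
  shows "holomorphic2_on (\<lambda>p. f p - g p) D"
  using holomorphic2_on_add[OF assms(1) holomorphic2_on_mult[OF holomorphic2_on_const[of "-1"] assms(2)]] by simp

lemma holomorphic2_on_inverse:
  assumes "holomorphic2_on f D" "\<And>p. p \<in> D \<Longrightarrow> f p \<noteq> 0"
  shows "holomorphic2_on (\<lambda>p. inverse (f p)) D"
proof -
  from assms(1) obtain a b where f: "\<forall>p\<in>D. (f has_derivative (\<lambda>h. a p * fst h + b p * snd h)) (at p within D)"
    by (rule holomorphic2_onE)
  show ?thesis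
  proof (rule holomorphic2_onI[where a = "\<lambda>p. - (inverse (f p) * a p * inverse (f p))" and b = "\<lambda>p. - (inverse (f p) * b p * inverse (f p))"])
    show "((\<lambda>p. inverse (f p)) has_derivative (\<lambda>h. - (inverse (f p) * (a p * fst h + b p * snd h) * inverse (f p)))) (at p within D)"
      if "p \<in> D" for p
      by (rule Deriv.has_derivative_inverse[OF assms(2)[OF that] bspec[OF f that]])
  qed (simp add: algebra_simps)
qed

lemma holomorphic2_on_subset: "holomorphic2_on f D \<Longrightarrow> E \<subseteq> D \<Longrightarrow> holomorphic2_on f E"
  unfolding holomorphic2_on_def by (meson has_derivative_subset subsetD)

lemma holomorphic2_on_imp_continuous_on: "holomorphic2_on f D \<Longrightarrow> continuous_on D f"
  unfolding holomorphic2_on_def continuous_on_eq_continuous_within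
  using has_derivative_continuous by blast

lemmas holomorphic2_intros = holomorphic2_on_const holomorphic2_on_fst holomorphic2_on_snd
  holomorphic2_on_add holomorphic2_on_diff holomorphic2_on_mult

lemma holomorphic2_xi_Q: "holomorphic2_on xi_Q UNIV"
  unfolding xi_Q_def[abs_def] divide_inverse
  by (intro holomorphic2_intros holomorphic2_ZQ_entire)

section \<open>The identity theorem in two variables; uniqueness and existence of the
  continuation\<close>

lemma holomorphic2_identity:
  assumes f: "holomorphic2_on f (ball p r)" and U: "open U" "U \<noteq> {}" "U \<subseteq> ball p r"
    and 0: "\<And>q. q \<in> U \<Longrightarrow> f q = 0" and q: "q \<in> ball p r"
  shows "f q = 0"
proof -
  obtain a where a: "a \<in> U" using U by blast
  \<comment> \<open>The complex line through a point of \<open>U\<close> and the target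
    \<open>q\<close>. Its part inside the ball corresponds to a convex set of parameters, so the
    one-variable identity theorem carries the vanishing from 0 to 1.\<close>
  define L where "L z = (fst a + z * (fst q - fst a), snd a + z * (snd q - snd a))" for z :: complex
  have contL: "continuous_on UNIV L" unfolding L_def by (intro continuous_intros)
  define T where "T = L -` ball p r"
  have oT: "open T" unfolding T_def by (rule open_vimage[OF open_ball contL])
  define M where "M z = (z * (fst q - fst a), z * (snd q - snd a))" for z :: complex
  have "linear M"
    unfolding M_def by (rule linearI) (simp_all add: algebra_simps scaleR_conv_of_real)
  then have "convex (M -` ball (p - a) r)" by (rule convex_linear_vimage) (rule convex_ball)
  moreover have pL: "p - L z = (p - a) - M z" for z
    by (simp add: L_def M_def prod_eq_iff)
  have "T = M -` ball (p - a) r"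
    unfolding T_def vimage_def mem_ball dist_norm pL ..
  ultimately have "convex T" by simp
  then have cT: "connected T" by (rule convex_connected)
  have hol: "(\<lambda>z. f (L z)) holomorphic_on T"
    unfolding L_def
    by (rule holomorphic2_on_compose[OF f open_ball oT])
       (auto intro!: holomorphic_intros simp: T_def L_def)
  have "f (L 1) = (\<lambda>_. 0) (1 :: complex)"
  proof (rule analytic_continuation_open[where s = "L -` U" and s' = T and f = "\<lambda>z. f (L z)" and g = "\<lambda>_. 0"])
    show "open (L -` U)" by (rule open_vimage[OF U(1) contL])
    have "L 0 = a" by (simp add: L_def)
    then show "L -` U \<noteq> {}" using a by blast
    have "L 1 = q" by (simp add: L_def)
    then show "1 \<in> T" using q by (simp add: T_def)
  qed (use oT cT hol U(3) 0 in \<open>auto simp: T_def\<close>)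
  moreover have "L 1 = q" by (simp add: L_def)
  ultimately show ?thesis by simp
qed

lemma open_ZQ_cone: "open ZQ_cone"
proof -
  have eq: "ZQ_cone = {p. Re (fst p) < Re (snd p)} \<inter> {p. Re (snd p) < 0}"
    by (auto simp: ZQ_cone_def)
  have "open {p :: complex \<times> complex. Re (fst p) < Re (snd p)}" "open {p :: complex \<times> complex. Re (snd p) < 0}"
    by (intro open_Collect_less continuous_intros)+
  then show ?thesis unfolding eq by (rule open_Int)
qed

text \<open>The domain \<open>D\<close> is not known to be connected, so the identity theorem cannot
  be applied on \<open>D\<close> itself. The argument takes place on all of the connected space, by
  a set that is open and closed there.\<close>

lemma is_ZQ_imp_xi_Q:
  assumes Z: "is_ZQ D Z" and q: "q \<in> D"
  shows "2 * fst q * xi_Q q = snd q * (snd q - fst q) * Z q"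
proof -
  define k :: "complex \<times> complex \<Rightarrow> complex" where "k p = snd p * (snd p - fst p)" for p
  define x where "x p = 2 * fst p * xi_Q p" for p
  have k: "holomorphic2_on k UNIV" unfolding k_def by (intro holomorphic2_intros)
  have x: "holomorphic2_on x UNIV" unfolding x_def by (intro holomorphic2_intros holomorphic2_xi_Q)
  define F where "F p = x p - k p * Z p" for p
  have D: "open D" "holomorphic2_on Z D"
    using Z by (simp_all add: is_ZQ_def meromorphic2_def)
  have F: "holomorphic2_on F D"
    unfolding F_def by (intro holomorphic2_intros D(2) holomorphic2_on_subset[OF k] holomorphic2_on_subset[OF x]) auto
  \<comment> \<open>The points, inside \<open>D\<close> or not, near which the difference
    \<open>F\<close> vanishes wherever it is defined.\<close>
  define V where "V = {p. \<exists>r>0. \<forall>q\<in>ball p r \<inter> D. F q = 0}"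
  have "open V"
    unfolding open_contains_ball
  proof
    fix p assume "p \<in> V"
    then obtain r where r: "r > 0" "\<forall>q\<in>ball p r \<inter> D. F q = 0" by (auto simp: V_def)
    have "q \<in> V" if q: "q \<in> ball p r" for q
    proof -
      obtain e where "e > 0" "ball q e \<subseteq> ball p r" using openE[OF open_ball q] by blast
      then show ?thesis using r(2) unfolding V_def by blast
    qed
    then show "\<exists>e>0. ball p e \<subseteq> V" using r(1) by blast
  qed
  moreover have "closed V"
    unfolding closure_subset_eq[symmetric]
  proof
    fix p assume p: "p \<in> closure V"
    obtain r g h where r: "r > 0" and g: "holomorphic2_on g (ball p r)" and h: "holomorphic2_on h (ball p r)"
      and hne: "\<exists>q\<in>ball p r. h q \<noteq> 0"
      and gh: "\<forall>q\<in>ball p r. h q \<noteq> 0 \<longrightarrow> q \<in> D \<and> Z q = g q / h q"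
      using Z unfolding is_ZQ_def meromorphic2_def by blast
    obtain q0 where q0: "q0 \<in> V" "q0 \<in> ball p r"
      using p r by (auto simp: closure_approachable dist_commute)
    then obtain r0 where r0: "r0 > 0" "\<forall>q\<in>ball q0 r0 \<inter> D. F q = 0" by (auto simp: V_def)
    \<comment> \<open>Clearing the local denominator gives a function that is holomorphic on the
      whole ball, also off \<open>D\<close>. The second factor \<open>h\<close> makes
      \<open>H = F * h * h\<close> true at the zeros of \<open>h\<close> too, where the quotient
      says nothing.\<close>
    define H where "H p = (x p * h p - k p * g p) * h p" for p
    have H: "holomorphic2_on H (ball p r)"
      unfolding H_def
      by (intro holomorphic2_intros g h holomorphic2_on_subset[OF k] holomorphic2_on_subset[OF x]) auto
    have HF: "H q = F q * h q * h q" if "q \<in> ball p r" for q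
      using gh that by (cases "h q = 0") (auto simp: H_def F_def field_simps)
    have H0: "H q = 0" if "q \<in> ball p r" for q
    proof (rule holomorphic2_identity[OF H _ _ _ _ that])
      show "open (ball q0 r0 \<inter> ball p r)" by (intro open_Int open_ball)
      have "q0 \<in> ball q0 r0 \<inter> ball p r" using q0 r0 by simp
      then show "ball q0 r0 \<inter> ball p r \<noteq> {}" by blast
      show "H q = 0" if "q \<in> ball q0 r0 \<inter> ball p r" for q
        using that r0 gh HF[of q] by (cases "h q = 0") auto
    qed auto
    have "F q = 0" if q: "q \<in> ball p r \<inter> D" for q
    proof (rule ccontr)
      assume Fq: "F q \<noteq> 0"
      \<comment> \<open>Where \<open>F\<close> is nonzero, \<open>h\<close> must vanish since
        \<open>H\<close> does. This set is open, so if it were nonempty, \<open>h\<close> would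
        vanish on the whole ball.\<close>
      define U where "U = F -` (- {0}) \<inter> D \<inter> ball p r"
      have "open (F -` (- {0}) \<inter> D)"
        using holomorphic2_on_imp_continuous_on[OF F] D(1) by (intro continuous_on_open_vimage[THEN iffD1, rule_format]) auto
      then have oU: "open U" unfolding U_def by (rule open_Int[OF _ open_ball])
      have qU: "q \<in> U" using q Fq by (simp add: U_def)
      have hU: "h y = 0" if "y \<in> U" for y
        using H0[of y] HF[of y] that by (auto simp: U_def)
      have "h y = 0" if "y \<in> ball p r" for y
      proof (rule holomorphic2_identity[OF h oU _ _ hU that])
        show "U \<noteq> {}" using qU by blast
        show "U \<subseteq> ball p r" unfolding U_def by blast
      qed
      with hne show False by blast
    qed
    then show "p \<in> V" using r unfolding V_def by blast
  qed
  moreover have "V \<noteq> {}"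
  proof -
    have c: "(-2, -1) \<in> ZQ_cone" by (simp add: ZQ_cone_def)
    obtain e where e: "e > 0" "ball (-2, -1) e \<subseteq> ZQ_cone"
      using openE[OF open_ZQ_cone c] by blast
    have "F y = 0" if "y \<in> ZQ_cone" for y
    proof -
      obtain w s where y: "y = (w, s)" by (cases y)
      have ws: "(w, s) \<in> ZQ_cone" using that y by simp
      have "s \<noteq> 0" "s - w \<noteq> 0" using ws by (auto simp: ZQ_cone_def)
      moreover have "Z (w, s) = w * ZQ_entire w s + w / (s * (s - w))"
        using Z ws ZQ_integral_eq[OF ws] unfolding is_ZQ_def by auto
      ultimately show ?thesis by (simp add: F_def x_def k_def xi_Q_def y distrib_left)
    qed
    then have "(-2, -1) \<in> V" using e unfolding V_def by blast
    then show ?thesis by blast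
  qed
  ultimately have "V = UNIV" using clopen[of V] by blast
  then have "q \<in> V" by simp
  then obtain r where "r > 0" "\<forall>y\<in>ball q r \<inter> D. F y = 0" unfolding V_def by blast
  then have "F q = 0" using q by simp
  then show ?thesis by (simp add: F_def x_def k_def)
qed

text \<open>The overview's formula for Z is a global quotient with denominator s (s - w), and D is
  the complement of its zero set. This guarantees that statements about every continuation are not
  vacuous.\<close>

lemma is_ZQ_exists: "\<exists>D Z. is_ZQ D Z"
proof (intro exI)
  define D where "D = {p :: complex \<times> complex. snd p \<noteq> 0 \<and> snd p \<noteq> fst p}"
  define h where "h p = snd p * (snd p - fst p)" for p :: "complex \<times> complex"
  define g where "g p = fst p * h p * ZQ_entire (fst p) (snd p) + fst p" for p
  define Z where "Z p = g p * inverse (h p)" for p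
  have h: "holomorphic2_on h UNIV" unfolding h_def by (intro holomorphic2_intros)
  have g: "holomorphic2_on g UNIV" unfolding g_def by (intro holomorphic2_intros h holomorphic2_ZQ_entire)
  have hD: "h p \<noteq> 0 \<longleftrightarrow> p \<in> D" for p by (auto simp: h_def D_def)
  have "D = h -` (- {0})" using hD by auto
  then have "open D"
    using open_vimage[OF _ holomorphic2_on_imp_continuous_on[OF h], of "- {0}"] by auto
  moreover have "holomorphic2_on Z D"
    unfolding Z_def using hD
    by (intro holomorphic2_intros holomorphic2_on_inverse holomorphic2_on_subset[OF h] holomorphic2_on_subset[OF g]) auto
  moreover have "\<exists>r>0. \<exists>g h. holomorphic2_on g (ball p r) \<and> holomorphic2_on h (ball p r) \<and>
        (\<exists>q\<in>ball p r. h q \<noteq> 0) \<and> (\<forall>q\<in>ball p r. h q \<noteq> 0 \<longrightarrow> q \<in> D \<and> Z q = g q / h q)" for p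
  proof (intro exI conjI)
    show "holomorphic2_on g (ball p 1)" by (rule holomorphic2_on_subset[OF g]) simp
    show "holomorphic2_on h (ball p 1)" by (rule holomorphic2_on_subset[OF h]) simp
    \<comment> \<open>For fixed \<open>w\<close> the denominator vanishes only at s = 0 and s = w,
      and a disc is uncountable; this provides a point where the denominator is nonzero.\<close>
    have "\<not> ball (snd p) 1 \<subseteq> {0, fst p}"
      using uncountable_ball[of 1 "snd p"] countable_subset[of "ball (snd p) 1" "{0, fst p}"] by auto
    then obtain y where "y \<in> ball (snd p) 1" "y \<noteq> 0" "y \<noteq> fst p" by blast
    then have "(fst p, y) \<in> ball p 1" "h (fst p, y) \<noteq> 0"
      by (auto simp: dist_prod_def h_def)
    then show "\<exists>q\<in>ball p 1. h q \<noteq> 0" by blast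
    show "\<forall>q\<in>ball p 1. h q \<noteq> 0 \<longrightarrow> q \<in> D \<and> Z q = g q / h q"
      by (simp add: hD Z_def divide_inverse)
  qed simp
  ultimately have "meromorphic2 D Z" unfolding meromorphic2_def by blast
  moreover have "ZQ_cone \<subseteq> D" by (auto simp: ZQ_cone_def D_def)
  moreover have "Z (w, s) = ZQ_integral w s" if "(w, s) \<in> ZQ_cone" for w s
  proof -
    have "h (w, s) \<noteq> 0" using that by (auto simp: ZQ_cone_def h_def)
    moreover have "s * (s - w) = h (w, s)" by (simp add: h_def)
    ultimately show ?thesis
      unfolding ZQ_integral_eq[OF that] Z_def g_def by (simp add: field_simps)
  qed
  ultimately show "is_ZQ D Z" unfolding is_ZQ_def by auto
qed

theorem theorem1p1:
  shows "(\<exists>D Z. is_ZQ D Z) \<and>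
    (\<exists>\<xi> :: complex \<times> complex \<Rightarrow> complex.
       holomorphic2_on \<xi> UNIV \<and>
       (\<forall>D Z. is_ZQ D Z \<longrightarrow>
          (\<forall>(w, s)\<in>D. w \<noteq> 0 \<longrightarrow> \<xi> (w, s) = s * (s - w) / (2 * w) * Z (w, s))) \<and>
       (\<forall>s. \<xi> (0, s) = remove_sings (\<lambda>s. - (s\<^sup>2 / 8) * (1 - 2 powr (1 + s / 2)) * (1 - 2 powr (1 - s / 2))
              * completed_zeta (s / 2) * completed_zeta (- (s / 2))) s) \<and>
       (\<forall>t::real. t \<noteq> 0 \<longrightarrow> \<xi> (0, \<i> * of_real t) =
          of_real (t\<^sup>2 / 8 * (cmod (1 - 2 powr (1 + \<i> * of_real t / 2)))\<^sup>2
                          * (cmod (completed_zeta (\<i> * of_real t / 2)))\<^sup>2)) \<and>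
       ((\<lambda>t::real. of_real (t\<^sup>2 / 8 * (cmod (1 - 2 powr (1 + \<i> * of_real t / 2)))\<^sup>2
                          * (cmod (completed_zeta (\<i> * of_real t / 2)))\<^sup>2))
          \<longlongrightarrow> \<xi> (0, 0)) (at 0) \<and>
       (\<forall>t::real. \<xi> (0, \<i> * of_real t) \<in> \<real> \<and> 0 < Re (\<xi> (0, \<i> * of_real t))) \<and>
       \<xi> (0, 0) = 1 / 2)"
  unfolding xi_Q_axis_def[symmetric]
proof (intro conjI is_ZQ_exists exI[of _ xi_Q])
  show "holomorphic2_on xi_Q UNIV" by (rule holomorphic2_xi_Q)
  show "\<forall>D Z. is_ZQ D Z \<longrightarrow> (\<forall>(w, s)\<in>D. w \<noteq> 0 \<longrightarrow> xi_Q (w, s) = s * (s - w) / (2 * w) * Z (w, s))"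
  proof (intro allI impI ballI, clarify)
    fix D Z w s assume "is_ZQ D Z" "(w, s) \<in> D" "w \<noteq> 0"
    then show "xi_Q (w, s) = s * (s - w) / (2 * w) * Z (w, s)"
      using is_ZQ_imp_xi_Q[of D Z "(w, s)"] by (simp add: field_simps)
  qed
  show "\<forall>s. xi_Q (0, s) = remove_sings (\<lambda>s. - (s\<^sup>2 / 8) * (1 - 2 powr (1 + s / 2)) * (1 - 2 powr (1 - s / 2))
              * completed_zeta (s / 2) * completed_zeta (- (s / 2))) s"
    by (intro allI xi_Q_0_eq_remove_sings)
  show "\<forall>t::real. t \<noteq> 0 \<longrightarrow> xi_Q (0, \<i> * of_real t) = of_real (xi_Q_axis t)"
    by (intro allI impI xi_Q_imaginary_axis(1))
  show half: "xi_Q (0, 0) = 1 / 2" by (simp add: xi_Q_def)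
  show "((\<lambda>t::real. of_real (xi_Q_axis t)) \<longlongrightarrow> xi_Q (0, 0)) (at 0)"
  proof (rule Lim_transform_eventually)
    have "((\<lambda>t::real. \<i> * complex_of_real t) \<longlongrightarrow> \<i> * of_real 0) (at 0)" by (intro tendsto_intros)
    then have "((\<lambda>t::real. \<i> * complex_of_real t) \<longlongrightarrow> 0) (at 0)" by simp
    then show "((\<lambda>t::real. xi_Q (0, \<i> * of_real t)) \<longlongrightarrow> xi_Q (0, 0)) (at 0)"
      by (rule isCont_tendsto_compose[OF isCont_xi_Q_0])
    show "\<forall>\<^sub>F t::real in at 0. xi_Q (0, \<i> * of_real t) = of_real (xi_Q_axis t)"
      using eventually_neq_at_within[of "0 :: real"] by eventually_elim (rule xi_Q_imaginary_axis(1))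
  qed
  show "\<forall>t::real. xi_Q (0, \<i> * of_real t) \<in> \<real> \<and> 0 < Re (xi_Q (0, \<i> * of_real t))"
  proof
    fix t :: real
    show "xi_Q (0, \<i> * of_real t) \<in> \<real> \<and> 0 < Re (xi_Q (0, \<i> * of_real t))"
    proof (cases "t = 0")
      case True
      then have "xi_Q (0, \<i> * of_real t) = of_real (1 / 2)" by (simp add: xi_Q_def)
      then show ?thesis by (simp only: Reals_of_real Re_complex_of_real) simp
    next
      case False
      show ?thesis
        unfolding xi_Q_imaginary_axis(1)[OF False] Re_complex_of_real
        using xi_Q_imaginary_axis(2)[OF False] Reals_of_real by blast
    qed
  qed
qed

end
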